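(* Let $\lambda\in\mathrm{Par}_n^{\le 2}$ and $\mathfrak t\in\mathrm{Std}(\lambda)$, and let $s_i=(i,i+1)\in\mathfrak S_n$ be a simple transposition. All identities below are in the right $\mathsf{TL}_n^{\mathbb Q}$-module $\Delta^{\mathbb Q}(\lambda)$. Suppose first that $\mathfrak t s_i\in\mathrm{Std}(\lambda)$ and $\mathfrak t\trianglelefteq \mathfrak t s_i$. Put $\mathfrak t_d:=\mathfrak t$, $\mathfrak t_u:=\mathfrak t s_i$ and $r:=c_{\mathfrak t_u}(i)-c_{\mathfrak t_d}(i)$. Then (a) $f_{\mathfrak t_d}u_i=\dfrac{r+1}{r}f_{\mathfrak t_d}+\dfrac{r^2-1}{r^2}f_{\mathfrak t_u}$; (b) $f_{\mathfrak t_u}u_i=\dfrac{r-1}{r}f_{\mathfrak t_u}+f_{\mathfrak t_d}$. Suppose next that $\mathfrak t s_i\notin\mathrm{Std}(\lambda)$. Then (c) $f_{\mathfrak t}u_i=0$ if $i,i+1$ are in the same column of $\mathfrak t$; (d) $f_{\mathfrak t}u_i=2f_{\mathfrak t}$ if $i,i+1$ are in the same row of $\mathfrak t$.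
   Context: **Temperley-Lieb algebra.** $\mathsf{TL}_n^{\mathbb Q}$ is the $\mathbb Q$-algebra with basis the non-crossing planar matchings (diagrams) of $n$ top and $n$ bottom points; $D_1D_2$ is the concatenation with $D_1$ on top of $D_2$, each closed loop being replaced by the scalar $2$. $u_i$ ($1\le i<n$) is the diagram joining the top points $i,i+1$, joining the bottom points $i,i+1$, and with vertical lines elsewhere. More generally, let $\mathrm{Hom}(a,b)$ be the $\mathbb Q$-span of non-crossing matchings with $a$ top and $b$ bottom points, composed in the same way. $\mathbf{JW}_m\in\mathsf{TL}_m^{\mathbb Q}$ is the Jones-Wenzl idempotent: the unique nonzero idempotent with $u_i\mathbf{JW}_m=\mathbf{JW}_mu_i=0$ for all $i$. **Tableaux.** $\mathrm{Par}_n^{\le2}$ is the set of partitions of $n$ whose Young diagram has at most two columns; $\mathrm{Std}(\lambda)$ is the set of standard $\lambda$-tableaux (entries $1,\dots,n$ increasing along rows and down columns). $\mathfrak S_n$ acts on tableaux by permuting entries. The content is $c_{\mathfrak t}(i)=c-r$ if $i$ is in row $r$ and column $c$ of $\mathfrak t$. For standard tableaux, $\mathfrak s\trianglelefteq\mathfrak t$ means that for each $m$ the shape of $\mathfrak s$ restricted to the entries $\le m$ is dominated by that of $\mathfrak t$ restricted to the entries $\le m$ (dominance order on partitions). **Cell module.** For $\lambda=(2^{l_2},1^{l_1-l_2})\in\mathrm{Par}_n^{\le2}$, $\Delta^{\mathbb Q}(\lambda)$ is the quotient of $\mathrm{Hom}(l_1-l_2,n)$ by the span of those diagrams in which two top points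 are joined; $\mathsf{TL}_n^{\mathbb Q}$ acts on the right by concatenation below. **The elements $f_{\mathfrak t}$.** A two-column standard tableau $\mathfrak t$ determines a unique sequence of consecutive blocks of consecutive integers $D_1,M_1,D_2,M_2,\dots,D_k,M_k$ (in increasing order, with union $\{1,\dots,n\}$), all non-empty except that $M_k$ may be empty, such that the $D_i$ lie in the first column and the $M_i$ in the second. Put $d_i=|D_i|$, $m_i=|M_i|$, $n_i=(d_1+\dots+d_i)-(m_1+\dots+m_{i-1})$. Define $g_0$ to be the empty diagram and, recursively for $i=1,\dots,k$: juxtapose $d_i$ vertical lines to the right of $g_{i-1}$; multiply on top by $\mathbf{JW}_{n_i}$; then bend the $m_i$ rightmost top strands around to the right and down to the bottom (without crossings), producing $m_i$ new rightmost bottom points; the result is $g_i\in\mathrm{Hom}(n_i-m_i,\sum_{j\le i}(d_j+m_j))$. Then $f_{\mathfrak t}:=g_k$, considered in $\Delta^{\mathbb Q}(\lambda)$ where $\lambda$ is the shape of $\mathfrak t$. *)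

theory Defs
  imports
    Complex_Main
    "HOL-Library.Poly_Mapping"
    "HOL-Library.Disjoint_Sets"
    "HOL-Combinatorics.Transposition"
begin

section \<open>Temperley-Lieb diagrams\<close>

text \<open>Boundary points are numbered from 1, from left to right.\<close>

datatype point = Top nat | Bot nat

type_synonym diagram = "point set set"

definition points :: "nat \<Rightarrow> nat \<Rightarrow> point set" where
  "points a b = Top ` {1..a} \<union> Bot ` {1..b}"

text \<open>Position on the boundary of the strip, read from the rightmost top point leftwards along the
  top and then rightwards along the bottom.\<close>

fun bpos :: "point \<Rightarrow> int" where
  "bpos (Top i) = - int i"
| "bpos (Bot j) = int j"

definition noncrossing :: "diagram \<Rightarrow> bool" where
  "noncrossing D \<longleftrightarrow>
     \<not> (\<exists>p q r s. {p, q} \<in> D \<and> {r, s} \<in> D \<and>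
          bpos p < bpos r \<and> bpos r < bpos q \<and> bpos q < bpos s)"

definition diagrams :: "nat \<Rightarrow> nat \<Rightarrow> diagram set" where
  "diagrams a b = {D. partition_on (points a b) D \<and> (\<forall>e\<in>D. card e = 2) \<and> noncrossing D}"

text \<open>Stacking \<open>D\<^sub>1\<close> on top of \<open>D\<^sub>2\<close>: the bottom points of \<open>D\<^sub>1\<close> and the top points of \<open>D\<^sub>2\<close>
  are identified and become the \<open>Middle\<close> nodes.\<close>

datatype node = Upper nat | Middle nat | Lower nat

fun upper_node :: "point \<Rightarrow> node" where
  "upper_node (Top i) = Upper i"
| "upper_node (Bot i) = Middle i"

fun lower_node :: "point \<Rightarrow> node" where
  "lower_node (Top i) = Middle i"
| "lower_node (Bot i) = Lower i"

fun outer_node :: "point \<Rightarrow> node" where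
  "outer_node (Top i) = Upper i"
| "outer_node (Bot i) = Lower i"

definition stack :: "diagram \<Rightarrow> diagram \<Rightarrow> node set set" where
  "stack D1 D2 = (\<lambda>e. upper_node ` e) ` D1 \<union> (\<lambda>e. lower_node ` e) ` D2"

definition connected_in :: "node set set \<Rightarrow> (node \<times> node) set" where
  "connected_in E = {(x, y). {x, y} \<in> E}\<^sup>*"

definition diagram_comp :: "diagram \<Rightarrow> diagram \<Rightarrow> diagram" where
  "diagram_comp D1 D2 =
     {{p, q} | p q. p \<noteq> q \<and> (outer_node p, outer_node q) \<in> connected_in (stack D1 D2)}"

text \<open>Closed loops are the connected components of the stacked picture not reaching the boundary.\<close>

definition closed_loops :: "diagram \<Rightarrow> diagram \<Rightarrow> node set set" where
  "closed_loops D1 D2 =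
     {C. \<exists>x \<in> \<Union>(stack D1 D2). C = connected_in (stack D1 D2) `` {x} \<and> C \<subseteq> range Middle}"


section \<open>Linear combinations of diagrams\<close>

type_synonym comb = "diagram \<Rightarrow>\<^sub>0 rat"

definition comb_scale :: "rat \<Rightarrow> ('a \<Rightarrow>\<^sub>0 rat) \<Rightarrow> ('a \<Rightarrow>\<^sub>0 rat)" where
  "comb_scale c x = Poly_Mapping.map ((*) c) x"

lemma lookup_scale: "Poly_Mapping.lookup (comb_scale c x) k = c * Poly_Mapping.lookup x k"
  by (simp add: comb_scale_def Poly_Mapping.map.rep_eq when_def)

global_interpretation comb: vector_space "comb_scale :: rat \<Rightarrow> ('a \<Rightarrow>\<^sub>0 rat) \<Rightarrow> ('a \<Rightarrow>\<^sub>0 rat)"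
  by unfold_locales
    (simp_all add: poly_mapping_eq_iff fun_eq_iff lookup_scale lookup_add algebra_simps)

definition of_diagram :: "diagram \<Rightarrow> comb" where
  "of_diagram D = Poly_Mapping.single D 1"

definition Hom :: "nat \<Rightarrow> nat \<Rightarrow> comb set" where
  "Hom a b = comb.span (of_diagram ` diagrams a b)"

definition lin_ext :: "(diagram \<Rightarrow> diagram) \<Rightarrow> comb \<Rightarrow> comb" where
  "lin_ext \<phi> x = (\<Sum>D\<in>Poly_Mapping.keys x. Poly_Mapping.single (\<phi> D) (Poly_Mapping.lookup x D))"

definition hom_comp :: "comb \<Rightarrow> comb \<Rightarrow> comb"  (infixl "\<odot>" 70) where
  "x \<odot> y = (\<Sum>D1\<in>Poly_Mapping.keys x. \<Sum>D2\<in>Poly_Mapping.keys y.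
     Poly_Mapping.single (diagram_comp D1 D2)
       (Poly_Mapping.lookup x D1 * Poly_Mapping.lookup y D2 * 2 ^ card (closed_loops D1 D2)))"

definition u_diagram :: "nat \<Rightarrow> nat \<Rightarrow> diagram" where
  "u_diagram n i = {{Top i, Top (i + 1)}, {Bot i, Bot (i + 1)}} \<union>
     {{Top j, Bot j} | j. j \<in> {1..n} - {i, i + 1}}"

definition u_elem :: "nat \<Rightarrow> nat \<Rightarrow> comb" where
  "u_elem n i = of_diagram (u_diagram n i)"

definition JW :: "nat \<Rightarrow> comb" where
  "JW m = (THE x. x \<in> Hom m m \<and> x \<noteq> 0 \<and> x \<odot> x = x \<and>
     (\<forall>i. 1 \<le> i \<and> i < m \<longrightarrow> u_elem m i \<odot> x = 0 \<and> x \<odot> u_elem m i = 0))"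

text \<open>\<open>juxtapose a b d\<close> maps \<open>Hom a b\<close> to \<open>Hom (a + d) (b + d)\<close>.\<close>

definition juxtapose :: "nat \<Rightarrow> nat \<Rightarrow> nat \<Rightarrow> comb \<Rightarrow> comb" where
  "juxtapose a b d = lin_ext (\<lambda>D. D \<union> {{Top (a + j), Bot (b + j)} | j. j \<in> {1..d}})"

text \<open>\<open>bend a b m\<close> maps \<open>Hom a b\<close> to \<open>Hom (a - m) (b + m)\<close> for \<open>m \<le> a\<close>. The order of the bent
  points is reversed: \<open>Top a\<close> becomes \<open>Bot (b + 1)\<close> and \<open>Top (a - m + 1)\<close> becomes \<open>Bot (b + m)\<close>.\<close>

fun bend_point :: "nat \<Rightarrow> nat \<Rightarrow> nat \<Rightarrow> point \<Rightarrow> point" where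
  "bend_point a b m (Top j) = (if a < j + m then Bot (b + (a + 1 - j)) else Top j)"
| "bend_point a b m (Bot j) = Bot j"

definition bend :: "nat \<Rightarrow> nat \<Rightarrow> nat \<Rightarrow> comb \<Rightarrow> comb" where
  "bend a b m = lin_ext (\<lambda>D. (\<lambda>e. bend_point a b m ` e) ` D)"


section \<open>Partitions and tableaux\<close>

text \<open>A partition is the list of its (positive) row lengths, a tableau the list of its rows.\<close>

definition partitions_of :: "nat \<Rightarrow> nat list set" where
  "partitions_of n = {\<mu>. sorted_wrt (\<ge>) \<mu> \<and> 0 \<notin> set \<mu> \<and> sum_list \<mu> = n}"

definition Par2 :: "nat \<Rightarrow> nat list set" where
  "Par2 n = {\<mu> \<in> partitions_of n. \<forall>p \<in> set \<mu>. p \<le> 2}"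

definition col_length :: "nat list \<Rightarrow> nat \<Rightarrow> nat" where
  "col_length \<mu> c = length (filter (\<lambda>p. c \<le> p) \<mu>)"

type_synonym tableau = "nat list list"

definition Std :: "nat list \<Rightarrow> tableau set" where
  "Std \<mu> = {t. map length t = \<mu> \<and>
     distinct (concat t) \<and> set (concat t) = {1..sum_list \<mu>} \<and>
     (\<forall>r < length t. sorted_wrt (<) (t ! r)) \<and>
     (\<forall>r c. r + 1 < length t \<and> c < length (t ! (r + 1)) \<longrightarrow> t ! r ! c < t ! (r + 1) ! c)}"

definition swap_entries :: "nat \<Rightarrow> tableau \<Rightarrow> tableau" where
  "swap_entries i t = map (map (transpose i (i + 1))) t"

text \<open>Rows and columns of tableaux are numbered from 0; this does not affect contents.\<close>

definition cell_of :: "tableau \<Rightarrow> nat \<Rightarrow> nat \<times> nat" where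
  "cell_of t i = (THE (r, c). r < length t \<and> c < length (t ! r) \<and> t ! r ! c = i)"

definition row_of :: "tableau \<Rightarrow> nat \<Rightarrow> nat" where
  "row_of t i = fst (cell_of t i)"

definition col_of :: "tableau \<Rightarrow> nat \<Rightarrow> nat" where
  "col_of t i = snd (cell_of t i)"

definition content :: "tableau \<Rightarrow> nat \<Rightarrow> int" where
  "content t i = int (col_of t i) - int (row_of t i)"

definition dominated :: "nat list \<Rightarrow> nat list \<Rightarrow> bool" where
  "dominated \<mu> \<nu> \<longleftrightarrow> (\<forall>k. sum_list (take k \<mu>) \<le> sum_list (take k \<nu>))"

definition restricted_shape :: "tableau \<Rightarrow> nat \<Rightarrow> nat list" where
  "restricted_shape t m = filter (\<lambda>p. p \<noteq> 0) (map (\<lambda>row. length (filter (\<lambda>x. x \<le> m) row)) t)"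

definition tab_dominated :: "tableau \<Rightarrow> tableau \<Rightarrow> bool"  (infix "\<unlhd>" 50) where
  "s \<unlhd> t \<longleftrightarrow> (\<forall>m. dominated (restricted_shape s m) (restricted_shape t m))"


section \<open>The cell module\<close>

text \<open>For \<open>\<mu> = (2\<^bsup>l\<^sub>2\<^esup>, 1\<^bsup>l\<^sub>1 - l\<^sub>2\<^esup>)\<close> the column lengths are \<open>l\<^sub>1\<close> and \<open>l\<^sub>2\<close>. Elements of
  the cell module are the equivalence classes of \<open>cell_rel\<close>.\<close>

abbreviation cell_hom :: "nat list \<Rightarrow> comb set" where
  "cell_hom \<mu> \<equiv> Hom (col_length \<mu> 1 - col_length \<mu> 2) (sum_list \<mu>)"

definition cell_null :: "nat list \<Rightarrow> comb set" where
  "cell_null \<mu> = comb.span (of_diagram `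
     {D \<in> diagrams (col_length \<mu> 1 - col_length \<mu> 2) (sum_list \<mu>). \<exists>i j. {Top i, Top j} \<in> D})"

definition cell_rel :: "nat list \<Rightarrow> (comb \<times> comb) set" where
  "cell_rel \<mu> = {(x, y). x \<in> cell_hom \<mu> \<and> y \<in> cell_hom \<mu> \<and> x - y \<in> cell_null \<mu>}"

definition cell_class :: "nat list \<Rightarrow> comb \<Rightarrow> comb set" where
  "cell_class \<mu> x = cell_rel \<mu> `` {x}"

definition cell_module :: "nat list \<Rightarrow> comb set set" where
  "cell_module \<mu> = cell_hom \<mu> // cell_rel \<mu>"

definition cell_zero :: "nat list \<Rightarrow> comb set" where
  "cell_zero \<mu> = cell_class \<mu> 0"

definition cell_add :: "nat list \<Rightarrow> comb set \<Rightarrow> comb set \<Rightarrow> comb set" where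
  "cell_add \<mu> X Y = (\<Union>x\<in>X. \<Union>y\<in>Y. cell_class \<mu> (x + y))"

definition cell_scale :: "nat list \<Rightarrow> rat \<Rightarrow> comb set \<Rightarrow> comb set" where
  "cell_scale \<mu> c X = (\<Union>x\<in>X. cell_class \<mu> (comb_scale c x))"

definition cell_act :: "nat list \<Rightarrow> comb set \<Rightarrow> comb \<Rightarrow> comb set" where
  "cell_act \<mu> X a = (\<Union>x\<in>X. cell_class \<mu> (x \<odot> a))"

lemma equiv_cell_rel:
  "equiv (cell_hom \<mu>) (cell_rel \<mu>)"
proof (rule equivI)
  show "sym (cell_rel \<mu>)"
  proof (rule symI)
    fix x y assume xy: "(x, y) \<in> cell_rel \<mu>"
    then have "- (x - y) \<in> cell_null \<mu>"
      unfolding cell_rel_def cell_null_def by (blast intro: comb.span_neg)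
    with xy show "(y, x) \<in> cell_rel \<mu>"
      by (simp add: cell_rel_def)
  qed
  show "trans (cell_rel \<mu>)"
  proof (rule transI)
    fix x y z assume xyz: "(x, y) \<in> cell_rel \<mu>" "(y, z) \<in> cell_rel \<mu>"
    then have "(x - y) + (y - z) \<in> cell_null \<mu>"
      unfolding cell_rel_def cell_null_def by (blast intro: comb.span_add)
    with xyz show "(x, z) \<in> cell_rel \<mu>"
      by (simp add: cell_rel_def)
  qed
qed (auto simp: cell_rel_def refl_on_def cell_null_def comb.span_zero)

lemma cell_add_class:
  assumes "x \<in> cell_hom \<mu>"
    and "y \<in> cell_hom \<mu>"
  shows "cell_add \<mu> (cell_class \<mu> x) (cell_class \<mu> y) = cell_class \<mu> (x + y)"
proof -
  have *: "cell_class \<mu> (x' + y') = cell_class \<mu> (x + y)"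
    if xx: "(x, x') \<in> cell_rel \<mu>" and yy: "(y, y') \<in> cell_rel \<mu>" for x' y'
  proof -
    have "(x - x') + (y - y') \<in> cell_null \<mu>"
      using xx yy unfolding cell_rel_def cell_null_def by (blast intro: comb.span_add)
    moreover have "(x + y) - (x' + y') = (x - x') + (y - y')"
      by (rule add_diff_add)
    ultimately have "(x + y) - (x' + y') \<in> cell_null \<mu>"
      by metis
    then have "(x + y, x' + y') \<in> cell_rel \<mu>"
      using xx yy unfolding cell_rel_def Hom_def by (blast intro: comb.span_add)
    then show ?thesis
      unfolding cell_class_def using equiv_class_eq[OF equiv_cell_rel] by metis
  qed
  have "(x, x) \<in> cell_rel \<mu>" "(y, y) \<in> cell_rel \<mu>"
    using assms by (auto simp: cell_rel_def cell_null_def comb.span_zero)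
  then have "x \<in> cell_class \<mu> x" "y \<in> cell_class \<mu> y"
    by (auto simp: cell_class_def)
  moreover have "cell_class \<mu> (x' + y') = cell_class \<mu> (x + y)"
    if "x' \<in> cell_class \<mu> x" "y' \<in> cell_class \<mu> y" for x' y'
    using that * by (simp add: cell_class_def)
  ultimately show ?thesis
    unfolding cell_add_def by blast
qed

lemma cell_scale_class:
  assumes "x \<in> cell_hom \<mu>"
  shows "cell_scale \<mu> c (cell_class \<mu> x) = cell_class \<mu> (comb_scale c x)"
proof -
  have *: "cell_class \<mu> (comb_scale c x') = cell_class \<mu> (comb_scale c x)"
    if xx: "(x, x') \<in> cell_rel \<mu>" for x'
  proof -
    have "comb_scale c (x - x') \<in> cell_null \<mu>"
      using xx unfolding cell_rel_def cell_null_def by (blast intro: comb.span_scale)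
    then have "(comb_scale c x, comb_scale c x') \<in> cell_rel \<mu>"
      using xx unfolding cell_rel_def Hom_def
      by (simp add: comb.span_scale comb.scale_right_diff_distrib)
    then show ?thesis
      unfolding cell_class_def using equiv_class_eq[OF equiv_cell_rel] by metis
  qed
  have "(x, x) \<in> cell_rel \<mu>"
    using assms by (auto simp: cell_rel_def cell_null_def comb.span_zero)
  then have "x \<in> cell_class \<mu> x"
    by (auto simp: cell_class_def)
  moreover have "cell_class \<mu> (comb_scale c x') = cell_class \<mu> (comb_scale c x)"
    if "x' \<in> cell_class \<mu> x" for x'
    using that * by (simp add: cell_class_def)
  ultimately show ?thesis
    unfolding cell_scale_def by blast
qed


section \<open>The elements attached to two-column tableaux\<close>

text \<open>The blocks \<open>D\<^sub>1, M\<^sub>1, \<dots>, D\<^sub>k, M\<^sub>k\<close> are recorded by the list of their sizes \<open>(d\<^sub>i, m\<^sub>i)\<close>;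
  as they are consecutive, they are determined by these sizes.\<close>

definition is_block_seq :: "tableau \<Rightarrow> (nat \<times> nat) list \<Rightarrow> bool" where
  "is_block_seq t bs \<longleftrightarrow>
     concat (map (\<lambda>(d, m). replicate d 0 @ replicate m 1) bs) =
       map (col_of t) [1..<length (concat t) + 1] \<and>
     (\<forall>j < length bs. fst (bs ! j) > 0) \<and>
     (\<forall>j. j + 1 < length bs \<longrightarrow> snd (bs ! j) > 0)"

definition block_seq :: "tableau \<Rightarrow> (nat \<times> nat) list" where
  "block_seq t = (THE bs. is_block_seq t bs)"

text \<open>With list positions starting at 0, \<open>through bs i\<close> is \<open>n\<^bsub>i+1\<^esub>\<close>, and \<open>gdiag bs i\<close> is \<open>g\<^sub>i\<close>
  with \<open>consumed bs i\<close> bottom points.\<close>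

definition through :: "(nat \<times> nat) list \<Rightarrow> nat \<Rightarrow> nat" where
  "through bs i = (\<Sum>j\<le>i. fst (bs ! j)) - (\<Sum>j<i. snd (bs ! j))"

definition consumed :: "(nat \<times> nat) list \<Rightarrow> nat \<Rightarrow> nat" where
  "consumed bs i = (\<Sum>j<i. fst (bs ! j) + snd (bs ! j))"

primrec gdiag :: "(nat \<times> nat) list \<Rightarrow> nat \<Rightarrow> comb" where
  "gdiag bs 0 = of_diagram {}"
| "gdiag bs (Suc i) =
     (let d = fst (bs ! i); m = snd (bs ! i); n = through bs i; b = consumed bs i
      in bend n (b + d) m (JW n \<odot> juxtapose (n - d) b d (gdiag bs i)))"

definition f_elem :: "nat list \<Rightarrow> tableau \<Rightarrow> comb set" where
  "f_elem \<mu> t = cell_class \<mu> (gdiag (block_seq t) (length (block_seq t)))"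

end

theory Submission
  imports Defs
begin

text \<open>
  Colour the boundary points with two colours and let a diagram act as the 0/1-matrix of the
  colourings that are constant on its edges.  As there are two colours, a closed loop contributes
  the factor 2, so stacking diagrams becomes matrix multiplication.  On noncrossing diagrams this
  representation is faithful: colour each point of a diagram by whether it is the first endpoint of
  its edge, twisted by the parity of its position; ordering the diagrams by the sum of the positions
  of their first endpoints makes the evaluation at these colourings unitriangular.

  For matrices the Jones-Wenzl element is given by Wenzl's recursion
  \<open>P (k + 1) = P k \<otimes> 1 - k / (k + 1) (P k \<otimes> 1) u (P k \<otimes> 1)\<close>.  Because \<open>P\<close> absorbs smaller \<open>P\<close>, the
  element \<open>f\<close> of a tableau can be built one entry at a time: an entry of the first column adds a
  strand and multiplies by \<open>P\<close> on top, an entry of the second column bends one strand.  These steps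
  commute with everything below, so only the two steps for \<open>i\<close> and \<open>i + 1\<close> matter.  Let \<open>X\<close> be the
  element just before them, \<open>k\<close> its number of top points, so that \<open>r = k + 1\<close>, and let \<open>y\<close> be \<open>X\<close>
  with a cup added at the bottom right.  The recursion gives \<open>f\<^sub>d = y - k / (k + 1) f\<^sub>u\<close>, and
  straightening strands gives \<open>f\<^sub>u u = y\<close>, while \<open>y u = 2 y\<close>; (a) and (b) follow.
\<close>

section \<open>Matrices indexed by labellings\<close>

text \<open>Two obstacles shape the proof. \<open>JW m\<close> is a definite description, so nothing
  can be computed with it before existence and uniqueness are known inside \<open>Hom m m\<close>.
  And \<open>diagram_comp\<close> is defined by connectivity, so that associativity, loop counts and
  the straightening of strands would all be arguments about paths. Matrices turn these into finite
  sums; faithfulness carries the results back, and already the identification of \<open>JW m\<close>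
  depends on it.

  The loop value 2 is q + 1/q at q = 1, so quantum integers become ordinary ones. The coefficient k
  / (k + 1) in the recursion is the reciprocal of the factor (k + 1) / k by which closing the last
  strand of P k yields P (k - 1); it is exactly what makes the new u annihilate P (k + 1).

  The four identities hold in \<open>Hom\<close> itself, before passing to the cell module. The
  quotient enters only through the fact that the action of u is well defined on classes.\<close>

type_synonym mat = "bool list \<Rightarrow> bool list \<Rightarrow> rat"

definition labels :: "nat \<Rightarrow> bool list set" where
  "labels n = {v. length v = n}"

text \<open>Sizes are imposed by vanishing elsewhere. Equations between matrices are then equalities
  of functions, and \<open>mat_eqI\<close> only compares entries of the right lengths.\<close>

definition Mat :: "nat \<Rightarrow> nat \<Rightarrow> mat set" where
  "Mat a b = {A. \<forall>s t. A s t \<noteq> 0 \<longrightarrow> length s = a \<and> length t = b}"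

definition mmul :: "nat \<Rightarrow> mat \<Rightarrow> mat \<Rightarrow> mat" where
  "mmul b A B = (\<lambda>s t. \<Sum>v\<in>labels b. A s v * B v t)"

text \<open>The only linear operation: a multiple of a matrix is written with second coefficient 0,
  so that each linear map needs a single rule.\<close>

definition lcomb :: "rat \<Rightarrow> mat \<Rightarrow> rat \<Rightarrow> mat \<Rightarrow> mat" where
  "lcomb a A b B = (\<lambda>s t. a * A s t + b * B s t)"

definition id_mat :: "nat \<Rightarrow> mat" where
  "id_mat n = (\<lambda>s t. if length s = n \<and> s = t then 1 else 0)"

text \<open>
  The matrix counterparts of adding a vertical line on the right and of bending the last top strand
  down to the bottom.
\<close>

definition strand :: "mat \<Rightarrow> mat" where
  "strand A = (\<lambda>s t. if s \<noteq> [] \<and> t \<noteq> [] \<and> last s = last t then A (butlast s) (butlast t) else 0)"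

definition bend_mat :: "mat \<Rightarrow> mat" where
  "bend_mat A = (\<lambda>s t. if t = [] then 0 else A (s @ [last t]) (butlast t))"

text \<open>Points are numbered from 1 and list positions from 0: the points i and i + 1 sit at the
  positions i - 1 and i.\<close>

definition u_mat :: "nat \<Rightarrow> nat \<Rightarrow> mat" where
  "u_mat n i = (\<lambda>s t. if length s = n \<and> length t = n \<and> s ! (i - 1) = s ! i \<and> t ! (i - 1) = t ! i \<and>
     (\<forall>j<n. j \<noteq> i - 1 \<and> j \<noteq> i \<longrightarrow> s ! j = t ! j) then 1 else 0)"

lemma labels_0 [simp]: "labels 0 = {[]}"
  by (auto simp: labels_def)

lemma in_labels [simp]: "v \<in> labels n \<longleftrightarrow> length v = n"
  by (simp add: labels_def)

lemma finite_labels [simp]: "finite (labels n)"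
  using finite_lists_length_eq[of "UNIV :: bool set" n] by (simp add: labels_def)

lemma sum_labels_Suc: "sum h (labels (Suc n)) = (\<Sum>v\<in>labels n. h (v @ [True]) + h (v @ [False]))"
proof -
  have "labels (Suc n) = (\<lambda>v. v @ [True]) ` labels n \<union> (\<lambda>v. v @ [False]) ` labels n" (is "_ = ?A \<union> ?B")
  proof (intro set_eqI iffI)
    fix v assume "v \<in> labels (Suc n)"
    then obtain w x where v: "v = w @ [x]" "length w = n"
      by (auto simp: length_Suc_conv_rev)
    then show "v \<in> ?A \<union> ?B" by (cases x) auto
  qed auto
  moreover have "?A \<inter> ?B = {}" by auto
  ultimately have "sum h (labels (Suc n)) = sum h ?A + sum h ?B"
    by (simp add: sum.union_disjoint)
  then show ?thesis
    by (simp add: sum.reindex inj_on_def sum.distrib)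
qed

lemma Mat_D: "A \<in> Mat a b \<Longrightarrow> A s t \<noteq> 0 \<Longrightarrow> length s = a \<and> length t = b"
  by (simp add: Mat_def)

lemma Mat_zero: "A \<in> Mat a b \<Longrightarrow> length s \<noteq> a \<or> length t \<noteq> b \<Longrightarrow> A s t = 0"
  by (auto simp: Mat_def)

lemma mat_eqI:
  assumes "A \<in> Mat a b" "B \<in> Mat a b"
    and "\<And>s t. length s = a \<Longrightarrow> length t = b \<Longrightarrow> A s t = B s t"
  shows "A = B"
proof (intro ext)
  fix s t
  show "A s t = B s t"
    using assms by (cases "length s = a \<and> length t = b") (auto simp: Mat_zero)
qed

lemma mmul_Mat [intro]:
  assumes A: "A \<in> Mat a b" and B: "B \<in> Mat b c"
  shows "mmul b A B \<in> Mat a c"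
proof (unfold Mat_def, intro CollectI allI impI)
  fix s t assume "mmul b A B s t \<noteq> 0"
  then obtain v where "A s v * B v t \<noteq> 0"
    unfolding mmul_def by (meson sum.not_neutral_contains_not_neutral)
  then show "length s = a \<and> length t = c"
    using Mat_D[OF A] Mat_D[OF B] by (metis mult_eq_0_iff)
qed

lemma lcomb_Mat [intro]: "A \<in> Mat a b \<Longrightarrow> B \<in> Mat a b \<Longrightarrow> lcomb x A y B \<in> Mat a b"
  by (simp add: Mat_def lcomb_def) (metis add_0 mult_zero_right)

lemma id_mat_Mat [intro, simp]: "id_mat n \<in> Mat n n"
  by (auto simp: Mat_def id_mat_def)

lemma strand_Mat [intro]:
  assumes "A \<in> Mat a b" shows "strand A \<in> Mat (Suc a) (Suc b)"
proof (unfold Mat_def, intro CollectI allI impI)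
  fix s t assume "strand A s t \<noteq> 0"
  then have "s \<noteq> []" "t \<noteq> []" "A (butlast s) (butlast t) \<noteq> 0"
    by (auto simp: strand_def split: if_splits)
  with Mat_D[OF assms this(3)] show "length s = Suc a \<and> length t = Suc b"
    by (cases s rule: rev_cases; cases t rule: rev_cases) simp_all
qed

lemma bend_mat_Mat [intro]:
  assumes "A \<in> Mat (Suc a) b" shows "bend_mat A \<in> Mat a (Suc b)"
proof (unfold Mat_def, intro CollectI allI impI)
  fix s t assume "bend_mat A s t \<noteq> 0"
  then have "t \<noteq> []" "A (s @ [last t]) (butlast t) \<noteq> 0"
    by (auto simp: bend_mat_def split: if_splits)
  with Mat_D[OF assms this(2)] show "length s = a \<and> length t = Suc b"
    by (cases t rule: rev_cases) simp_all
qed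

lemma u_mat_Mat [intro, simp]: "u_mat n i \<in> Mat n n"
  by (auto simp: Mat_def u_mat_def)

lemma strand_snoc [simp]: "strand A (s @ [x]) (t @ [y]) = (if x = y then A s t else 0)"
  by (simp add: strand_def)

lemma strand_snoc2 [simp]: "strand A (s @ [x]) (t @ [y, z]) = (if x = z then A s (t @ [y]) else 0)"
  "strand A (s @ [w, x]) (t @ [y]) = (if x = y then A (s @ [w]) t else 0)"
  "strand A (s @ [w, x]) (t @ [y, z]) = (if x = z then A (s @ [w]) (t @ [y]) else 0)"
  by (simp_all add: strand_def butlast_append)

lemma strand_Nil [simp]: "strand A [] t = 0" "strand A s [] = 0"
  by (simp_all add: strand_def)

lemma bend_mat_snoc [simp]: "bend_mat A s (t @ [y]) = A (s @ [y]) t" "bend_mat A s [] = 0"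
  "bend_mat A s (t @ [x, y]) = A (s @ [y]) (t @ [x])"
  by (simp_all add: bend_mat_def butlast_append)

lemma u_mat_last:
  "u_mat (Suc (Suc n)) (Suc n) (s @ [x, y]) (t @ [z, w]) =
     (if length s = n \<and> s = t \<and> x = y \<and> z = w then 1 else 0)"
proof (cases "length s = n \<and> length t = n")
  case True
  have "(\<forall>j<Suc (Suc n). j \<noteq> n \<and> j \<noteq> Suc n \<longrightarrow> (s @ [x, y]) ! j = (t @ [z, w]) ! j) \<longleftrightarrow>
      (\<forall>j<n. s ! j = t ! j)"
    using True by (force simp: nth_append less_Suc_eq)
  also have "\<dots> \<longleftrightarrow> s = t"
    using True by (simp add: list_eq_iff_nth_eq)
  finally show ?thesis
    using True by (simp add: u_mat_def nth_append)
qed (auto simp: u_mat_def)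

lemma mmul_assoc: "mmul c (mmul b A B) C = mmul b A (mmul c B C)"
  unfolding mmul_def
  by (simp add: sum_distrib_left sum_distrib_right mult.assoc) (subst sum.swap, rule refl)

lemma mmul_lcomb_left [simp]: "mmul b (lcomb x A y B) C = lcomb x (mmul b A C) y (mmul b B C)"
  by (simp add: mmul_def lcomb_def fun_eq_iff sum.distrib sum_distrib_left algebra_simps)

lemma mmul_lcomb_right [simp]: "mmul b C (lcomb x A y B) = lcomb x (mmul b C A) y (mmul b C B)"
  by (simp add: mmul_def lcomb_def fun_eq_iff sum.distrib sum_distrib_left algebra_simps)

lemma strand_lcomb: "strand (lcomb x A y B) = lcomb x (strand A) y (strand B)"
  by (simp add: strand_def lcomb_def fun_eq_iff)

lemma bend_mat_lcomb: "bend_mat (lcomb x A y B) = lcomb x (bend_mat A) y (bend_mat B)"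
  by (simp add: bend_mat_def lcomb_def fun_eq_iff)

lemma sum_delta_labels:
  "length s = n \<Longrightarrow> (\<Sum>v\<in>labels n. (if s = v then f v else 0)) = (f s :: rat)"
  by (simp add: sum.delta)

lemma mmul_id_mat_left [simp]: "A \<in> Mat a b \<Longrightarrow> mmul a (id_mat a) A = A"
proof (rule mat_eqI)
  fix s t :: "bool list" assume "length s = a"
  have "mmul a (id_mat a) A s t = (\<Sum>v\<in>labels a. (if s = v then A v t else 0))"
    unfolding mmul_def id_mat_def using \<open>length s = a\<close> by (intro sum.cong) auto
  then show "mmul a (id_mat a) A s t = A s t"
    using \<open>length s = a\<close> by (simp add: sum_delta_labels)
qed auto

lemma mmul_id_mat_right [simp]: "A \<in> Mat a b \<Longrightarrow> mmul b A (id_mat b) = A"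
proof (rule mat_eqI)
  fix s t :: "bool list" assume "length t = b"
  have "mmul b A (id_mat b) s t = (\<Sum>v\<in>labels b. (if t = v then A s v else 0))"
    unfolding mmul_def id_mat_def using \<open>length t = b\<close> by (intro sum.cong) auto
  then show "mmul b A (id_mat b) s t = A s t"
    using \<open>length t = b\<close> by (simp add: sum_delta_labels)
qed auto

lemma strand_id_mat: "strand (id_mat n) = id_mat (Suc n)"
proof (rule mat_eqI[of _ "Suc n" "Suc n"])
  fix s t :: "bool list" assume "length s = Suc n" "length t = Suc n"
  then obtain s' x t' y where "s = s' @ [x]" "t = t' @ [y]"
    by (metis length_Suc_conv_rev)
  then show "strand (id_mat n) s t = id_mat (Suc n) s t"
    using \<open>length s = Suc n\<close> by (auto simp: id_mat_def)
qed auto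

text \<open>\<open>strand\<close> is the tensor product with the identity on one point, hence
  functorial.\<close>

lemma strand_mmul: "strand (mmul b A B) = mmul (Suc b) (strand A) (strand B)"
proof (intro ext)
  fix s t
  show "strand (mmul b A B) s t = mmul (Suc b) (strand A) (strand B) s t"
    by (cases s rule: rev_cases; cases t rule: rev_cases)
      (auto simp: mmul_def sum_labels_Suc intro!: sum.cong sum.neutral)
qed

text \<open>The bent strand runs past A untouched, so a factor on the other top points can be taken
  out of the bend.\<close>

lemma bend_mat_mmul_left: "bend_mat (mmul (Suc b) (strand A) B) = mmul b A (bend_mat B)"
proof (intro ext)
  fix s t
  show "bend_mat (mmul (Suc b) (strand A) B) s t = mmul b A (bend_mat B) s t"
    by (cases t rule: rev_cases) (auto simp: mmul_def sum_labels_Suc intro!: sum.cong)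
qed

text \<open>What is multiplied at the bottom acts as the identity on the new rightmost bottom
  point.\<close>

lemma bend_mat_mmul_right: "bend_mat (mmul b A B) = mmul (Suc b) (bend_mat A) (strand B)"
proof (intro ext)
  fix s t
  show "bend_mat (mmul b A B) s t = mmul (Suc b) (bend_mat A) (strand B) s t"
    by (cases t rule: rev_cases) (auto simp: mmul_def sum_labels_Suc intro!: sum.cong)
qed

lemma strand_u_mat:
  assumes "1 \<le> i" "i < n" shows "strand (u_mat n i) = u_mat (Suc n) i"
proof (rule mat_eqI[of _ "Suc n" "Suc n"])
  fix s t :: "bool list" assume "length s = Suc n" "length t = Suc n"
  then obtain s' x t' y where st: "s = s' @ [x]" "t = t' @ [y]" "length s' = n" "length t' = n"
    by (metis length_Suc_conv_rev)
  have "(\<forall>j<Suc n. j \<noteq> i - 1 \<and> j \<noteq> i \<longrightarrow> s ! j = t ! j) \<longleftrightarrow>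
     (\<forall>j<n. j \<noteq> i - 1 \<and> j \<noteq> i \<longrightarrow> s ! j = t ! j) \<and> x = y"
    using st assms by (simp only: less_Suc_eq) (auto simp: nth_append)
  also have "(\<forall>j<n. j \<noteq> i - 1 \<and> j \<noteq> i \<longrightarrow> s ! j = t ! j) \<longleftrightarrow>
     (\<forall>j<n. j \<noteq> i - 1 \<and> j \<noteq> i \<longrightarrow> s' ! j = t' ! j)"
    using st by (simp add: nth_append)
  finally have *: "(\<forall>j<Suc n. j \<noteq> i - 1 \<and> j \<noteq> i \<longrightarrow> s ! j = t ! j) \<longleftrightarrow>
     (\<forall>j<n. j \<noteq> i - 1 \<and> j \<noteq> i \<longrightarrow> s' ! j = t' ! j) \<and> x = y" .
  have "s ! (i - 1) = s' ! (i - 1)" "s ! i = s' ! i" "t ! (i - 1) = t' ! (i - 1)" "t ! i = t' ! i"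
    using st assms by (auto simp: nth_append)
  then show "strand (u_mat n i) s t = u_mat (Suc n) i s t"
    using st unfolding u_mat_def * by auto
qed auto

lemma length_Suc_SucE:
  assumes "length s = Suc (Suc n)" obtains s' x y where "s = s' @ [x, y]" "length s' = n"
  using assms by (metis append.assoc append_Cons append_Nil length_Suc_conv_rev)

lemma sum_labels_Suc_Suc: "sum h (labels (Suc (Suc n))) =
   (\<Sum>v\<in>labels n. h (v @ [True, True]) + h (v @ [True, False]) + h (v @ [False, True]) + h (v @ [False, False]))"
  by (simp add: sum_labels_Suc sum.distrib algebra_simps)

lemma if_mult_rat: "(if P then 1 else 0) * (x :: rat) = (if P then x else 0)"
  "x * (if P then 1 else 0) = (if P then x else 0)"
  by auto

lemma u_mat_last_mmul:
  "length s = n \<Longrightarrow> mmul (Suc (Suc n)) (u_mat (Suc (Suc n)) (Suc n)) A (s @ [x, y]) t =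
     (if x = y then A (s @ [True, True]) t + A (s @ [False, False]) t else 0)"
  unfolding mmul_def sum_labels_Suc_Suc
  by (auto simp: u_mat_last if_mult_rat sum.distrib sum.delta sum_delta_labels)

lemma mmul_u_mat_last:
  assumes "length t = n"
  shows "mmul (Suc (Suc n)) A (u_mat (Suc (Suc n)) (Suc n)) s (t @ [x, y]) =
     (if x = y then A s (t @ [True, True]) + A s (t @ [False, False]) else 0)"
proof -
  have *: "(length v = n \<and> v = t \<and> Q) = (t = v \<and> Q)" for v :: "bool list" and Q
    using assms by auto
  show ?thesis
    using assms unfolding mmul_def sum_labels_Suc_Suc
    by (auto simp: u_mat_last if_mult_rat sum.distrib sum.delta sum_delta_labels * cong: if_cong)
qed

text \<open>The last two strands are free on both sides of A, so u slides along them.\<close>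

lemma u_mat_last_strand_strand:
  assumes "A \<in> Mat a b"
  shows "mmul (Suc (Suc b)) (strand (strand A)) (u_mat (Suc (Suc b)) (Suc b)) =
         mmul (Suc (Suc a)) (u_mat (Suc (Suc a)) (Suc a)) (strand (strand A))" (is "?L = ?R")
proof (rule mat_eqI[of _ "Suc (Suc a)" "Suc (Suc b)"])
  show "?L \<in> Mat (Suc (Suc a)) (Suc (Suc b))" "?R \<in> Mat (Suc (Suc a)) (Suc (Suc b))"
    using assms by blast+
  fix s t :: "bool list" assume "length s = Suc (Suc a)" "length t = Suc (Suc b)"
  then show "?L s t = ?R s t"
    by (elim length_Suc_SucE) (simp add: mmul_u_mat_last u_mat_last_mmul)
qed

text \<open>A zigzag: the lower half of u bends the last top strand of A onto the added line, and
  the upper half, once bent, straightens to a vertical line. This turns the correction term of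
  Wenzl's recursion into the element with the two entries exchanged.\<close>

lemma bend_mat_u_mat_strand:
  assumes "A \<in> Mat (Suc k) b"
  shows "bend_mat (mmul (Suc (Suc k)) (u_mat (Suc (Suc k)) (Suc k)) (strand A)) = strand (bend_mat A)" (is "?L = ?R")
proof (rule mat_eqI[of _ "Suc k" "Suc (Suc b)"])
  show "?L \<in> Mat (Suc k) (Suc (Suc b))" "?R \<in> Mat (Suc k) (Suc (Suc b))"
    using assms by blast+
  fix s t :: "bool list" assume "length s = Suc k" "length t = Suc (Suc b)"
  then obtain s' x where s: "s = s' @ [x]" "length s' = k" by (auto simp: length_Suc_conv_rev)
  from \<open>length t = _\<close> obtain t' y z where t: "t = t' @ [y, z]" "length t' = b" by (elim length_Suc_SucE)
  show "?L s t = ?R s t"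
    using s t by (auto simp: u_mat_last_mmul)
qed

text \<open>\<open>bend_mat (strand A)\<close> is A with a cup on its right; u closes this cup to a
  loop, worth 2, and leaves a new cup.\<close>

lemma bend_mat_strand_u_mat:
  assumes "A \<in> Mat k b"
  shows "mmul (Suc (Suc b)) (bend_mat (strand A)) (u_mat (Suc (Suc b)) (Suc b)) = lcomb 2 (bend_mat (strand A)) 0 A" (is "?L = ?R")
proof (rule mat_eqI[of _ k "Suc (Suc b)"])
  \<comment> \<open>The operand \<open>A\<close> with coefficient 0 has the wrong size for
    \<open>lcomb_Mat\<close>; it is exchanged for one of the right size.\<close>
  have "lcomb 2 (bend_mat (strand A)) 0 A = lcomb 2 (bend_mat (strand A)) 0 (bend_mat (strand A))"
    by (simp add: lcomb_def)
  then show "?L \<in> Mat k (Suc (Suc b))" "?R \<in> Mat k (Suc (Suc b))"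
    using assms by auto
  fix s t :: "bool list" assume "length s = k" "length t = Suc (Suc b)"
  then show "?L s t = ?R s t"
    by (elim length_Suc_SucE) (auto simp: mmul_u_mat_last lcomb_def)
qed

text \<open>The reverse zigzag: the upper half of u joins the bent strand to the added line, which
  straightens, and the lower half stays behind as a cup.\<close>

lemma strand_bend_mat_u_mat:
  assumes "A \<in> Mat (Suc k) b"
  shows "mmul (Suc (Suc b)) (strand (bend_mat A)) (u_mat (Suc (Suc b)) (Suc b)) = bend_mat (strand A)" (is "?L = ?R")
proof (rule mat_eqI[of _ "Suc k" "Suc (Suc b)"])
  show "?L \<in> Mat (Suc k) (Suc (Suc b))" "?R \<in> Mat (Suc k) (Suc (Suc b))"
    using assms by blast+
  fix s t :: "bool list" assume "length s = Suc k" "length t = Suc (Suc b)"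
  then obtain s' x where s: "s = s' @ [x]" "length s' = k" by (auto simp: length_Suc_conv_rev)
  from \<open>length t = _\<close> obtain t' y z where t: "t = t' @ [y, z]" "length t' = b" by (elim length_Suc_SucE)
  show "?L s t = ?R s t"
    using s t by (auto simp: mmul_u_mat_last)
qed

text \<open>Once both strands are bent, joining them at the bottom is the same as joining the last
  two top points of A, which gives 0 by assumption.\<close>

lemma bend_mat_bend_mat_u_mat:
  assumes "A \<in> Mat (Suc (Suc k)) b"
    and 0: "mmul (Suc (Suc k)) (u_mat (Suc (Suc k)) (Suc k)) A = (\<lambda>s t. 0)"
  shows "mmul (Suc (Suc b)) (bend_mat (bend_mat A)) (u_mat (Suc (Suc b)) (Suc b)) = (\<lambda>s t. 0)" (is "?L = ?R")
proof (rule mat_eqI[of _ k "Suc (Suc b)"])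
  show "?L \<in> Mat k (Suc (Suc b))" "?R \<in> Mat k (Suc (Suc b))"
    using assms(1) apply auto by (auto simp: Mat_def)
  fix s t :: "bool list" assume s: "length s = k" and "length t = Suc (Suc b)"
  then obtain t' y z where t: "t = t' @ [y, z]" "length t' = b" by (elim length_Suc_SucE)
  have "A (s @ [True, True]) t' + A (s @ [False, False]) t' = 0"
    using fun_cong[OF fun_cong[OF 0], of "s @ [True, True]" t'] s by (simp add: u_mat_last_mmul)
  then show "?L s t = ?R s t"
    using s t by (auto simp: mmul_u_mat_last)
qed

section \<open>Closing the last strand (partial trace) and Wenzl's recursion\<close>

definition ptrace :: "mat \<Rightarrow> mat" where
  "ptrace A = (\<lambda>s t. A (s @ [True]) (t @ [True]) + A (s @ [False]) (t @ [False]))"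

lemma ptrace_lcomb: "ptrace (lcomb x A y B) = lcomb x (ptrace A) y (ptrace B)"
  by (simp add: ptrace_def lcomb_def fun_eq_iff algebra_simps)

lemma ptrace_strand: "ptrace (strand A) = lcomb 1 A 1 A"
  by (simp add: ptrace_def lcomb_def fun_eq_iff)

lemma ptrace_mmul_left: "ptrace (mmul (Suc b) (strand A) B) = mmul b A (ptrace B)"
  by (simp add: ptrace_def mmul_def fun_eq_iff sum_labels_Suc sum.distrib algebra_simps)

lemma ptrace_mmul_right: "ptrace (mmul (Suc b) B (strand A)) = mmul b (ptrace B) A"
  by (simp add: ptrace_def mmul_def fun_eq_iff sum_labels_Suc sum.distrib algebra_simps)

lemma ptrace_Mat: 
  assumes "A \<in> Mat (Suc a) (Suc b)" shows "ptrace A \<in> Mat a b"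
proof (unfold Mat_def, intro CollectI allI impI)
  fix s t assume "ptrace A s t \<noteq> 0"
  then obtain x where "A (s @ [x]) (t @ [x]) \<noteq> 0"
    unfolding ptrace_def by fastforce
  from Mat_D[OF assms this] show "length s = a \<and> length t = b" by simp
qed

lemma ptrace_u_mat: "ptrace (u_mat (Suc (Suc n)) (Suc n)) = id_mat (Suc n)"
proof (rule mat_eqI)
  show "ptrace (u_mat (Suc (Suc n)) (Suc n)) \<in> Mat (Suc n) (Suc n)"
    by (rule ptrace_Mat) simp
  fix s t :: "bool list" assume "length s = Suc n" "length t = Suc n"
  then obtain s' x t' y where st: "s = s' @ [x]" "t = t' @ [y]" "length s' = n" "length t' = n"
    by (metis length_Suc_conv_rev)
  then show "ptrace (u_mat (Suc (Suc n)) (Suc n)) s t = id_mat (Suc n) s t"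
    by (auto simp: ptrace_def u_mat_last id_mat_def)
qed simp

text \<open>Between two copies of u the last strand of A is closed up along the added line, which
  leaves the partial trace of A beside u.\<close>

lemma u_mat_strand_u_mat:
  assumes "A \<in> Mat (Suc n) (Suc n)"
  shows "mmul (Suc (Suc n)) (u_mat (Suc (Suc n)) (Suc n)) (mmul (Suc (Suc n)) (strand A) (u_mat (Suc (Suc n)) (Suc n))) =
         mmul (Suc (Suc n)) (strand (strand (ptrace A))) (u_mat (Suc (Suc n)) (Suc n))" (is "?L = ?R")
proof (rule mat_eqI[of _ "Suc (Suc n)" "Suc (Suc n)"])
  show "?L \<in> Mat (Suc (Suc n)) (Suc (Suc n))" "?R \<in> Mat (Suc (Suc n)) (Suc (Suc n))"
    using assms ptrace_Mat by blast+
  fix s t :: "bool list" assume "length s = Suc (Suc n)" "length t = Suc (Suc n)"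
  then show "?L s t = ?R s t"
    by (elim length_Suc_SucE) (auto simp: mmul_u_mat_last u_mat_last_mmul ptrace_def)
qed

abbreviation zero_mat :: mat where "zero_mat \<equiv> (\<lambda>s t. 0)"

lemma mmul_zero [simp]: "mmul b zero_mat A = zero_mat" "mmul b A zero_mat = zero_mat"
  by (simp_all add: mmul_def)

lemma strand_zero [simp]: "strand zero_mat = zero_mat"
  by (simp add: strand_def fun_eq_iff)

text \<open>For \<open>n = 0\<close> the coefficient vanishes, so the meaningless matrix of \<open>u\<^sub>0\<close> plays no role.\<close>

primrec jw_mat :: "nat \<Rightarrow> mat" where
  "jw_mat 0 = id_mat 0"
| "jw_mat (Suc n) = lcomb 1 (strand (jw_mat n)) (- (rat_of_nat n / rat_of_nat (Suc n)))
     (mmul (Suc n) (strand (jw_mat n)) (mmul (Suc n) (u_mat (Suc n) n) (strand (jw_mat n))))"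

lemma jw_mat_Mat [simp, intro]: "jw_mat n \<in> Mat n n"
  by (induction n) auto

lemma jw_mat_1: "jw_mat (Suc 0) = id_mat (Suc 0)"
  by (simp add: lcomb_def strand_id_mat)

text \<open>The claims need one common induction: annihilation by the last u uses the partial trace
  and the absorption one step earlier, and the next partial trace uses idempotence.\<close>

lemma jw_mat_properties:
  "mmul n (jw_mat n) (jw_mat n) = jw_mat n \<and>
   (\<forall>i. 1 \<le> i \<and> i < n \<longrightarrow> mmul n (u_mat n i) (jw_mat n) = zero_mat \<and> mmul n (jw_mat n) (u_mat n i) = zero_mat) \<and>
   (\<forall>m. n = Suc m \<longrightarrow> ptrace (jw_mat n) = lcomb ((rat_of_nat n + 1) / rat_of_nat n) (jw_mat m) 0 (jw_mat m) \<and>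
      mmul n (jw_mat n) (strand (jw_mat m)) = jw_mat n \<and> mmul n (strand (jw_mat m)) (jw_mat n) = jw_mat n)"
proof (induction n)
  case 0
  show ?case by (simp add: mmul_id_mat_left[OF id_mat_Mat])
next
  case (Suc n)
  define N where "N = Suc n"
  define A Q U where "A = jw_mat n" and "Q = strand A" and "U = u_mat N n"
  define c where "c = rat_of_nat n / rat_of_nat (Suc n)"
  define B where "B = jw_mat N"
  have A: "A \<in> Mat n n" and Q: "Q \<in> Mat N N"
    by (auto simp: A_def Q_def N_def)
  have AA: "mmul n A A = A"
    and kill: "\<And>i. 1 \<le> i \<Longrightarrow> i < n \<Longrightarrow> mmul n (u_mat n i) A = zero_mat \<and> mmul n A (u_mat n i) = zero_mat"
    using Suc.IH unfolding A_def by auto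
  have QQ: "mmul N Q Q = Q"
    unfolding Q_def N_def using AA strand_mmul[of n A A] by simp
  have B: "B = lcomb 1 Q (- c) (mmul N Q (mmul N U Q))"
    by (simp add: B_def N_def Q_def U_def A_def c_def)
  have QB: "mmul N Q B = B"
    unfolding B by (simp add: mmul_assoc[symmetric] QQ)
  have BQ: "mmul N B Q = B"
    unfolding B by (simp add: mmul_assoc QQ)
  have main: "mmul N B B = B \<and> (1 \<le> n \<longrightarrow> mmul N U B = zero_mat \<and> mmul N B U = zero_mat) \<and>
     ptrace B = lcomb ((rat_of_nat N + 1) / rat_of_nat N) A 0 A"
  proof (cases n)
    case 0
    have "ptrace (id_mat (Suc 0)) = lcomb 2 (id_mat 0) 0 (id_mat 0)"
      unfolding strand_id_mat[symmetric] ptrace_strand by (simp add: lcomb_def)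
    then show ?thesis
      using 0 by (simp add: B_def N_def A_def jw_mat_1 mmul_id_mat_left[OF id_mat_Mat] del: jw_mat.simps(2))
  next
    case (Suc m)
    define P TP where "P = jw_mat m" and "TP = strand (strand P)"
    define k where "k = (rat_of_nat n + 1) / rat_of_nat n"
    \<comment> \<open>\<open>k\<close> is the partial trace factor of \<open>A\<close>. This
      cancellation is the reason for the coefficient in the recursion.\<close>
    have ck: "c * k = 1"
      using Suc by (simp add: c_def k_def)
    have P: "P \<in> Mat m m"
      by (simp add: P_def)
    have ptrA: "ptrace A = lcomb k P 0 P" and AP: "mmul n A (strand P) = A" and PA: "mmul n (strand P) A = A"
      using Suc.IH Suc unfolding A_def P_def k_def by auto
    have QTP: "mmul N Q TP = Q" and TPQ: "mmul N TP Q = Q"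
      unfolding Q_def N_def TP_def by (simp_all add: strand_mmul[symmetric] AP PA)
    have TPU: "mmul N TP U = mmul N U TP"
      using u_mat_last_strand_strand[OF P] Suc by (simp add: TP_def U_def N_def)
    \<comment> \<open>Closing a strand of \<open>A\<close> leaves \<open>k\<close> times
      \<open>TP\<close>, which commutes with \<open>U\<close> and is absorbed by a neighbouring
      \<open>Q\<close>. Hence U Q U Q is k U Q.\<close>
    have UQU: "mmul N U (mmul N Q U) = lcomb k (mmul N TP U) 0 U"
    proof -
      have "mmul N U (mmul N Q U) = mmul N (strand (strand (ptrace A))) U"
        using u_mat_strand_u_mat[of A m] A Suc by (simp add: Q_def U_def N_def)
      also have "strand (strand (ptrace A)) = lcomb k TP 0 U"
        unfolding ptrA strand_lcomb TP_def by (simp add: lcomb_def)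
      finally show ?thesis by simp (simp add: lcomb_def)
    qed
    have "mmul N U (mmul N Q (mmul N U Q)) = mmul N (mmul N U (mmul N Q U)) Q"
      by (simp add: mmul_assoc)
    also have "\<dots> = lcomb k (mmul N U Q) 0 U"
      unfolding UQU TPU by (simp add: mmul_assoc TPQ) (simp add: lcomb_def)
    finally have "mmul N U B = lcomb 1 (mmul N U Q) (- c) (lcomb k (mmul N U Q) 0 U)"
      unfolding B by simp
    then have "mmul N U B = zero_mat"
      using ck by (simp add: lcomb_def fun_eq_iff mult.assoc[symmetric])
    moreover have "mmul N (mmul N Q (mmul N U Q)) U = mmul N Q (mmul N U (mmul N Q U))"
      by (simp add: mmul_assoc)
    then have "mmul N (mmul N Q (mmul N U Q)) U = lcomb k (mmul N Q U) 0 U"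
      unfolding UQU by (simp add: mmul_assoc[symmetric] QTP) (simp add: lcomb_def)
    then have "mmul N B U = lcomb 1 (mmul N Q U) (- c) (lcomb k (mmul N Q U) 0 U)"
      unfolding B by simp
    then have "mmul N B U = zero_mat"
      using ck by (simp add: lcomb_def fun_eq_iff mult.assoc[symmetric])
    \<comment> \<open>Only Q B = B survives; in the other summand Q is absorbed by the right factor
      B, and then U meets B.\<close>
    moreover have "mmul N B B = lcomb 1 (mmul N Q B) (- c) (mmul N (mmul N Q (mmul N U Q)) B)"
      by (subst (1) B) simp
    then have "mmul N B B = B"
      using \<open>mmul N U B = zero_mat\<close> by (simp add: mmul_assoc QB) (simp add: lcomb_def)
    \<comment> \<open>Closing the free strand of \<open>Q\<close> gives a loop, worth 2, and closing
      the summand with U gives A A = A. The factor is therefore 2 - c = (N + 1) / N.\<close>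
    moreover have "ptrace B = lcomb ((rat_of_nat N + 1) / rat_of_nat N) A 0 A"
    proof -
      have "ptrace U = id_mat n"
        using ptrace_u_mat[of m] Suc by (simp add: U_def N_def)
      then have "ptrace (mmul N Q (mmul N U Q)) = A"
        using A AA by (simp add: N_def Q_def ptrace_mmul_left ptrace_mmul_right)
      then show ?thesis
        unfolding B ptrace_lcomb unfolding Q_def ptrace_strand
        by (simp add: lcomb_def fun_eq_iff c_def N_def field_simps)
    qed
    ultimately show ?thesis by blast
  qed
  \<comment> \<open>These u act on the first n strands only, and both summands of \<open>B\<close>
    begin and end with \<open>Q\<close>.\<close>
  have kill': "mmul N (u_mat N i) B = zero_mat \<and> mmul N B (u_mat N i) = zero_mat" if i: "1 \<le> i" "i < n" for i
  proof -
    have "mmul N (u_mat N i) Q = zero_mat" "mmul N Q (u_mat N i) = zero_mat"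
      unfolding N_def Q_def strand_u_mat[OF i, symmetric] strand_mmul[symmetric] using kill[OF i] by simp_all
    then show ?thesis
      unfolding B by (simp add: mmul_assoc) (simp add: mmul_assoc[symmetric] lcomb_def)
  qed
  have "mmul N (u_mat N i) B = zero_mat \<and> mmul N B (u_mat N i) = zero_mat" if "1 \<le> i" "i < N" for i
    using kill'[of i] main that by (cases "i < n") (auto simp: N_def U_def less_Suc_eq)
  with main QB BQ show ?case
    unfolding B_def Q_def A_def N_def by (simp del: jw_mat.simps(2))
qed

lemma jw_mat_idem [simp]: "mmul n (jw_mat n) (jw_mat n) = jw_mat n"
  using jw_mat_properties by blast

lemma u_mat_jw_mat: "1 \<le> i \<Longrightarrow> i < n \<Longrightarrow> mmul n (u_mat n i) (jw_mat n) = zero_mat"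
  using jw_mat_properties by blast

lemma jw_mat_u_mat: "1 \<le> i \<Longrightarrow> i < n \<Longrightarrow> mmul n (jw_mat n) (u_mat n i) = zero_mat"
  using jw_mat_properties by blast

lemma jw_mat_strand_jw_mat: "mmul (Suc n) (jw_mat (Suc n)) (strand (jw_mat n)) = jw_mat (Suc n)"
  using jw_mat_properties[of "Suc n"] by blast

lemma strand_jw_mat_jw_mat: "mmul (Suc n) (strand (jw_mat n)) (jw_mat (Suc n)) = jw_mat (Suc n)"
  using jw_mat_properties[of "Suc n"] by blast

text \<open>Closing the last strand gives a nonzero multiple of the previous projector, so the claim
  climbs up from the empty one.\<close>

lemma jw_mat_nonzero: "jw_mat n \<noteq> zero_mat"
proof (induction n)
  case 0
  have "jw_mat 0 [] [] = 1" by (simp add: id_mat_def)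
  then show ?case by (metis zero_neq_one)
next
  case (Suc n)
  have "ptrace (jw_mat (Suc n)) = lcomb ((rat_of_nat (Suc n) + 1) / rat_of_nat (Suc n)) (jw_mat n) 0 (jw_mat n)"
    using jw_mat_properties[of "Suc n"] by blast
  moreover have "(rat_of_nat (Suc n) + 1) / rat_of_nat (Suc n) \<noteq> 0"
    by (simp add: add_eq_0_iff)
  ultimately have "ptrace (jw_mat (Suc n)) \<noteq> zero_mat"
    using Suc by (auto simp: lcomb_def fun_eq_iff)
  then show ?case
    by (auto simp: ptrace_def)
qed

text \<open>
  Combinations of labels in the \<open>u\<^sub>i\<close>.  Since \<open>P\<close> is one of them, composing with it stays inside the
  noncrossing diagrams, and closure under general composition is never needed.
\<close>

inductive_set u_span :: "nat \<Rightarrow> mat set" for n where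
  u_span_id_mat: "id_mat n \<in> u_span n"
| u_span_u_mat: "1 \<le> i \<Longrightarrow> i < n \<Longrightarrow> A \<in> u_span n \<Longrightarrow> mmul n (u_mat n i) A \<in> u_span n"
| u_span_lcomb: "A \<in> u_span n \<Longrightarrow> B \<in> u_span n \<Longrightarrow> lcomb x A y B \<in> u_span n"

lemma u_span_Mat: "A \<in> u_span n \<Longrightarrow> A \<in> Mat n n"
  by (induction rule: u_span.induct) auto

lemma u_span_mmul: "A \<in> u_span n \<Longrightarrow> B \<in> u_span n \<Longrightarrow> mmul n A B \<in> u_span n"
  by (induction rule: u_span.induct)
    (simp_all add: mmul_id_mat_left[OF u_span_Mat] mmul_assoc u_span.intros)

lemma u_span_strand: "A \<in> u_span n \<Longrightarrow> strand A \<in> u_span (Suc n)"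
proof (induction rule: u_span.induct)
  case u_span_id_mat
  then show ?case by (simp add: strand_id_mat u_span.intros)
next
  case (u_span_u_mat i A)
  then show ?case
    by (simp add: strand_mmul strand_u_mat u_span.u_span_u_mat)
qed (simp add: strand_lcomb u_span.u_span_lcomb)

lemma u_mat_in_u_span: "1 \<le> i \<Longrightarrow> i < n \<Longrightarrow> u_mat n i \<in> u_span n"
  using u_span.u_span_u_mat[OF _ _ u_span.u_span_id_mat, of i n] mmul_id_mat_right[OF u_mat_Mat, of n i] by simp

lemma jw_mat_u_span: "jw_mat n \<in> u_span n"
proof (induction n)
  case 0
  show ?case by (simp add: u_span.intros)
next
  case (Suc n)
  show ?case
  proof (cases "n = 0")
    case True
    then show ?thesis by (simp add: jw_mat_1 u_span.intros del: jw_mat.simps(2))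
  next
    case False
    then show ?thesis
      using Suc by (auto intro!: u_span_lcomb u_span_mmul u_span_strand u_mat_in_u_span)
  qed
qed

section \<open>Column words, and the elements f built one letter at a time\<close>

definition height :: "nat list \<Rightarrow> nat" where
  "height w = count_list w 0 - count_list w 1"

text \<open>Letter 0 stands for the first column and 1 for the second. The prefix condition says
  that there is always a strand to bend, and it makes the natural-number subtraction in
  \<open>height\<close> exact.\<close>

definition ballot :: "nat list \<Rightarrow> bool" where
  "ballot w \<longleftrightarrow> set w \<subseteq> {0, 1} \<and> (\<forall>p q. w = p @ q \<longrightarrow> count_list p 1 \<le> count_list p 0)"

lemma ballot_append: "ballot (p @ q) \<Longrightarrow> ballot p"
  unfolding ballot_def by auto

lemma ballot_count: "ballot p \<Longrightarrow> count_list p 1 \<le> count_list p 0"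
  unfolding ballot_def by (metis append_Nil2)

lemma height_snoc_0: "ballot p \<Longrightarrow> height (p @ [0]) = Suc (height p)"
  using ballot_count[of p] by (simp add: height_def)

lemma height_snoc_1: "ballot (p @ [1]) \<Longrightarrow> height p = Suc (height (p @ [1]))"
  using ballot_count[of "p @ [1]"] by (simp add: height_def)

text \<open>The matrix grows with the last letter while lists recurse on the head, hence the
  reversed word. A projector is inserted at each 0, not once per block as in \<open>gdiag\<close>;
  \<open>word_mat_replicate_0\<close> reconciles the two.\<close>

fun word_mat_rev :: "nat list \<Rightarrow> mat" where
  "word_mat_rev [] = id_mat 0"
| "word_mat_rev (c # w) = (if c = 0
     then mmul (height (rev (c # w))) (jw_mat (height (rev (c # w)))) (strand (word_mat_rev w))
     else bend_mat (word_mat_rev w))"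

definition word_mat :: "nat list \<Rightarrow> mat" where
  "word_mat w = word_mat_rev (rev w)"

lemma word_mat_Nil: "word_mat [] = id_mat 0"
  by (simp add: word_mat_def)

lemma word_mat_snoc_0: "word_mat (w @ [0]) = mmul (height (w @ [0])) (jw_mat (height (w @ [0]))) (strand (word_mat w))"
  by (simp add: word_mat_def)

lemma word_mat_snoc_1: "word_mat (w @ [1]) = bend_mat (word_mat w)"
  by (simp add: word_mat_def)

text \<open>The invariant that a projector of the current height is absorbed on top is what later
  allows projectors to be dropped or inserted.\<close>

lemma word_mat_Mat_jw_mat: "ballot w \<Longrightarrow> word_mat w \<in> Mat (height w) (length w) \<and> mmul (height w) (jw_mat (height w)) (word_mat w) = word_mat w"
proof (induction w rule: rev_induct)
  case Nil
  show ?case by (simp add: word_mat_Nil height_def mmul_id_mat_left[OF id_mat_Mat])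
next
  case (snoc c w)
  then have w: "ballot w" and IH: "word_mat w \<in> Mat (height w) (length w)"
    "mmul (height w) (jw_mat (height w)) (word_mat w) = word_mat w"
    using ballot_append by auto
  have "c = 0 \<or> c = 1"
    using snoc.prems by (auto simp: ballot_def)
  then show ?case
  proof
    assume c: "c = 0"
    show ?thesis
      using IH unfolding c word_mat_snoc_0 height_snoc_0[OF w]
      by (auto simp: mmul_assoc[symmetric] simp del: jw_mat.simps(2))
  next
    assume c: "c = 1"
    define h where "h = height (w @ [1])"
    have h: "height w = Suc h"
      using height_snoc_1 snoc.prems c by (simp add: h_def)
    \<comment> \<open>The smaller projector is moved inside the bend, where the larger one, absorbed
      by the word, swallows it.\<close>
    have "mmul h (jw_mat h) (bend_mat (word_mat w)) = bend_mat (mmul (Suc h) (mmul (Suc h) (strand (jw_mat h)) (jw_mat (Suc h))) (word_mat w))"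
      using IH(2) by (simp add: bend_mat_mmul_left[symmetric] mmul_assoc h del: jw_mat.simps(2))
    also have "\<dots> = bend_mat (word_mat w)"
      using IH(2) by (simp add: strand_jw_mat_jw_mat h del: jw_mat.simps(2))
    finally show ?thesis
      using IH(1) unfolding c word_mat_snoc_1 h_def[symmetric] by (auto simp: h)
  qed
qed

lemma height_append_cong: "height p = height p' \<Longrightarrow> ballot p \<Longrightarrow> ballot p' \<Longrightarrow> height (p @ q) = height (p' @ q)"
  using ballot_count[of p] ballot_count[of p'] by (auto simp: height_def)

text \<open>A further letter only acts on top strands, so it passes u at the cost of one more strand
  on u. Equal heights ensure that the same projector is inserted for all three words.\<close>

lemma word_mat_u_mat_append:
  assumes "ballot p" "ballot p'" "ballot p''" "height p' = height p" "height p'' = height p"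
    and "1 \<le> i" "i < length p" "set q \<subseteq> {0, 1}"
    and "mmul (length p) (word_mat p) (u_mat (length p) i) = lcomb x (word_mat p') y (word_mat p'')"
  shows "mmul (length (p @ q)) (word_mat (p @ q)) (u_mat (length (p @ q)) i) = lcomb x (word_mat (p' @ q)) y (word_mat (p'' @ q))"
  using \<open>set q \<subseteq> {0, 1}\<close>
proof (induction q rule: rev_induct)
  case Nil
  then show ?case using assms by simp
next
  case (snoc c q)
  let ?n = "length (p @ q)"
  have IH: "mmul ?n (word_mat (p @ q)) (u_mat ?n i) = lcomb x (word_mat (p' @ q)) y (word_mat (p'' @ q))"
    using snoc by simp
  have u_mat: "u_mat (length (p @ q @ [c])) i = strand (u_mat ?n i)"
    using strand_u_mat[of i ?n] assms by simp
  have len: "length (p @ q @ [c]) = Suc ?n" by simp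
  have h: "height (p' @ q @ [0]) = height (p @ q @ [0])" "height (p'' @ q @ [0]) = height (p @ q @ [0])"
    using assms height_append_cong by metis+
  have "c = 0 \<or> c = 1"
    using snoc.prems by auto
  then show ?case
  proof
    assume c: "c = 0"
    note word_mat_0 = word_mat_snoc_0[of "r @ q" for r, unfolded append_assoc]
    show ?thesis
      unfolding u_mat unfolding len unfolding c word_mat_0 h
      by (simp add: mmul_assoc strand_mmul[symmetric] IH[simplified] strand_lcomb)
  next
    assume c: "c = 1"
    note word_mat_1 = word_mat_snoc_1[of "r @ q" for r, unfolded append_assoc]
    show ?thesis
      unfolding u_mat unfolding len unfolding c word_mat_1
      by (simp add: bend_mat_mmul_right[symmetric] IH[simplified] bend_mat_lcomb)
  qed
qed

section \<open>The action of u on the last two letters of a word\<close>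

context
  fixes p :: "nat list" and k b :: nat and U :: mat
  assumes p: "ballot p"
  defines "k \<equiv> height p" and "b \<equiv> length p" and "U \<equiv> u_mat (Suc (Suc b)) (Suc b)"
begin

lemma h0: "height (p @ [0]) = Suc k"
  by (simp add: k_def height_snoc_0 p)

lemma h00: "height (p @ [0, 0]) = Suc (Suc k)"
  using ballot_count[OF p] by (simp add: k_def height_def)

lemma h10: "k > 0 \<Longrightarrow> height (p @ [1, 0]) = k"
  using ballot_count[OF p] by (simp add: k_def height_def)

lemma word_mat_append2: "word_mat (p @ [c, 0]) = mmul (height (p @ [c, 0])) (jw_mat (height (p @ [c, 0]))) (strand (word_mat (p @ [c])))"
  "word_mat (p @ [c, 1]) = bend_mat (word_mat (p @ [c]))"
  using word_mat_snoc_0[of "p @ [c]"] word_mat_snoc_1[of "p @ [c]"] by simp_all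

lemma Xprops: "word_mat p \<in> Mat k b" "mmul k (jw_mat k) (word_mat p) = word_mat p"
  using word_mat_Mat_jw_mat[OF p] by (simp_all add: k_def b_def)

text \<open>Both projectors merge into the larger one above two free strands; u slides up along
  these and is annihilated.\<close>

lemma word_mat_same_0: "mmul (Suc (Suc b)) (word_mat (p @ [0, 0])) U = zero_mat"
proof -
  have "strand (word_mat (p @ [0])) = mmul (Suc (Suc k)) (strand (jw_mat (Suc k))) (strand (strand (word_mat p)))"
    by (simp add: word_mat_snoc_0 h0 strand_mmul del: jw_mat.simps(2))
  then have "word_mat (p @ [0, 0]) = mmul (Suc (Suc k)) (jw_mat (Suc (Suc k))) (strand (strand (word_mat p)))"
    by (simp add: word_mat_append2 h00 mmul_assoc[symmetric] jw_mat_strand_jw_mat del: jw_mat.simps(2))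
  then have "mmul (Suc (Suc b)) (word_mat (p @ [0, 0])) U =
     mmul (Suc (Suc k)) (mmul (Suc (Suc k)) (jw_mat (Suc (Suc k))) (u_mat (Suc (Suc k)) (Suc k))) (strand (strand (word_mat p)))"
    using u_mat_last_strand_strand[OF Xprops(1)] by (simp add: U_def mmul_assoc del: jw_mat.simps(2))
  then show ?thesis
    by (simp add: jw_mat_u_mat del: jw_mat.simps(2))
qed

text \<open>The matrix of p absorbs a projector on top, so u on its last two top points gives 0; the
  two bends carry this to the bottom.\<close>

lemma word_mat_same_1:
  assumes "ballot (p @ [1, 1])"
  shows "mmul (Suc (Suc b)) (word_mat (p @ [1, 1])) U = zero_mat"
proof -
  have "2 \<le> k"
    using ballot_count[OF assms] by (simp add: k_def height_def)
  then obtain j where j: "k = Suc (Suc j)"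
    by (metis add_2_eq_Suc le_Suc_ex)
  have "mmul k (u_mat k (Suc j)) (word_mat p) = mmul k (mmul k (u_mat k (Suc j)) (jw_mat k)) (word_mat p)"
    by (simp add: mmul_assoc Xprops del: jw_mat.simps(2))
  also have "\<dots> = zero_mat"
    using u_mat_jw_mat[of "Suc j" k] j by (simp del: jw_mat.simps(2))
  finally show ?thesis
    using bend_mat_bend_mat_u_mat[of "word_mat p" j b] Xprops(1) j word_mat_snoc_1[of p]
    by (simp add: word_mat_append2(2)[of 1, simplified] U_def)
qed

lemma word_mat_01: "word_mat (p @ [0, 1]) = bend_mat (mmul (Suc k) (jw_mat (Suc k)) (strand (word_mat p)))"
  using word_mat_append2(2)[of 0] word_mat_snoc_0[of p] by (simp add: h0 del: jw_mat.simps(2))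

text \<open>Wenzl's recursion for the inserted projector: the inner copies of the smaller projector
  disappear into the matrix of p, and the outer copy leaves the bend. The first summand is the
  matrix of p with a cup on its right.\<close>

lemma word_mat_01_eq: 
  "word_mat (p @ [0, 1]) = lcomb 1 (bend_mat (strand (word_mat p))) (- (rat_of_nat k / rat_of_nat (Suc k)))
      (mmul k (jw_mat k) (bend_mat (mmul (Suc k) (u_mat (Suc k) k) (strand (word_mat p)))))"
proof -
  let ?X = "word_mat p"
  have "mmul (Suc k) (strand (jw_mat k)) (strand ?X) = strand ?X"
    by (simp add: strand_mmul[symmetric] Xprops)
  then have "mmul (Suc k) (jw_mat (Suc k)) (strand ?X) = lcomb 1 (strand ?X) (- (rat_of_nat k / rat_of_nat (Suc k)))
      (mmul (Suc k) (strand (jw_mat k)) (mmul (Suc k) (u_mat (Suc k) k) (strand ?X)))"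
    by (simp add: mmul_assoc)
  then show ?thesis
    by (simp add: word_mat_01 bend_mat_lcomb bend_mat_mmul_left del: jw_mat.simps(2) One_nat_def)
qed

lemma word_mat_10: "0 < k \<Longrightarrow> word_mat (p @ [1, 0]) = mmul k (jw_mat k) (strand (bend_mat (word_mat p)))"
  using word_mat_append2(1)[of 1] word_mat_snoc_1[of p] by (simp add: h10 del: One_nat_def)

text \<open>At height 0 the correction term has coefficient 0, so only the matrix of p with a cup
  remains, and u closes that cup.\<close>

lemma word_mat_row: "k = 0 \<Longrightarrow> mmul (Suc (Suc b)) (word_mat (p @ [0, 1])) U = lcomb 2 (word_mat (p @ [0, 1])) 0 (word_mat (p @ [0, 1]))"
  using bend_mat_strand_u_mat[OF Xprops(1)] by (simp add: word_mat_01_eq U_def del: One_nat_def) (simp add: lcomb_def)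

lemma word_mat_swap:
  assumes "0 < k"
  defines "r \<equiv> rat_of_nat (Suc k)"
  shows "mmul (Suc (Suc b)) (word_mat (p @ [0, 1])) U =
           lcomb ((r + 1) / r) (word_mat (p @ [0, 1])) ((r^2 - 1) / r^2) (word_mat (p @ [1, 0]))" (is ?A)
    and "mmul (Suc (Suc b)) (word_mat (p @ [1, 0])) U = lcomb ((r - 1) / r) (word_mat (p @ [1, 0])) 1 (word_mat (p @ [0, 1]))" (is ?B)
proof -
  obtain j where j: "k = Suc j"
    using assms by (cases k) auto
  define y where "y = bend_mat (strand (word_mat p))"
  define c where "c = rat_of_nat k / rat_of_nat (Suc k)"
  have X: "word_mat p \<in> Mat (Suc j) b"
    using Xprops(1) j by simp
  have d: "word_mat (p @ [0, 1]) = lcomb 1 y (- c) (word_mat (p @ [1, 0]))"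
    using bend_mat_u_mat_strand[OF X] assms j by (simp add: word_mat_01_eq word_mat_10 y_def c_def del: One_nat_def)
  have yU: "mmul (Suc (Suc b)) y U = lcomb 2 y 0 y"
    using bend_mat_strand_u_mat[OF Xprops(1)] by (simp add: y_def U_def lcomb_def)
  have "mmul (Suc (Suc b)) (strand (bend_mat (word_mat p))) U = y"
    using strand_bend_mat_u_mat[OF X] by (simp add: y_def U_def)
  \<comment> \<open>The outer projector is moved inside the bend and absorbed by the matrix of
    p.\<close>
  then have uU: "mmul (Suc (Suc b)) (word_mat (p @ [1, 0])) U = y"
    using assms Xprops(2) by (simp add: word_mat_10 mmul_assoc y_def bend_mat_mmul_left[symmetric] strand_mmul[symmetric] del: One_nat_def)
  have c: "c = (r - 1) / r" "r \<noteq> 0"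
    unfolding r_def c_def by simp_all
  show ?B
    unfolding uU d c by (simp add: lcomb_def)
  \<comment> \<open>From f_d = y - c f_u it follows that f_d u = (2 - c) y = (2 - c) (f_d + c f_u),
    which explains both coefficients of (a).\<close>
  have r: "(r + 1) / r = 2 - c" "(r^2 - 1) / r^2 = (2 - c) * c"
    unfolding c(1) using c(2) by (simp_all add: field_simps power2_eq_square)
  show ?A
    unfolding r unfolding d
    by (simp add: yU uU del: One_nat_def) (simp add: lcomb_def fun_eq_iff algebra_simps)
qed

end

section \<open>The matrix of a diagram\<close>

lemma span_of_diagram: "comb.span (of_diagram ` S) = {x. Poly_Mapping.keys x \<subseteq> S}"
proof (intro equalityI subsetI)
  fix x assume "x \<in> comb.span (of_diagram ` S)"
  then show "x \<in> {x. Poly_Mapping.keys x \<subseteq> S}"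
  proof (induction rule: comb.span_induct_alt)
    case base
    then show ?case by simp
  next
    case (step c x y)
    then show ?case
      by (auto simp: of_diagram_def in_keys_iff lookup_add lookup_scale lookup_single when_def split: if_splits)
  qed
next
  fix x :: comb assume x: "x \<in> {x. Poly_Mapping.keys x \<subseteq> S}"
  have "x = (\<Sum>D\<in>Poly_Mapping.keys x. Poly_Mapping.single D (Poly_Mapping.lookup x D))"
    by (rule poly_mapping_eqI) (simp add: lookup_sum lookup_single when_def sum.delta in_keys_iff)
  also have "\<dots> = (\<Sum>D\<in>Poly_Mapping.keys x. comb_scale (Poly_Mapping.lookup x D) (of_diagram D))"
    by (intro sum.cong)
      (auto simp: poly_mapping_eq_iff fun_eq_iff lookup_scale of_diagram_def lookup_single when_def)
  also have "\<dots> \<in> comb.span (of_diagram ` S)"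
    using x by (intro comb.span_sum comb.span_scale comb.span_base) auto
  finally show "x \<in> comb.span (of_diagram ` S)" .
qed

lemma Hom_iff: "x \<in> Hom a b \<longleftrightarrow> Poly_Mapping.keys x \<subseteq> diagrams a b"
  by (simp add: Hom_def span_of_diagram)

lemma single_in_Hom: "D \<in> diagrams a b \<Longrightarrow> Poly_Mapping.single D c \<in> Hom a b"
  by (simp add: Hom_iff)

section \<open>Labellings and the diagrams they determine\<close>

definition consistent :: "'a set set \<Rightarrow> ('a \<Rightarrow> bool) \<Rightarrow> bool" where
  "consistent E f \<longleftrightarrow> (\<forall>e\<in>E. \<forall>p\<in>e. \<forall>q\<in>e. f p = f q)"

fun lab :: "bool list \<Rightarrow> bool list \<Rightarrow> point \<Rightarrow> bool" where
  "lab s t (Top i) = s ! (i - 1)"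
| "lab s t (Bot j) = t ! (j - 1)"

definition dmat :: "diagram \<Rightarrow> mat" where
  "dmat D = (\<lambda>s t. if consistent D (lab s t) then 1 else 0)"

definition matching :: "nat \<Rightarrow> nat \<Rightarrow> diagram \<Rightarrow> bool" where
  "matching a b D \<longleftrightarrow> partition_on (points a b) D \<and> (\<forall>e\<in>D. card e = 2)"

text \<open>All that is immediate for a composite, whose edges are the pairs of connected outer
  points: they form disjoint cliques. That every point has exactly one partner would need an
  analysis of paths, but labellings already determine such a family of edges.\<close>

definition pairing :: "nat \<Rightarrow> nat \<Rightarrow> diagram \<Rightarrow> bool" where
  "pairing a b D \<longleftrightarrow> (\<forall>e\<in>D. card e = 2) \<and> \<Union>D \<subseteq> points a b \<and>
     (\<forall>p q r. {p, q} \<in> D \<and> {q, r} \<in> D \<and> p \<noteq> r \<longrightarrow> {p, r} \<in> D)"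

lemma diagrams_matching: "D \<in> diagrams a b \<Longrightarrow> matching a b D"
  by (simp add: diagrams_def matching_def)

lemma matching_edge_unique: "matching a b D \<Longrightarrow> {p, q} \<in> D \<Longrightarrow> {p, r} \<in> D \<Longrightarrow> q = r"
proof -
  assume D: "matching a b D" "{p, q} \<in> D" "{p, r} \<in> D"
  then have "{p, q} = {p, r}"
    unfolding matching_def partition_on_def disjoint_def by (metis insertI1 disjoint_iff)
  then show "q = r" by (auto simp: doubleton_eq_iff)
qed

lemma matching_edge_neq: "matching a b D \<Longrightarrow> {p, q} \<in> D \<Longrightarrow> p \<noteq> q"
  unfolding matching_def by fastforce

lemma matching_partner:
  assumes "matching a b D" "p \<in> points a b" obtains q where "{p, q} \<in> D"
proof -
  obtain e where e: "e \<in> D" "p \<in> e"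
    using assms unfolding matching_def partition_on_def by blast
  then obtain x y where "e = {x, y}"
    using assms unfolding matching_def by (metis card_2_iff)
  with e that show thesis by (cases "p = x") (auto simp: insert_commute)
qed

lemma matching_edge_points: "matching a b D \<Longrightarrow> {p, q} \<in> D \<Longrightarrow> p \<in> points a b \<and> q \<in> points a b"
  unfolding matching_def partition_on_def by blast

lemma matching_edgeE:
  assumes "matching a b D" "e \<in> D" obtains p q where "e = {p, q}" "p \<noteq> q"
  using assms unfolding matching_def by (metis card_2_iff)

lemma matching_pairing: "matching a b D \<Longrightarrow> pairing a b D"
proof -
  assume D: "matching a b D"
  have "{p, r} \<in> D" if "{p, q} \<in> D" "{q, r} \<in> D" "p \<noteq> r" for p q r
    using matching_edge_unique[OF D, of q p r] that by (simp add: insert_commute)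
  with D show "pairing a b D"
    unfolding pairing_def by (auto simp: matching_def partition_on_def)
qed

lemma pairing_points:
  assumes "pairing a b E" "e \<in> E" "p \<in> e" shows "p \<in> points a b"
proof -
  have "\<Union>E \<subseteq> points a b" using assms(1) by (simp add: pairing_def)
  then show ?thesis using assms by blast
qed

lemma pairing_edgeE:
  assumes "pairing a b E" "e \<in> E" obtains p q where "e = {p, q}" "p \<noteq> q"
proof -
  have "card e = 2" using assms by (simp add: pairing_def)
  then show thesis using that by (meson card_2_iff)
qed

definition label_list :: "nat \<Rightarrow> (nat \<Rightarrow> bool) \<Rightarrow> bool list" where
  "label_list a f = map (\<lambda>i. f (Suc i)) [0..<a]"

lemma length_label_list [simp]: "length (label_list a f) = a"
  by (simp add: label_list_def)

lemma lab_label_list: "p \<in> points a b \<Longrightarrow> lab (label_list a (\<lambda>i. f (Top i))) (label_list b (\<lambda>i. f (Bot i))) p = f p"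
  by (auto simp: points_def label_list_def)

text \<open>Giving the clique of p one colour and all other points the second is consistent, and it
  separates p from every point outside its clique.\<close>

lemma pairing_separate:
  assumes E: "pairing a b E" and pq: "p \<in> points a b" "q \<in> points a b" "p \<noteq> q"
    and *: "\<And>s t. length s = a \<Longrightarrow> length t = b \<Longrightarrow> consistent E (lab s t) \<Longrightarrow> lab s t p = lab s t q"
  shows "{p, q} \<in> E"
proof -
  define X where "X = (\<lambda>r. r = p \<or> {p, r} \<in> E)"
  let ?s = "label_list a (\<lambda>i. X (Top i))" and ?t = "label_list b (\<lambda>i. X (Bot i))"
  have step: "X v" if "{u, v} \<in> E" "X u" for u v
    using E that unfolding pairing_def X_def by blast
  then have edge: "X u = X v" if "{u, v} \<in> E" for u v
    using that by (metis insert_commute)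
  have "X u = X v" if "e \<in> E" "u \<in> e" "v \<in> e" for u v e
  proof -
    from E \<open>e \<in> E\<close> obtain x y where "e = {x, y}" by (rule pairing_edgeE)
    then show ?thesis using edge[of x y] that by auto
  qed
  moreover have "lab ?s ?t u = X u" if "e \<in> E" "u \<in> e" for u e
    using lab_label_list[of u a b X] pairing_points[OF E that] by simp
  ultimately have "consistent E (lab ?s ?t)"
    unfolding consistent_def by metis
  from *[OF _ _ this] have "X p = X q"
    using pq lab_label_list[of _ a b X] by simp
  then show ?thesis
    using pq by (simp add: X_def)
qed

text \<open>Positive factors leave the sets of consistent labellings visible, and by
  \<open>pairing_separate\<close> these determine the edges.\<close>

lemma pairing_eqI:
  assumes E: "pairing a b E" and F: "pairing a b F" and k: "k > 0" "l > 0"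
    and *: "\<And>s t. length s = a \<Longrightarrow> length t = b \<Longrightarrow> k * dmat E s t = l * dmat F s t"
  shows "E = F \<and> k = l"
proof -
  have **: "consistent E (lab s t) = consistent F (lab s t)" if "length s = a" "length t = b" for s t
  proof (cases "consistent E (lab s t)"; cases "consistent F (lab s t)")
  qed (use *[OF that] k in \<open>simp_all add: dmat_def\<close>)
  have sub: "A \<subseteq> B" if A: "pairing a b A" and B: "pairing a b B"
    and c: "\<And>s t. length s = a \<Longrightarrow> length t = b \<Longrightarrow> consistent B (lab s t) \<Longrightarrow> consistent A (lab s t)" for A B
  proof
    fix e assume e: "e \<in> A"
    then obtain p q where pq: "e = {p, q}" "p \<noteq> q" using pairing_edgeE[OF A] by metis
    have "{p, q} \<in> B"
    proof (rule pairing_separate[OF B])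
      show "p \<in> points a b" "q \<in> points a b"
        using pairing_points[OF A e] pq by simp_all
      show "lab s t p = lab s t q" if "length s = a" "length t = b" "consistent B (lab s t)" for s t
        using c[OF that] e unfolding consistent_def pq(1) by (metis insertCI)
    qed fact
    then show "e \<in> B" using pq by simp
  qed
  have "E = F"
    using sub[OF E F] sub[OF F E] ** by blast
  \<comment> \<open>At the constant labelling both matrix entries are 1, so the factors can be
    compared there.\<close>
  moreover have "consistent E (lab (replicate a True) (replicate b True))"
  proof -
    have "lab (replicate a True) (replicate b True) p" if "p \<in> points a b" for p
      using that by (auto simp: points_def)
    moreover have "p \<in> points a b" if "e \<in> E" "p \<in> e" for e p
      using pairing_points[OF E that] .
    ultimately show ?thesis
      unfolding consistent_def by simp
  qed
  then have "k = l"
    using *[of "replicate a True" "replicate b True"] \<open>E = F\<close> by (simp add: dmat_def)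
  ultimately show ?thesis by blast
qed

section \<open>Connected components of stacked diagrams and the count of closed loops\<close>

lemma card_image_upper: "card (upper_node ` e) = card e" "card (lower_node ` e) = card e"
proof -
  have "inj upper_node"
  proof (rule injI)
    fix x y :: point assume "upper_node x = upper_node y" then show "x = y" by (cases x; cases y) auto
  qed
  then show "card (upper_node ` e) = card e" by (metis card_image inj_on_subset subset_UNIV)
  have "inj lower_node"
  proof (rule injI)
    fix x y :: point assume "lower_node x = lower_node y" then show "x = y" by (cases x; cases y) auto
  qed
  then show "card (lower_node ` e) = card e" by (metis card_image inj_on_subset subset_UNIV)
qed

lemma inj_outer: "outer_node p = outer_node q \<longleftrightarrow> p = q"
  by (cases p; cases q) auto

lemma connected_refl [simp]: "(x, x) \<in> connected_in E"
  by (simp add: connected_in_def)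

lemma connected_sym: "(x, y) \<in> connected_in E \<Longrightarrow> (y, x) \<in> connected_in E"
  unfolding connected_in_def
  by (rule symD[OF sym_rtrancl]) (auto simp: sym_def insert_commute)

lemma connected_trans: "(x, y) \<in> connected_in E \<Longrightarrow> (y, z) \<in> connected_in E \<Longrightarrow> (x, z) \<in> connected_in E"
  unfolding connected_in_def by (rule rtrancl_trans)

lemma connected_edge: "{x, y} \<in> E \<Longrightarrow> (x, y) \<in> connected_in E"
  unfolding connected_in_def by (rule r_into_rtrancl) simp

lemma connected_class: "(x, y) \<in> connected_in E \<Longrightarrow> connected_in E `` {x} = connected_in E `` {y}"
  using connected_sym connected_trans by blast

lemma connected_Union: "(x, y) \<in> connected_in E \<Longrightarrow> x = y \<or> x \<in> \<Union>E \<and> y \<in> \<Union>E"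
  unfolding connected_in_def by (induction rule: rtrancl_induct) auto

lemma connected_consistent:
  "(x, y) \<in> connected_in E \<Longrightarrow> consistent E f \<Longrightarrow> f x = f y"
  unfolding connected_in_def
proof (induction rule: rtrancl_induct)
  case (step y z)
  then show ?case unfolding consistent_def by fast
qed simp

fun node_lab :: "bool list \<Rightarrow> bool list \<Rightarrow> bool list \<Rightarrow> node \<Rightarrow> bool" where
  "node_lab s v t (Upper i) = s ! (i - 1)"
| "node_lab s v t (Middle i) = v ! (i - 1)"
| "node_lab s v t (Lower i) = t ! (i - 1)"

lemma node_lab_point:
  "node_lab s v t (upper_node p) = lab s v p"
  "node_lab s v t (lower_node p) = lab v t p"
  "node_lab s v t (outer_node p) = lab s t p"
  by (cases p; simp)+

lemma consistent_stack:
  "consistent (stack D1 D2) (node_lab s v t) \<longleftrightarrow> consistent D1 (lab s v) \<and> consistent D2 (lab v t)"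
  unfolding consistent_def stack_def by (simp add: ball_Un node_lab_point)

lemma consistent_comp:
  "consistent (diagram_comp D1 D2) f \<longleftrightarrow>
     (\<forall>p q. (outer_node p, outer_node q) \<in> connected_in (stack D1 D2) \<longrightarrow> f p = f q)"
proof
  assume c: "consistent (diagram_comp D1 D2) f"
  show "\<forall>p q. (outer_node p, outer_node q) \<in> connected_in (stack D1 D2) \<longrightarrow> f p = f q"
  proof (intro allI impI)
    fix p q assume pq: "(outer_node p, outer_node q) \<in> connected_in (stack D1 D2)"
    show "f p = f q"
    proof (cases "p = q")
      case False
      then have "{p, q} \<in> diagram_comp D1 D2" using pq unfolding diagram_comp_def by blast
      then show ?thesis using c unfolding consistent_def by (metis insertCI)
    qed simp
  qed
next
  assume c: "\<forall>p q. (outer_node p, outer_node q) \<in> connected_in (stack D1 D2) \<longrightarrow> f p = f q"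
  show "consistent (diagram_comp D1 D2) f"
    unfolding consistent_def
  proof (intro ballI)
    fix e x y assume "e \<in> diagram_comp D1 D2" and xy: "x \<in> e" "y \<in> e"
    then obtain p q where "e = {p, q}" "(outer_node p, outer_node q) \<in> connected_in (stack D1 D2)"
      unfolding diagram_comp_def by blast
    then show "f x = f y" using c xy by auto
  qed
qed

text \<open>The middle points must be covered from one side at least: a middle node on no edge would
  be coloured freely in the matrix product without counting as a closed loop. Covering from one side
  is enough to admit composites, known only as pairings, as factors.\<close>

definition composable :: "nat \<Rightarrow> nat \<Rightarrow> nat \<Rightarrow> diagram \<Rightarrow> diagram \<Rightarrow> bool" where
  "composable a b c D1 D2 \<longleftrightarrow> (\<forall>e\<in>D1. card e = 2) \<and> (\<forall>e\<in>D2. card e = 2) \<and>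
     \<Union>D1 \<subseteq> points a b \<and> \<Union>D2 \<subseteq> points b c \<and> (Bot ` {1..b} \<subseteq> \<Union>D1 \<or> Top ` {1..b} \<subseteq> \<Union>D2)"

lemma composable_matching:
  "matching a b D1 \<Longrightarrow> pairing b c D2 \<Longrightarrow> composable a b c D1 D2"
  "pairing a b D1 \<Longrightarrow> matching b c D2 \<Longrightarrow> composable a b c D1 D2"
  by (auto simp: composable_def matching_def partition_on_def pairing_def points_def)

context
  fixes a b c :: nat and D1 D2 :: diagram
  assumes comp: "composable a b c D1 D2"
begin

lemma stack_card: "e \<in> stack D1 D2 \<Longrightarrow> card e = 2"
  using comp by (auto simp: composable_def stack_def card_image_upper)

lemma stack_Union:
  "\<Union>(stack D1 D2) \<subseteq> Upper ` {1..a} \<union> Middle ` {1..b} \<union> Lower ` {1..c}"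
  "Middle ` {1..b} \<subseteq> \<Union>(stack D1 D2)"
proof -
  have U: "\<Union>(stack D1 D2) = upper_node ` \<Union>D1 \<union> lower_node ` \<Union>D2"
    by (auto simp: stack_def)
  have "upper_node ` points a b \<subseteq> Upper ` {1..a} \<union> Middle ` {1..b}"
    "lower_node ` points b c \<subseteq> Middle ` {1..b} \<union> Lower ` {1..c}"
    by (auto simp: points_def)
  moreover have "upper_node ` \<Union>D1 \<subseteq> upper_node ` points a b" "lower_node ` \<Union>D2 \<subseteq> lower_node ` points b c"
    using comp by (simp_all only: composable_def image_mono)
  ultimately have "upper_node ` \<Union>D1 \<subseteq> Upper ` {1..a} \<union> Middle ` {1..b}"
    "lower_node ` \<Union>D2 \<subseteq> Middle ` {1..b} \<union> Lower ` {1..c}"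
    by (meson order_trans)+
  then show "\<Union>(stack D1 D2) \<subseteq> Upper ` {1..a} \<union> Middle ` {1..b} \<union> Lower ` {1..c}"
    unfolding U by blast
  have M: "Middle ` {1..b} = upper_node ` Bot ` {1..b}" "Middle ` {1..b} = lower_node ` Top ` {1..b}"
    by (auto simp: image_image)
  have "Bot ` {1..b} \<subseteq> \<Union>D1 \<or> Top ` {1..b} \<subseteq> \<Union>D2"
    using comp by (simp add: composable_def)
  then show "Middle ` {1..b} \<subseteq> \<Union>(stack D1 D2)"
    unfolding U
  proof
    assume "Bot ` {1..b} \<subseteq> \<Union>D1"
    then show "Middle ` {1..b} \<subseteq> upper_node ` \<Union>D1 \<union> lower_node ` \<Union>D2"
      unfolding M(1) by (intro le_supI1 image_mono)
  next
    assume "Top ` {1..b} \<subseteq> \<Union>D2"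
    then show "Middle ` {1..b} \<subseteq> upper_node ` \<Union>D1 \<union> lower_node ` \<Union>D2"
      unfolding M(2) by (intro le_supI2 image_mono)
  qed
qed

lemma comp_points: "(outer_node p, outer_node q) \<in> connected_in (stack D1 D2) \<Longrightarrow> p \<noteq> q \<Longrightarrow>
    p \<in> points a c \<and> q \<in> points a c"
proof -
  assume "(outer_node p, outer_node q) \<in> connected_in (stack D1 D2)" "p \<noteq> q"
  then have "outer_node p \<in> \<Union>(stack D1 D2)" "outer_node q \<in> \<Union>(stack D1 D2)"
    using connected_Union inj_outer by blast+
  then have "outer_node p \<in> Upper ` {1..a} \<union> Middle ` {1..b} \<union> Lower ` {1..c}"
    "outer_node q \<in> Upper ` {1..a} \<union> Middle ` {1..b} \<union> Lower ` {1..c}"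
    using stack_Union by blast+
  then show ?thesis
    by (cases p; cases q) (auto simp: points_def)
qed

lemma comp_pairing: "pairing a c (diagram_comp D1 D2)"
proof -
  have mem: "{p, q} \<in> diagram_comp D1 D2 \<longleftrightarrow>
      p \<noteq> q \<and> (outer_node p, outer_node q) \<in> connected_in (stack D1 D2)" for p q
    unfolding diagram_comp_def by (auto simp: doubleton_eq_iff connected_sym)
  have "\<Union>(diagram_comp D1 D2) \<subseteq> points a c"
    unfolding diagram_comp_def using comp_points by auto
  moreover have "\<forall>e\<in>diagram_comp D1 D2. card e = 2"
    unfolding diagram_comp_def by auto
  ultimately show ?thesis
    unfolding pairing_def mem using connected_trans by blast
qed

lemma closed_loops_mem: "C \<in> closed_loops D1 D2 \<longleftrightarrow>
    (\<exists>j\<in>{1..b}. C = connected_in (stack D1 D2) `` {Middle j}) \<and> C \<subseteq> range Middle" 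
proof
  assume "C \<in> closed_loops D1 D2"
  then obtain x where x: "x \<in> \<Union>(stack D1 D2)" "C = connected_in (stack D1 D2) `` {x}" "C \<subseteq> range Middle"
    unfolding closed_loops_def by blast
  then have "x \<in> range Middle" by auto
  then show "(\<exists>j\<in>{1..b}. C = connected_in (stack D1 D2) `` {Middle j}) \<and> C \<subseteq> range Middle"
    using x stack_Union(1) by blast
next
  assume "(\<exists>j\<in>{1..b}. C = connected_in (stack D1 D2) `` {Middle j}) \<and> C \<subseteq> range Middle"
  then show "C \<in> closed_loops D1 D2"
    unfolding closed_loops_def using stack_Union(2) by blast
qed

lemma finite_closed_loops: "finite (closed_loops D1 D2)"
proof (rule finite_subset)
  show "closed_loops D1 D2 \<subseteq> (\<lambda>j. connected_in (stack D1 D2) `` {Middle j}) ` {1..b}"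
    using closed_loops_mem by blast
qed simp

lemma middle_cases:
  assumes "j \<in> {1..b}"
  shows "connected_in (stack D1 D2) `` {Middle j} \<in> closed_loops D1 D2 \<or>
     (\<exists>p. (Middle j, outer_node p) \<in> connected_in (stack D1 D2))"
proof -
  have "x \<in> range Middle \<or> (\<exists>p. x = outer_node p)" for x
  proof (cases x)
    case (Upper i) then have "x = outer_node (Top i)" by simp then show ?thesis by blast
  next
    case (Lower i) then have "x = outer_node (Bot i)" by simp then show ?thesis by blast
  qed simp
  then have "connected_in (stack D1 D2) `` {Middle j} \<subseteq> range Middle \<or>
     (\<exists>p. (Middle j, outer_node p) \<in> connected_in (stack D1 D2))"
    by (metis ImageE singletonD subsetI)
  then show ?thesis
    unfolding closed_loops_mem using assms by blast
qed

text \<open>A middle node connected to the boundary has its colour forced by s and t, and each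
  closed loop carries one free colour. Consistency of the composite says that the forced colours do
  not conflict.\<close>

lemma card_consistent:
  assumes ok: "consistent (diagram_comp D1 D2) (lab s t)"
  shows "card {v \<in> labels b. consistent (stack D1 D2) (node_lab s v t)} = 2 ^ card (closed_loops D1 D2)"
proof -
  let ?E = "stack D1 D2" and ?L = "closed_loops D1 D2"
  let ?V = "{v \<in> labels b. consistent ?E (node_lab s v t)}"
  \<comment> \<open>The colours of the loops under \<open>v\<close>; on consistent labellings this
    turns out to be a bijection onto all colourings of the loops.\<close>
  define val where "val v = restrict (\<lambda>C. \<exists>j. Middle j \<in> C \<and> v ! (j - 1)) ?L" for v :: "bool list"
  have valj: "val v (connected_in ?E `` {Middle j}) = v ! (j - 1)"
    if "consistent ?E (node_lab s v t)" "connected_in ?E `` {Middle j} \<in> ?L" for v j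
  proof -
    have "v ! (j' - 1) = v ! (j - 1)" if "Middle j' \<in> connected_in ?E `` {Middle j}" for j'
      using connected_consistent[OF _ \<open>consistent ?E (node_lab s v t)\<close>, of "Middle j" "Middle j'"] that by simp
    moreover have "Middle j \<in> connected_in ?E `` {Middle j}" by simp
    ultimately have "(\<exists>j'. Middle j' \<in> connected_in ?E `` {Middle j} \<and> v ! (j' - 1)) = v ! (j - 1)"
      by blast
    then show ?thesis
      unfolding val_def restrict_apply using that(2) by (simp only: if_True)
  qed
  have "bij_betw val ?V (?L \<rightarrow>\<^sub>E (UNIV :: bool set))"
  proof (rule bij_betwI')
    fix v w assume v: "v \<in> ?V" and w: "w \<in> ?V"
    show "(val v = val w) = (v = w)"
    proof
      assume eq: "val v = val w"
      show "v = w"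
      proof (rule nth_equalityI)
        fix i assume "i < length v"
        then have i: "Suc i \<in> {1..b}" using v by auto
        from middle_cases[OF i] show "v ! i = w ! i"
        proof
          assume "connected_in ?E `` {Middle (Suc i)} \<in> ?L"
          then show ?thesis using valj[of v "Suc i"] valj[of w "Suc i"] v w eq by simp
        next
          assume "\<exists>p. (Middle (Suc i), outer_node p) \<in> connected_in ?E"
          then obtain p where p: "(Middle (Suc i), outer_node p) \<in> connected_in ?E" by blast
          from connected_consistent[OF p, of "node_lab s v t"] connected_consistent[OF p, of "node_lab s w t"] v w
          show ?thesis by (simp add: node_lab_point)
        qed
      qed (use v w in auto)
    qed simp
  next
    fix v assume "v \<in> ?V"
    then show "val v \<in> ?L \<rightarrow>\<^sub>E UNIV" by (simp add: val_def)
  next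
    fix h assume h: "h \<in> ?L \<rightarrow>\<^sub>E (UNIV :: bool set)"
    \<comment> \<open>The inverse of \<open>val\<close>: loops are coloured by \<open>h\<close>,
      other components by their outer points, which agree by \<open>ok\<close>.\<close>
    define g where "g x = (let C = connected_in ?E `` {x} in
      if C \<in> ?L then h C else \<exists>p. outer_node p \<in> C \<and> lab s t p)" for x
    define v where "v = label_list b (\<lambda>j. g (Middle j))"
    have vg: "v ! (j - 1) = g (Middle j)" if "j \<in> {1..b}" for j
      using that by (auto simp: v_def label_list_def)
    have outer: "g (outer_node q) = lab s t q" for q
    proof -
      have nm: "outer_node q \<notin> range Middle" by (cases q) auto
      have "connected_in ?E `` {outer_node q} \<notin> ?L"
      proof
        assume "connected_in ?E `` {outer_node q} \<in> ?L"
        then have "connected_in ?E `` {outer_node q} \<subseteq> range Middle"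
          by (simp only: closed_loops_mem)
        moreover have "outer_node q \<in> connected_in ?E `` {outer_node q}" by simp
        ultimately show False using nm by (meson subsetD)
      qed
      then have "g (outer_node q) = (\<exists>p. outer_node p \<in> connected_in ?E `` {outer_node q} \<and> lab s t p)"
        unfolding g_def Let_def by (simp only: if_False)
      moreover have "lab s t q = lab s t p" if "outer_node p \<in> connected_in ?E `` {outer_node q}" for p
        using ok that unfolding consistent_comp by simp
      moreover have "outer_node q \<in> connected_in ?E `` {outer_node q}" by simp
      ultimately show ?thesis by metis
    qed
    have "node_lab s v t x = g x" if "x \<in> \<Union>?E" for x
    proof -
      have "x \<in> Upper ` {1..a} \<union> Middle ` {1..b} \<union> Lower ` {1..c}"
        using that stack_Union by blast
      moreover have "g (Upper i) = s ! (i - 1)" "g (Lower i) = t ! (i - 1)" for i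
        using outer[of "Top i"] outer[of "Bot i"] by simp_all
      ultimately show ?thesis
        using vg by auto
    qed
    moreover have "g x = g y" if "(x, y) \<in> connected_in ?E" for x y
      unfolding g_def connected_class[OF that] ..
    then have "g x = g y" if "e \<in> ?E" "x \<in> e" "y \<in> e" for x y e
    proof -
      have "card e = 2" using stack_card that(1) .
      then obtain u w where "e = {u, w}" by (meson card_2_iff)
      then show ?thesis
        using \<open>\<And>x y. (x, y) \<in> connected_in ?E \<Longrightarrow> g x = g y\<close>[of u w] connected_edge[of u w ?E] that by auto
    qed
    ultimately have cons: "consistent ?E (node_lab s v t)"
      unfolding consistent_def by (metis UnionI)
    then have v: "v \<in> ?V" by (simp add: v_def)
    have "val v C = h C" for C
    proof (cases "C \<in> ?L")
      case True
      then obtain j where j: "j \<in> {1..b}" "C = connected_in ?E `` {Middle j}"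
        using closed_loops_mem by blast
      then have "val v C = g (Middle j)"
        using valj[OF cons, of j] vg[of j] True by simp
      then show ?thesis using True j by (simp add: g_def)
    next
      case False
      then show ?thesis using h by (simp add: val_def PiE_def extensional_def)
    qed
    then show "\<exists>v\<in>?V. h = val v" using v by blast
  qed
  then have "card ?V = card (?L \<rightarrow>\<^sub>E (UNIV :: bool set))" by (rule bij_betw_same_card)
  also have "\<dots> = 2 ^ card ?L"
    using finite_closed_loops by (simp add: card_PiE)
  finally show ?thesis .
qed

lemma dmat_comp:
  "mmul b (dmat D1) (dmat D2) s t = 2 ^ card (closed_loops D1 D2) * dmat (diagram_comp D1 D2) s t"
proof -
  let ?E = "stack D1 D2"
  have "mmul b (dmat D1) (dmat D2) s t = (\<Sum>v\<in>labels b. if consistent ?E (node_lab s v t) then 1 else 0)"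
    unfolding mmul_def dmat_def consistent_stack by (intro sum.cong) auto
  also have "\<dots> = rat_of_nat (card {v \<in> labels b. consistent ?E (node_lab s v t)})"
    by (simp add: sum.If_cases Int_def)
  also have "\<dots> = 2 ^ card (closed_loops D1 D2) * dmat (diagram_comp D1 D2) s t"
  proof (cases "consistent (diagram_comp D1 D2) (lab s t)")
    case True
    then show ?thesis by (simp add: card_consistent[simplified] dmat_def)
  next
    case False
    then obtain p q where "(outer_node p, outer_node q) \<in> connected_in ?E" "lab s t p \<noteq> lab s t q"
      unfolding consistent_comp by blast
    then have "\<not> consistent ?E (node_lab s v t)" for v
      using connected_consistent[of "outer_node p" "outer_node q" ?E "node_lab s v t"] by (auto simp: node_lab_point)
    then show ?thesis using False by (simp add: dmat_def)
  qed
  finally show ?thesis .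
qed

end

text \<open>
  A pairing is determined by its consistent labellings, so a composite of diagrams can be read off
  from the product of their matrices.
\<close>

lemma diagram_comp_eqI:
  assumes "composable a b c D1 D2" "pairing a c D" "k > 0"
    and "\<And>s t. length s = a \<Longrightarrow> length t = c \<Longrightarrow> mmul b (dmat D1) (dmat D2) s t = k * dmat D s t"
  shows "diagram_comp D1 D2 = D \<and> 2 ^ card (closed_loops D1 D2) = k"
  using assms by (intro pairing_eqI comp_pairing) (auto simp: dmat_comp)

text \<open>Both bracketings have the same matrix up to powers of 2, and \<open>pairing_eqI\<close>
  extracts the equality of diagrams and that of the loop factors at once.\<close>

lemma diagram_comp_assoc:
  assumes D: "matching a b D1" "matching b c D2" "matching c d D3"
  shows "diagram_comp (diagram_comp D1 D2) D3 = diagram_comp D1 (diagram_comp D2 D3)"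
    "(2 :: rat) ^ card (closed_loops D1 D2) * 2 ^ card (closed_loops (diagram_comp D1 D2) D3) =
     2 ^ card (closed_loops D2 D3) * 2 ^ card (closed_loops D1 (diagram_comp D2 D3))"
proof -
  have c: "composable a b c D1 D2" "composable b c d D2 D3"
    using D matching_pairing composable_matching by blast+
  have c': "composable a c d (diagram_comp D1 D2) D3" "composable a b d D1 (diagram_comp D2 D3)"
    using c D comp_pairing composable_matching by blast+
  have "2 ^ card (closed_loops D1 D2) * 2 ^ card (closed_loops (diagram_comp D1 D2) D3) *
        dmat (diagram_comp (diagram_comp D1 D2) D3) s t =
     2 ^ card (closed_loops D2 D3) * 2 ^ card (closed_loops D1 (diagram_comp D2 D3)) *
        dmat (diagram_comp D1 (diagram_comp D2 D3)) s t" for s t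
  proof -
    have r: "mmul b (dmat D1) (dmat D2) = lcomb (2 ^ card (closed_loops D1 D2)) (dmat (diagram_comp D1 D2)) 0 zero_mat"
      "mmul c (dmat D2) (dmat D3) = lcomb (2 ^ card (closed_loops D2 D3)) (dmat (diagram_comp D2 D3)) 0 zero_mat"
      by (simp_all add: dmat_comp[OF c(1)] dmat_comp[OF c(2)] lcomb_def fun_eq_iff)
    have "mmul c (mmul b (dmat D1) (dmat D2)) (dmat D3) s t = mmul b (dmat D1) (mmul c (dmat D2) (dmat D3)) s t"
      by (simp add: mmul_assoc)
    then show ?thesis
      unfolding r mmul_lcomb_left mmul_lcomb_right
      by (simp add: lcomb_def dmat_comp[OF c'(1)] dmat_comp[OF c'(2)] mult.assoc)
  qed
  from pairing_eqI[OF comp_pairing[OF c'(1)] comp_pairing[OF c'(2)] _ _ this]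
  show "diagram_comp (diagram_comp D1 D2) D3 = diagram_comp D1 (diagram_comp D2 D3)"
    "(2 :: rat) ^ card (closed_loops D1 D2) * 2 ^ card (closed_loops (diagram_comp D1 D2) D3) =
     2 ^ card (closed_loops D2 D3) * 2 ^ card (closed_loops D1 (diagram_comp D2 D3))"
    by simp_all
qed

section \<open>Linear combinations of diagrams\<close>

text \<open>\<open>dmat\<close> does not look at the lengths of its arguments, so the restriction to
  the right sizes is made here.\<close>

definition mat_of :: "nat \<Rightarrow> nat \<Rightarrow> comb \<Rightarrow> mat" where
  "mat_of a b x = (\<lambda>s t. if length s = a \<and> length t = b
     then \<Sum>D\<in>Poly_Mapping.keys x. Poly_Mapping.lookup x D * dmat D s t else 0)"

lemma mat_of_Mat [simp, intro]: "mat_of a b x \<in> Mat a b"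
  by (auto simp: Mat_def mat_of_def)

lemma mat_of_superset:
  assumes "finite S" "Poly_Mapping.keys x \<subseteq> S" "length s = a" "length t = b"
  shows "mat_of a b x s t = (\<Sum>D\<in>S. Poly_Mapping.lookup x D * dmat D s t)"
  unfolding mat_of_def using assms
  by (auto intro!: sum.mono_neutral_left simp: in_keys_iff)

lemma mat_of_single:
  "mat_of a b (Poly_Mapping.single D c) s t = (if length s = a \<and> length t = b then c * dmat D s t else 0)"
proof (cases "length s = a \<and> length t = b")
  case True
  then show ?thesis
    by (subst mat_of_superset[of "{D}"]) auto
qed (auto simp: mat_of_def)

lemma mat_of_zero [simp]: "mat_of a b 0 = zero_mat"
  by (simp add: mat_of_def fun_eq_iff)

lemma mat_of_add: "mat_of a b (x + y) s t = mat_of a b x s t + mat_of a b y s t"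
proof (cases "length s = a \<and> length t = b")
  case True
  let ?S = "Poly_Mapping.keys x \<union> Poly_Mapping.keys y"
  show ?thesis
    using True keys_add[of x y]
    by (subst (1 2 3) mat_of_superset[of ?S]) (auto simp: lookup_add algebra_simps sum.distrib)
qed (auto simp: mat_of_def)

lemma mat_of_scale: "mat_of a b (comb_scale c x) s t = c * mat_of a b x s t"
proof (cases "length s = a \<and> length t = b")
  case True
  have "Poly_Mapping.keys (comb_scale c x) \<subseteq> Poly_Mapping.keys x"
    by (auto simp: in_keys_iff lookup_scale)
  then show ?thesis
    using True
    by (subst (1 2) mat_of_superset[of "Poly_Mapping.keys x"])
      (auto simp: lookup_scale sum_distrib_left algebra_simps)
qed (auto simp: mat_of_def)

lemma mat_of_lcomb: "mat_of a b (comb_scale c x + comb_scale d y) = lcomb c (mat_of a b x) d (mat_of a b y)"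
  by (simp add: fun_eq_iff lcomb_def mat_of_add mat_of_scale)

lemma mat_of_diff: "mat_of a b (x - y) s t = mat_of a b x s t - mat_of a b y s t"
  using mat_of_add[of a b "x - y" y s t] by simp

lemma mat_of_sum: "mat_of a b (sum f I) s t = (\<Sum>i\<in>I. mat_of a b (f i) s t)"
  by (induction I rule: infinite_finite_induct) (simp_all add: mat_of_add)

text \<open>The supports in the definition change with the operands; common finite index sets make
  bilinearity a termwise statement.\<close>

lemma hom_comp_superset:
  assumes "finite S" "Poly_Mapping.keys x \<subseteq> S" "finite T" "Poly_Mapping.keys y \<subseteq> T"
  shows "x \<odot> y = (\<Sum>D1\<in>S. \<Sum>D2\<in>T. Poly_Mapping.single (diagram_comp D1 D2)
       (Poly_Mapping.lookup x D1 * Poly_Mapping.lookup y D2 * 2 ^ card (closed_loops D1 D2)))"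
proof -
  have "x \<odot> y = (\<Sum>D1\<in>Poly_Mapping.keys x. \<Sum>D2\<in>T. Poly_Mapping.single (diagram_comp D1 D2)
       (Poly_Mapping.lookup x D1 * Poly_Mapping.lookup y D2 * 2 ^ card (closed_loops D1 D2)))"
    unfolding hom_comp_def using assms
    by (intro sum.cong sum.mono_neutral_left) (auto simp: in_keys_iff)
  also have "\<dots> = (\<Sum>D1\<in>S. \<Sum>D2\<in>T. Poly_Mapping.single (diagram_comp D1 D2)
       (Poly_Mapping.lookup x D1 * Poly_Mapping.lookup y D2 * 2 ^ card (closed_loops D1 D2)))"
    using assms by (intro sum.mono_neutral_left) (auto simp: in_keys_iff)
  finally show ?thesis .
qed

lemma hom_comp_single: "Poly_Mapping.single D1 c \<odot> Poly_Mapping.single D2 d =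
    Poly_Mapping.single (diagram_comp D1 D2) (c * d * 2 ^ card (closed_loops D1 D2))"
  by (subst hom_comp_superset[of "{D1}" _ "{D2}"]) auto

lemma hom_comp_add_left: "(x + x') \<odot> y = x \<odot> y + x' \<odot> y"
proof -
  let ?S = "Poly_Mapping.keys x \<union> Poly_Mapping.keys x'" and ?T = "Poly_Mapping.keys y"
  show ?thesis
    using keys_add[of x x']
    by (subst (1 2 3) hom_comp_superset[of ?S _ ?T])
      (auto simp: lookup_add algebra_simps sum.distrib single_add)
qed

lemma hom_comp_add_right: "x \<odot> (y + y') = x \<odot> y + x \<odot> y'"
proof -
  let ?S = "Poly_Mapping.keys x" and ?T = "Poly_Mapping.keys y \<union> Poly_Mapping.keys y'"
  show ?thesis
    using keys_add[of y y']
    by (subst (1 2 3) hom_comp_superset[of ?S _ ?T])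
      (auto simp: lookup_add algebra_simps sum.distrib single_add)
qed

lemma comb_scale_single: "comb_scale c (Poly_Mapping.single D d) = Poly_Mapping.single D (c * d)"
  by (rule poly_mapping_eqI) (simp add: lookup_scale lookup_single when_def)

lemma keys_scale: "Poly_Mapping.keys (comb_scale c x) \<subseteq> Poly_Mapping.keys x"
  by (auto simp: in_keys_iff lookup_scale)

lemma hom_comp_scale_left: "comb_scale c x \<odot> y = comb_scale c (x \<odot> y)"
  by (subst (1 2) hom_comp_superset[of "Poly_Mapping.keys x" _ "Poly_Mapping.keys y"])
    (auto simp: keys_scale[THEN subsetD] lookup_scale comb.scale_sum_right comb_scale_single algebra_simps)

lemma hom_comp_scale_right: "x \<odot> comb_scale c y = comb_scale c (x \<odot> y)"
  by (subst (1 2) hom_comp_superset[of "Poly_Mapping.keys x" _ "Poly_Mapping.keys y"])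
    (auto simp: keys_scale[THEN subsetD] lookup_scale comb.scale_sum_right comb_scale_single algebra_simps)

lemma hom_comp_zero [simp]: "0 \<odot> y = 0" "x \<odot> 0 = 0"
  by (simp_all add: hom_comp_def)

lemma of_diagram_comp: "of_diagram D1 \<odot> of_diagram D2 =
    comb_scale (2 ^ card (closed_loops D1 D2)) (of_diagram (diagram_comp D1 D2))"
  by (simp add: of_diagram_def hom_comp_single comb_scale_single)

lemma mat_of_of_diagram: "mat_of a b (of_diagram D) s t = (if length s = a \<and> length t = b then dmat D s t else 0)"
  by (simp add: of_diagram_def mat_of_single)

lemma Hom_induct [consumes 1, case_names zero of_diagram add scale]:
  assumes "x \<in> Hom a b" "P 0" "\<And>D. D \<in> diagrams a b \<Longrightarrow> P (of_diagram D)"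
    "\<And>x y. P x \<Longrightarrow> P y \<Longrightarrow> P (x + y)" "\<And>c x. P x \<Longrightarrow> P (comb_scale c x)"
  shows "P x"
  using assms(1) unfolding Hom_def
  by (induction rule: comb.span_induct_alt) (use assms in auto)

lemma Hom_add: "x \<in> Hom a b \<Longrightarrow> y \<in> Hom a b \<Longrightarrow> x + y \<in> Hom a b"
  unfolding Hom_def by (rule comb.span_add)

lemma Hom_diff: "x \<in> Hom a b \<Longrightarrow> y \<in> Hom a b \<Longrightarrow> x - y \<in> Hom a b"
  unfolding Hom_def by (rule comb.span_diff)

lemma Hom_scale: "x \<in> Hom a b \<Longrightarrow> comb_scale c x \<in> Hom a b"
  unfolding Hom_def by (rule comb.span_scale)

lemma Hom_zero [simp]: "0 \<in> Hom a b"
  unfolding Hom_def by (rule comb.span_zero)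

lemma of_diagram_in_Hom: "D \<in> diagrams a b \<Longrightarrow> of_diagram D \<in> Hom a b"
  unfolding Hom_def by (rule comb.span_base) simp

lemma diagrams_composable: "D1 \<in> diagrams a b \<Longrightarrow> D2 \<in> diagrams b c \<Longrightarrow> composable a b c D1 D2"
  using composable_matching diagrams_matching matching_pairing by blast

text \<open>Reduces by bilinearity to \<open>dmat_comp\<close>. As \<open>mat_of\<close> reads off
  arbitrary combinations, the rule applies before the composite is known to lie in
  \<open>Hom\<close>.\<close>

lemma mat_of_hom_comp:
  assumes "x \<in> Hom a b" "y \<in> Hom b c"
  shows "mat_of a c (x \<odot> y) = mmul b (mat_of a b x) (mat_of b c y)"
  using assms(1)
proof (induction rule: Hom_induct)
  case zero
  then show ?case by simp
next
  case (of_diagram D)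
  show ?case using assms(2)
  proof (induction rule: Hom_induct)
    case zero
    then show ?case by simp
  next
    case D': (of_diagram D')
    have "mmul b (mat_of a b (of_diagram D)) (mat_of b c (of_diagram D')) s t = mmul b (dmat D) (dmat D') s t"
      if "length s = a" "length t = c" for s t
      unfolding mmul_def using that by (intro sum.cong) (auto simp: mat_of_of_diagram)
    note eq = this
    show ?case
    proof (rule mat_eqI[OF mat_of_Mat mmul_Mat[OF mat_of_Mat mat_of_Mat]])
      fix s t :: "bool list" assume "length s = a" "length t = c"
      then show "mat_of a c (of_diagram D \<odot> of_diagram D') s t =
          mmul b (mat_of a b (of_diagram D)) (mat_of b c (of_diagram D')) s t"
        unfolding eq[OF \<open>length s = a\<close> \<open>length t = c\<close>] dmat_comp[OF diagrams_composable[OF of_diagram D']]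
        by (simp add: of_diagram_comp mat_of_scale mat_of_of_diagram)
    qed
  next
    case (add x y)
    then show ?case
      by (simp add: hom_comp_add_right fun_eq_iff mat_of_add mmul_def algebra_simps sum.distrib)
  next
    case (scale c x)
    then show ?case
      by (simp add: hom_comp_scale_right fun_eq_iff mat_of_scale mmul_def algebra_simps sum_distrib_left)
  qed
next
  case (add x y)
  then show ?case
    by (simp add: hom_comp_add_left fun_eq_iff mat_of_add mmul_def algebra_simps sum.distrib)
next
  case (scale c x)
  then show ?case
    by (simp add: hom_comp_scale_left fun_eq_iff mat_of_scale mmul_def algebra_simps sum_distrib_left)
qed

lemma hom_comp_assoc:
  assumes "x \<in> Hom a b" "y \<in> Hom b c" "z \<in> Hom c d"
  shows "(x \<odot> y) \<odot> z = x \<odot> (y \<odot> z)"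
  using assms(1)
proof (induction rule: Hom_induct)
  case D1: (of_diagram D1)
  show ?case using assms(2)
  proof (induction rule: Hom_induct)
    case D2: (of_diagram D2)
    show ?case using assms(3)
    proof (induction rule: Hom_induct)
      case D3: (of_diagram D3)
      show ?case
        using diagram_comp_assoc[OF D1[THEN diagrams_matching] D2[THEN diagrams_matching] D3[THEN diagrams_matching]]
        by (simp add: of_diagram_comp hom_comp_scale_left hom_comp_scale_right)
    qed (simp_all add: hom_comp_add_right hom_comp_scale_right)
  qed (simp_all add: hom_comp_add_left hom_comp_add_right hom_comp_scale_left hom_comp_scale_right)
qed (simp_all add: hom_comp_add_left hom_comp_scale_left)

section \<open>Reflecting diagrams\<close>

fun flip_point :: "point \<Rightarrow> point" where
  "flip_point (Top i) = Bot i"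
| "flip_point (Bot i) = Top i"

text \<open>Reflection at a horizontal line exchanges multiplication by u on top and at the bottom,
  so planarity is analysed on one side only.\<close>

definition flip :: "diagram \<Rightarrow> diagram" where
  "flip D = (\<lambda>e. flip_point ` e) ` D"

lemma flip_flip_point [simp]: "flip_point (flip_point p) = p"
  by (cases p) auto

lemma flip_image_image [simp]: "flip_point ` flip_point ` e = e"
  by (simp add: image_image)

lemma flip_flip [simp]: "flip (flip D) = D"
  by (simp add: flip_def image_image)

lemma flip_edge: "{p, q} \<in> flip D \<longleftrightarrow> {flip_point p, flip_point q} \<in> D"
proof
  assume "{p, q} \<in> flip D"
  then obtain e where "e \<in> D" "{p, q} = flip_point ` e" unfolding flip_def by blast
  then have "flip_point ` {p, q} = e" by (simp only: flip_image_image)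
  then have "{flip_point p, flip_point q} = e" by simp
  then show "{flip_point p, flip_point q} \<in> D" using \<open>e \<in> D\<close> by simp
next
  assume "{flip_point p, flip_point q} \<in> D"
  then have "flip_point ` {flip_point p, flip_point q} \<in> flip D" unfolding flip_def by blast
  then show "{p, q} \<in> flip D" by simp
qed

lemma bpos_flip [simp]: "bpos (flip_point p) = - bpos p"
  by (cases p) auto

lemma flip_points: "flip_point ` points a b = points b a"
  by (auto simp: points_def image_Un image_image)

lemma inj_flip_point: "inj flip_point"
  by (metis flip_flip_point injI)

lemma bij_diagram_image:
  assumes D: "matching a b D" and f: "bij_betw f (points a b) (points c d)"
  shows "matching c d ((\<lambda>e. f ` e) ` D)"
proof -
  have inj: "inj_on f (points a b)" and im: "f ` points a b = points c d"
    using f by (auto simp: bij_betw_def)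
  have part: "partition_on (points a b) D" and card: "\<And>e. e \<in> D \<Longrightarrow> card e = 2"
    using D by (simp_all add: matching_def)
  have sub: "e \<subseteq> points a b" if "e \<in> D" for e
    using partition_onD1[OF part] that by blast
  have card': "card (f ` e) = 2" if "e \<in> D" for e
    using card[OF that] card_image[OF inj_on_subset[OF inj sub[OF that]]] by simp
  then have "{} \<notin> (`) f ` D"
    by fastforce
  then have "partition_on (points c d) ((`) f ` D)"
    using partition_on_inj_image[OF part inj] im by simp
  then show ?thesis
    using card' by (simp add: matching_def)
qed

lemma noncrossing_flip: "noncrossing D \<Longrightarrow> noncrossing (flip D)"
  unfolding noncrossing_def flip_edge
proof (rule notI, elim exE conjE)
  fix p q r s
  assume nc: "\<not> (\<exists>p q r s. {p, q} \<in> D \<and> {r, s} \<in> D \<and> bpos p < bpos r \<and> bpos r < bpos q \<and> bpos q < bpos s)"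
    and e: "{flip_point p, flip_point q} \<in> D" "{flip_point r, flip_point s} \<in> D"
    and lt: "bpos p < bpos r" "bpos r < bpos q" "bpos q < bpos s"
  have "{flip_point s, flip_point r} \<in> D" "{flip_point q, flip_point p} \<in> D"
    using e by (simp_all add: insert_commute)
  moreover have "bpos (flip_point s) < bpos (flip_point q)" "bpos (flip_point q) < bpos (flip_point r)"
    "bpos (flip_point r) < bpos (flip_point p)"
    using lt by simp_all
  ultimately show False using nc by metis
qed

lemma flip_diagrams: "D \<in> diagrams a b \<Longrightarrow> flip D \<in> diagrams b a"
proof -
  assume D: "D \<in> diagrams a b"
  have "bij_betw flip_point (points a b) (points b a)"
    using flip_points inj_flip_point by (metis bij_betw_def inj_on_subset subset_UNIV)
  then have "matching b a (flip D)"
    unfolding flip_def using bij_diagram_image diagrams_matching[OF D] by blast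
  moreover have "noncrossing (flip D)"
    using D noncrossing_flip by (simp add: diagrams_def)
  ultimately show ?thesis
    by (simp add: diagrams_def matching_def)
qed

lemma lab_flip: "lab s t (flip_point p) = lab t s p"
  by (cases p) auto

lemma dmat_flip: "dmat (flip D) t s = dmat D s t"
  by (simp add: dmat_def consistent_def flip_def lab_flip)

section \<open>The action of the generators\<close>

lemma noncrossingD: "noncrossing D \<Longrightarrow> {p, q} \<in> D \<Longrightarrow> {r, s} \<in> D \<Longrightarrow>
    bpos p < bpos r \<Longrightarrow> bpos r < bpos q \<Longrightarrow> bpos q < bpos s \<Longrightarrow> False"
  unfolding noncrossing_def by blast

text \<open>A row of the matrix of u has at most two nonzero entries, one for each common colour of
  the two joined points.\<close>

lemma sum_u_mat:
  assumes s: "length s = n" and i: "1 \<le> i" "i < n"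
  shows "mmul n (u_mat n i) A s t = (if s ! (i - 1) = s ! i
    then A (s[i - 1 := True, i := True]) t + A (s[i - 1 := False, i := False]) t else 0)"
proof -
  let ?f = "\<lambda>x. s[i - 1 := x, i := x]"
  have u_mat: "u_mat n i s v = (if s ! (i - 1) = s ! i \<and> (v = ?f True \<or> v = ?f False) then 1 else 0)"
    if v: "length v = n" for v
  proof -
    have "(v ! (i - 1) = v ! i \<and> (\<forall>j<n. j \<noteq> i - 1 \<and> j \<noteq> i \<longrightarrow> s ! j = v ! j)) \<longleftrightarrow> v = ?f (v ! i)"
    proof
      assume "v ! (i - 1) = v ! i \<and> (\<forall>j<n. j \<noteq> i - 1 \<and> j \<noteq> i \<longrightarrow> s ! j = v ! j)"
      then show "v = ?f (v ! i)"
        using s v i by (intro nth_equalityI) (auto simp: nth_list_update)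
    next
      assume *: "v = ?f (v ! i)"
      have "?f x ! (i - 1) = ?f x ! i \<and> (\<forall>j<n. j \<noteq> i - 1 \<and> j \<noteq> i \<longrightarrow> s ! j = ?f x ! j)" for x
        using s i by (simp add: nth_list_update)
      from this[of "v ! i", unfolded *[symmetric]]
      show "v ! (i - 1) = v ! i \<and> (\<forall>j<n. j \<noteq> i - 1 \<and> j \<noteq> i \<longrightarrow> s ! j = v ! j)" .
    qed
    moreover have "v = ?f (v ! i) \<longleftrightarrow> v = ?f True \<or> v = ?f False"
    proof
      assume "v = ?f (v ! i)"
      then show "v = ?f True \<or> v = ?f False" by (metis (full_types))
    next
      have "?f x ! i = x" for x using s i by simp
      then show "v = ?f True \<or> v = ?f False \<Longrightarrow> v = ?f (v ! i)" by metis
    qed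
    ultimately have "(v ! (i - 1) = v ! i \<and> (\<forall>j<n. j \<noteq> i - 1 \<and> j \<noteq> i \<longrightarrow> s ! j = v ! j)) \<longleftrightarrow>
        v = ?f True \<or> v = ?f False" by (rule trans)
    then have "(length s = n \<and> length v = n \<and> s ! (i - 1) = s ! i \<and> v ! (i - 1) = v ! i \<and>
        (\<forall>j<n. j \<noteq> i - 1 \<and> j \<noteq> i \<longrightarrow> s ! j = v ! j)) \<longleftrightarrow>
        s ! (i - 1) = s ! i \<and> (v = ?f True \<or> v = ?f False)" using s v by blast
    then show ?thesis
      unfolding u_mat_def by (simp only:)
  qed
  have ne: "?f True \<noteq> ?f False"
  proof
    assume "?f True = ?f False"
    then have "?f True ! i = ?f False ! i" by simp
    then show False using s i by simp
  qed
  show ?thesis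
  proof (cases "s ! (i - 1) = s ! i")
    case False
    then show ?thesis unfolding mmul_def by (simp add: u_mat)
  next
    case True
    have "mmul n (u_mat n i) A s t = (\<Sum>v\<in>labels n. if v \<in> {?f True, ?f False} then A v t else 0)"
      unfolding mmul_def by (intro sum.cong) (use True in \<open>auto simp: u_mat\<close>)
    also have "\<dots> = (\<Sum>v\<in>{?f True, ?f False}. A v t)"
      using s by (subst sum.inter_restrict[symmetric]) (auto intro!: sum.cong)
    finally show ?thesis using ne True by simp
  qed
qed

lemma lab_update:
  assumes "length s = a" "1 \<le> i" "i < a" "p \<in> points a b"
  shows "lab (s[i - 1 := x, i := x]) t p = (if p = Top i \<or> p = Top (i + 1) then x else lab s t p)"
proof (cases p)
  case (Top j)
  then have "1 \<le> j" "j \<le> a" using assms by (auto simp: points_def)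
  have "s[i - 1 := x, i := x] ! (j - 1) = (if j = i \<or> j = i + 1 then x else s ! (j - 1))"
  proof (cases "j = i \<or> j = i + 1")
    case True
    then show ?thesis using assms by (auto simp: nth_list_update)
  next
    case False
    then have "j - 1 \<noteq> i - 1" "j - 1 \<noteq> i" using \<open>1 \<le> j\<close> assms(2) by arith+
    then show ?thesis using False by (metis nth_list_update_neq)
  qed
  then show ?thesis using Top by simp
qed simp

lemma consistent_insert: "consistent (insert {p, q} E) f \<longleftrightarrow> f p = f q \<and> consistent E f"
  by (auto simp: consistent_def)

lemma consistent_cong:
  "(\<And>e p. e \<in> E \<Longrightarrow> p \<in> e \<Longrightarrow> f p = g p) \<Longrightarrow> consistent E f = consistent E g"
  unfolding consistent_def by simp

text \<open>With one end inside and the other outside, the two edges would cross in one of the two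
  possible orders.\<close>

lemma noncrossing_sep:
  assumes D: "noncrossing D" "{r, s} \<in> D" "{u, v} \<in> D" and rs: "bpos r < bpos s"
    and ne: "bpos u \<noteq> bpos r" "bpos u \<noteq> bpos s" "bpos v \<noteq> bpos r" "bpos v \<noteq> bpos s"
  shows "bpos r < bpos u \<and> bpos u < bpos s \<longleftrightarrow> bpos r < bpos v \<and> bpos v < bpos s"
proof -
  have *: False if "{u, v} \<in> D" "bpos r < bpos u" "bpos u < bpos s"
      "bpos v \<noteq> bpos r" "bpos v \<noteq> bpos s" "\<not> (bpos r < bpos v \<and> bpos v < bpos s)" for u v
  proof -
    have vu: "{v, u} \<in> D" using that by (simp add: insert_commute)
    from that have "bpos v < bpos r \<or> bpos s < bpos v" by linarith
    then show False
      using noncrossingD[OF D(1) vu D(2)] noncrossingD[OF D(1) D(2) that(1)] that(2,3) by blast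
  qed
  have vu: "{v, u} \<in> D" using D by (simp add: insert_commute)
  show ?thesis using *[OF D(3)] *[OF vu] ne by blast
qed

lemma bpos_inj: "p \<in> points a b \<Longrightarrow> q \<in> points a b \<Longrightarrow> bpos p = bpos q \<longleftrightarrow> p = q"
  by (cases p; cases q) (auto simp: points_def image_iff)

lemma matching_disjoint: "matching a b D \<Longrightarrow> e \<in> D \<Longrightarrow> e' \<in> D \<Longrightarrow> e \<noteq> e' \<Longrightarrow> e \<inter> e' = {}"
  unfolding matching_def by (meson disjointD partition_onD2)

lemma matching_sub: "matching a b D \<Longrightarrow> e \<in> D \<Longrightarrow> e \<subseteq> points a b"
  unfolding matching_def by (metis Union_upper partition_onD1)

text \<open>If D joins the two points, a loop closes; otherwise their partners become joined. The
  clause on \<open>Bot\<close> edges, once reflected, preserves the diagrams spanning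
  \<open>cell_null\<close>; the last one gives u D = 2 D, on which the uniqueness of the Jones-Wenzl
  element rests.\<close>

lemma u_mat_diagram:
  assumes D: "D \<in> diagrams a b" and i: "1 \<le> i" "i < a"
  obtains D' k where "D' \<in> diagrams a b" "k > 0"
    "\<And>s t. length s = a \<Longrightarrow> length t = b \<Longrightarrow> mmul a (u_mat a i) (dmat D) s t = k * dmat D' s t"
    "\<And>j l. {Bot j, Bot l} \<in> D \<Longrightarrow> {Bot j, Bot l} \<in> D'"
    "{Top i, Top (i + 1)} \<in> D \<Longrightarrow> D' = D \<and> k = 2"
proof (cases "{Top i, Top (i + 1)} \<in> D")
  case True
  have m: "matching a b D" using D by (rule diagrams_matching)
  define F where "F = D - {{Top i, Top (i + 1)}}"
  have DF: "D = insert {Top i, Top (i + 1)} F" using True by (auto simp: F_def)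
  have notin: "Top i \<notin> e" "Top (i + 1) \<notin> e" and sub: "e \<subseteq> points a b" if "e \<in> F" for e
  proof -
    have "e \<in> D" "e \<noteq> {Top i, Top (i + 1)}"
      using that by (simp_all add: F_def)
    then have "e \<inter> {Top i, Top (i + 1)} = {}" "e \<subseteq> points a b"
      using matching_disjoint[OF m _ True] matching_sub[OF m] by simp_all
    then show "Top i \<notin> e" "Top (i + 1) \<notin> e" "e \<subseteq> points a b" by auto
  qed
  have "mmul a (u_mat a i) (dmat D) s t = 2 * dmat D s t" if st: "length s = a" "length t = b" for s t
  proof -
    have pts: "Top i \<in> points a b" "Top (i + 1) \<in> points a b" using i by (auto simp: points_def)
    have "consistent F (lab (s[i - 1 := x, i := x]) t) = consistent F (lab s t)" for x
    proof (rule consistent_cong)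
      fix e p assume e: "e \<in> F" "p \<in> e"
      then have "p \<in> points a b" "p \<noteq> Top i" "p \<noteq> Top (i + 1)"
        using notin[OF e(1)] sub[OF e(1)] by auto
      then show "lab (s[i - 1 := x, i := x]) t p = lab s t p"
        using lab_update[OF st(1) i] by simp
    qed
    moreover have "lab (s[i - 1 := x, i := x]) t (Top i) = lab (s[i - 1 := x, i := x]) t (Top (i + 1))" for x
      using lab_update[OF st(1) i pts(1)] lab_update[OF st(1) i pts(2)] by simp
    ultimately have "dmat D (s[i - 1 := x, i := x]) t = (if consistent F (lab s t) then 1 else 0)" for x
      unfolding dmat_def DF consistent_insert by simp
    then show ?thesis
      using st i by (simp add: sum_u_mat) (simp add: dmat_def DF consistent_insert)
  qed
  with that[of D 2] D show thesis by simp
next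
  case False
  have m: "matching a b D" using D by (rule diagrams_matching)
  have nc: "noncrossing D" using D by (simp add: diagrams_def)
  have pts: "Top i \<in> points a b" "Top (i + 1) \<in> points a b" using i by (auto simp: points_def)
  obtain p where p: "{Top i, p} \<in> D" using matching_partner[OF m pts(1)] .
  obtain q where q: "{Top (i + 1), q} \<in> D" using matching_partner[OF m pts(2)] .
  define F where "F = D - {{Top i, p}, {Top (i + 1), q}}"
  define D' where "D' = insert {Top i, Top (i + 1)} (insert {p, q} F)"
  have DF: "D = insert {Top i, p} (insert {Top (i + 1), q} F)" using p q by (auto simp: F_def)
  have neq: "p \<noteq> Top i" "p \<noteq> Top (i + 1)" "q \<noteq> Top i" "q \<noteq> Top (i + 1)"
    using matching_edge_neq[OF m p] matching_edge_neq[OF m q] False p q by (auto simp: insert_commute)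
  have pq: "p \<noteq> q"
    using matching_edge_unique[OF m, of p "Top i" "Top (i + 1)"] p q by (auto simp: insert_commute)
  have pts': "p \<in> points a b" "q \<in> points a b"
    using matching_edge_points[OF m] p q by auto
  have notin: "e \<inter> {Top i, Top (i + 1), p, q} = {}" and sub: "e \<subseteq> points a b" and Fcard: "card e = 2"
    if "e \<in> F" for e
  proof -
    have "e \<in> D" "e \<noteq> {Top i, p}" "e \<noteq> {Top (i + 1), q}"
      using that by (simp_all add: F_def)
    then have "e \<inter> {Top i, p} = {}" "e \<inter> {Top (i + 1), q} = {}" "e \<subseteq> points a b"
      using matching_disjoint[OF m _ p] matching_disjoint[OF m _ q] matching_sub[OF m] by simp_all
    then show "e \<inter> {Top i, Top (i + 1), p, q} = {}" "e \<subseteq> points a b" by auto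
    show "card e = 2" using m \<open>e \<in> D\<close> by (simp add: matching_def)
  qed
  have "matching a b D'"
    unfolding matching_def
  proof
    have un: "\<Union>D = points a b" "disjoint D" "{} \<notin> D"
      using m by (auto simp: matching_def partition_on_def)
    have "\<Union>D' = {Top i, Top (i + 1), p, q} \<union> \<Union>F" "\<Union>D = {Top i, Top (i + 1), p, q} \<union> \<Union>F"
      by (auto simp: D'_def DF)
    then have "\<Union>D' = points a b" using un by simp
    moreover have "disjoint D'"
    proof (rule disjointI)
      fix e e' assume e: "e \<in> D'" "e' \<in> D'" "e \<noteq> e'"
      have 1: "{Top i, Top (i + 1)} \<inter> {p, q} = {}" using neq by auto
      have 2: "x \<inter> y = {}" if "x \<in> F" "y \<in> F" "x \<noteq> y" for x y
        using matching_disjoint[OF m _ _ that(3)] that by (simp add: F_def)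
      have 3: "x \<inter> {Top i, Top (i + 1)} = {}" "x \<inter> {p, q} = {}" if "x \<in> F" for x
        using notin[OF that] by auto
      have "e = {Top i, Top (i + 1)} \<or> e = {p, q} \<or> e \<in> F" "e' = {Top i, Top (i + 1)} \<or> e' = {p, q} \<or> e' \<in> F"
        using e by (simp_all add: D'_def)
      then show "e \<inter> e' = {}"
        using 1 2[of e e'] 3[of e] 3[of e'] e(3) by (elim disjE) (simp_all add: Int_commute)
    qed
    moreover have "{} \<notin> D'"
      using un by (auto simp: D'_def F_def)
    ultimately show "partition_on (points a b) D'" by (simp add: partition_on_def)
    show "\<forall>e\<in>D'. card e = 2"
      using Fcard pq by (auto simp: D'_def)
  qed
  moreover have "noncrossing D'"
    unfolding noncrossing_def
  proof (rule notI, elim exE conjE)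
    fix u w x y
    assume uw: "{u, w} \<in> D'" and xy: "{x, y} \<in> D'"
      and lt: "bpos u < bpos x" "bpos x < bpos w" "bpos w < bpos y"
    have FD: "e \<in> D" if "e \<in> F" for e using that by (simp add: F_def)
    \<comment> \<open>No remaining edge separates p from q: it separates neither p from its old
      partner, nor q from its own, nor the two adjacent old partners.\<close>
    have key: "bpos r < bpos p \<and> bpos p < bpos s \<longleftrightarrow> bpos r < bpos q \<and> bpos q < bpos s"
      if rs: "{r, s} \<in> F" "bpos r < bpos s" for r s
    proof -
      have rs': "r \<notin> {Top i, Top (i + 1), p, q}" "s \<notin> {Top i, Top (i + 1), p, q}"
        using notin[OF rs(1)] by auto
      have rspts: "r \<in> points a b" "s \<in> points a b" using sub[OF rs(1)] by auto
      have ne: "bpos (Top i) \<noteq> bpos r" "bpos (Top i) \<noteq> bpos s"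
        "bpos (Top (i + 1)) \<noteq> bpos r" "bpos (Top (i + 1)) \<noteq> bpos s"
        "bpos p \<noteq> bpos r" "bpos p \<noteq> bpos s" "bpos q \<noteq> bpos r" "bpos q \<noteq> bpos s"
        using rs' by (auto simp: bpos_inj[OF _ rspts(1)] bpos_inj[OF _ rspts(2)] pts pts(2)[unfolded Suc_eq_plus1[symmetric]] pts' simp del: bpos.simps)
      have "bpos r < bpos (Top i) \<and> bpos (Top i) < bpos s \<longleftrightarrow> bpos r < bpos p \<and> bpos p < bpos s"
        by (rule noncrossing_sep[OF nc FD[OF rs(1)] p rs(2)]) (use ne in simp_all)
      moreover have "bpos r < bpos (Top (i + 1)) \<and> bpos (Top (i + 1)) < bpos s \<longleftrightarrow> bpos r < bpos q \<and> bpos q < bpos s"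
        by (rule noncrossing_sep[OF nc FD[OF rs(1)] q rs(2)]) (use ne in simp_all)
      \<comment> \<open>The two points occupy neighbouring positions, so no end of the edge fits
        between them.\<close>
      moreover have "bpos r < bpos (Top (i + 1)) \<and> bpos (Top (i + 1)) < bpos s \<longleftrightarrow>
          bpos r < bpos (Top i) \<and> bpos (Top i) < bpos s"
        using ne by auto
      ultimately show ?thesis by blast
    qed
    have uw': "{u, w} = {Top i, Top (i + 1)} \<or> {u, w} = {p, q} \<or> {u, w} \<in> F"
      and xy': "{x, y} = {Top i, Top (i + 1)} \<or> {x, y} = {p, q} \<or> {x, y} \<in> F"
      using uw xy by (simp_all add: D'_def)
    have 1: "{u, w} \<noteq> {Top i, Top (i + 1)}" "{x, y} \<noteq> {Top i, Top (i + 1)}"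
      using lt by (auto simp: doubleton_eq_iff)
    consider "{u, w} = {p, q}" "{x, y} = {p, q}" | "{u, w} = {p, q}" "{x, y} \<in> F"
      | "{u, w} \<in> F" "{x, y} = {p, q}" | "{u, w} \<in> F" "{x, y} \<in> F"
      using uw' xy' 1 by metis
    then show False
    proof cases
      case 1
      then have "{u, w} = {x, y}" by simp
      then show ?thesis using lt by (auto simp: doubleton_eq_iff)
    next
      case 2
      then show ?thesis using key[of x y] lt by (auto simp: doubleton_eq_iff)
    next
      case 3
      then show ?thesis using key[of u w] lt by (auto simp: doubleton_eq_iff)
    next
      case 4
      show ?thesis by (rule noncrossingD[OF nc FD[OF 4(1)] FD[OF 4(2)] lt])
    qed
  qed
  ultimately have "D' \<in> diagrams a b"
    by (simp add: diagrams_def matching_def)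
  moreover have "mmul a (u_mat a i) (dmat D) s t = 1 * dmat D' s t" if st: "length s = a" "length t = b" for s t
  proof -
    have F: "consistent F (lab (s[i - 1 := x, i := x]) t) = consistent F (lab s t)" for x
    proof (rule consistent_cong)
      fix e r assume e: "e \<in> F" "r \<in> e"
      then have "r \<in> points a b" "r \<noteq> Top i" "r \<noteq> Top (i + 1)"
        using notin[OF e(1)] sub[OF e(1)] by auto
      then show "lab (s[i - 1 := x, i := x]) t r = lab s t r"
        using lab_update[OF st(1) i] by simp
    qed
    have L: "lab (s[i - 1 := x, i := x]) t (Top i) = x" "lab (s[i - 1 := x, i := x]) t (Top (i + 1)) = x"
      "lab (s[i - 1 := x, i := x]) t p = lab s t p" "lab (s[i - 1 := x, i := x]) t q = lab s t q" for x
      using lab_update[OF st(1) i pts(1)] lab_update[OF st(1) i pts(2)]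
        lab_update[OF st(1) i pts'(1)] lab_update[OF st(1) i pts'(2)] neq by simp_all
    \<comment> \<open>Here both top points carry the colour x, so the term survives only if p and q
      have colour x as well. At most one of the two terms does, and only if p and q agree, which is
      the condition of the edge {p, q}.\<close>
    have R: "dmat D (s[i - 1 := x, i := x]) t =
        (if x = lab s t p \<and> x = lab s t q \<and> consistent F (lab s t) then 1 else 0)" for x
      unfolding dmat_def DF consistent_insert L F ..
    have "lab s t (Top i) = s ! (i - 1)" "lab s t (Top (i + 1)) = s ! i" by simp_all
    then have R': "dmat D' s t =
        (if s ! (i - 1) = s ! i \<and> lab s t p = lab s t q \<and> consistent F (lab s t) then 1 else 0)"
      unfolding dmat_def D'_def consistent_insert by simp
    show ?thesis
      unfolding sum_u_mat[OF st(1) i] R R'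
      by (cases "lab s t p"; cases "lab s t q"; cases "consistent F (lab s t)") simp_all
  qed
  moreover have "{Bot j, Bot l} \<in> D'" if "{Bot j, Bot l} \<in> D" for j l
  proof -
    have "{Bot j, Bot l} \<noteq> {Top i, p}" "{Bot j, Bot l} \<noteq> {Top (i + 1), q}" by (auto simp: doubleton_eq_iff)
    then show ?thesis using that by (simp add: DF D'_def)
  qed
  ultimately show thesis
    using that[of D' 1] False by simp
qed

section \<open>Generators and the algebra they span\<close>

lemma matching_involution:
  assumes "\<And>p. p \<in> points a b \<Longrightarrow> \<sigma> p \<in> points a b"
    and inv: "\<And>p. p \<in> points a b \<Longrightarrow> \<sigma> (\<sigma> p) = p"
    and ne: "\<And>p. p \<in> points a b \<Longrightarrow> \<sigma> p \<noteq> p"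
  shows "matching a b ((\<lambda>p. {p, \<sigma> p}) ` points a b)"
  unfolding matching_def
proof
  show "partition_on (points a b) ((\<lambda>p. {p, \<sigma> p}) ` points a b)"
  proof (rule partition_onI)
    fix x y assume "x \<in> (\<lambda>p. {p, \<sigma> p}) ` points a b" "y \<in> (\<lambda>p. {p, \<sigma> p}) ` points a b" "x \<noteq> y"
    then obtain p q where pq: "x = {p, \<sigma> p}" "y = {q, \<sigma> q}" "p \<in> points a b" "q \<in> points a b" by blast
    have "p \<noteq> q" using pq \<open>x \<noteq> y\<close> by auto
    moreover have "\<sigma> p \<noteq> q" using pq \<open>x \<noteq> y\<close> inv[of p] by auto
    moreover have "p \<noteq> \<sigma> q" using pq \<open>x \<noteq> y\<close> inv[of q] by auto
    moreover have "\<sigma> p \<noteq> \<sigma> q" using \<open>p \<noteq> q\<close> inv[OF pq(3)] inv[OF pq(4)] by metis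
    ultimately show "disjnt x y" using pq by (simp add: disjnt_def)
  qed (use assms in auto)
  show "\<forall>e\<in>(\<lambda>p. {p, \<sigma> p}) ` points a b. card e = 2"
  proof
    fix e assume "e \<in> (\<lambda>p. {p, \<sigma> p}) ` points a b"
    then obtain p where "e = {p, \<sigma> p}" "p \<in> points a b" by blast
    then show "card e = 2" using ne[of p] by auto
  qed
qed

definition id_diagram :: "nat \<Rightarrow> diagram" where
  "id_diagram n = {{Top j, Bot j} | j. j \<in> {1..n}}"

lemma id_diagram_image: "id_diagram n = (\<lambda>p. {p, flip_point p}) ` points n n"
  by (auto simp: id_diagram_def points_def image_Un image_image insert_commute)

lemma id_diagram_in [simp]: "id_diagram n \<in> diagrams n n"
proof -
  have "matching n n (id_diagram n)"
    unfolding id_diagram_image by (rule matching_involution) (auto simp: points_def)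
  moreover have "noncrossing (id_diagram n)"
    unfolding noncrossing_def
  proof (rule notI, elim exE conjE)
    fix p q r s
    assume e: "{p, q} \<in> id_diagram n" "{r, s} \<in> id_diagram n"
      and lt: "bpos p < bpos r" "bpos r < bpos q" "bpos q < bpos s"
    have "bpos y = - bpos x" if "{x, y} \<in> id_diagram n" for x y
      using that by (auto simp: id_diagram_def doubleton_eq_iff)
    from this[OF e(1)] this[OF e(2)] lt show False by linarith
  qed
  ultimately show ?thesis by (simp add: diagrams_def matching_def)
qed

fun u_inv :: "nat \<Rightarrow> point \<Rightarrow> point" where
  "u_inv i (Top j) = (if j = i then Top (i + 1) else if j = i + 1 then Top i else Bot j)"
| "u_inv i (Bot j) = (if j = i then Bot (i + 1) else if j = i + 1 then Bot i else Top j)"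

lemma u_diagram_image:
  assumes "1 \<le> i" "i < n" shows "u_diagram n i = (\<lambda>p. {p, u_inv i p}) ` points n n" (is "?L = ?R")
proof (intro equalityI subsetI)
  fix e assume "e \<in> ?L"
  then have "e = {Top i, Top (i + 1)} \<or> e = {Bot i, Bot (i + 1)} \<or> (\<exists>j\<in>{1..n} - {i, i + 1}. e = {Top j, Bot j})"
    unfolding u_diagram_def by blast
  then show "e \<in> ?R"
  proof (elim disjE bexE)
    assume "e = {Top i, Top (i + 1)}"
    then show ?thesis using assms by (intro image_eqI[of _ _ "Top i"]) (simp_all add: points_def)
  next
    assume "e = {Bot i, Bot (i + 1)}"
    then show ?thesis using assms by (intro image_eqI[of _ _ "Bot i"]) (simp_all add: points_def)
  next
    fix j assume "j \<in> {1..n} - {i, i + 1}" "e = {Top j, Bot j}"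
    then show ?thesis using assms by (intro image_eqI[of _ _ "Top j"]) (simp_all add: points_def)
  qed
next
  fix e assume "e \<in> ?R"
  then obtain p where e: "p \<in> points n n" "e = {p, u_inv i p}" by blast
  have thr: "{Top j, Bot j} \<in> ?L" if "1 \<le> j" "j \<le> n" "j \<noteq> i" "j \<noteq> i + 1" for j
    using that unfolding u_diagram_def Setcompr_eq_image by simp
  have cap: "{Top i, Top (i + 1)} \<in> ?L" "{Bot i, Bot (i + 1)} \<in> ?L"
    by (simp_all add: u_diagram_def)
  show "e \<in> ?L"
  proof (cases p)
    case (Top j)
    then have "1 \<le> j" "j \<le> n" using e by (auto simp: points_def)
    then show ?thesis using thr[of j] cap e(2) Top
      by (cases "j = i"; cases "j = i + 1") (simp_all add: insert_commute)
  next
    case (Bot j)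
    then have "1 \<le> j" "j \<le> n" using e by (auto simp: points_def)
    then show ?thesis using thr[of j] cap e(2) Bot
      by (cases "j = i"; cases "j = i + 1") (simp_all add: insert_commute)
  qed
qed

lemma u_diagram_matching:
  assumes "1 \<le> i" "i < n" shows "matching n n (u_diagram n i)"
  unfolding u_diagram_image[OF assms]
  by (rule matching_involution) (use assms in \<open>auto simp: points_def split: if_splits\<close>)

lemma consistent_image: "consistent ((\<lambda>j. {f j, g j}) ` A) h \<longleftrightarrow> (\<forall>j\<in>A. h (f j) = h (g j))"
  unfolding consistent_def by auto

lemma consistent_Un: "consistent (A \<union> B) h \<longleftrightarrow> consistent A h \<and> consistent B h"
  unfolding consistent_def by auto

lemma consistent_empty: "consistent {} h"
  unfolding consistent_def by auto

lemma dmat_id: "length s = n \<Longrightarrow> length t = n \<Longrightarrow> dmat (id_diagram n) s t = id_mat n s t"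
proof -
  assume st: "length s = n" "length t = n"
  have "consistent (id_diagram n) (lab s t) \<longleftrightarrow> (\<forall>j\<in>{1..n}. s ! (j - 1) = t ! (j - 1))"
    unfolding id_diagram_def Setcompr_eq_image consistent_image by simp
  also have "\<dots> \<longleftrightarrow> (\<forall>j<n. s ! j = t ! j)"
  proof
    assume *: "\<forall>j\<in>{1..n}. s ! (j - 1) = t ! (j - 1)"
    show "\<forall>j<n. s ! j = t ! j"
    proof (intro allI impI)
      fix j assume "j < n" then show "s ! j = t ! j" using *[rule_format, of "Suc j"] by simp
    qed
  qed auto
  also have "\<dots> \<longleftrightarrow> s = t" using st by (simp add: list_eq_iff_nth_eq)
  finally show ?thesis using st by (simp add: dmat_def id_mat_def)
qed

lemma dmat_u:
  assumes st: "length s = n" "length t = n" and i: "1 \<le> i" "i < n"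
  shows "dmat (u_diagram n i) s t = u_mat n i s t"
proof -
  have "consistent (u_diagram n i) (lab s t) \<longleftrightarrow> s ! (i - 1) = s ! i \<and> t ! (i - 1) = t ! i \<and>
     (\<forall>j\<in>{1..n} - {i, i + 1}. s ! (j - 1) = t ! (j - 1))"
    unfolding u_diagram_def Setcompr_eq_image consistent_Un consistent_insert consistent_image
    by (simp add: consistent_empty conj_assoc)
  also have "(\<forall>j\<in>{1..n} - {i, i + 1}. s ! (j - 1) = t ! (j - 1)) \<longleftrightarrow>
     (\<forall>j<n. j \<noteq> i - 1 \<and> j \<noteq> i \<longrightarrow> s ! j = t ! j)"
  proof
    assume *: "\<forall>j\<in>{1..n} - {i, i + 1}. s ! (j - 1) = t ! (j - 1)"
    show "\<forall>j<n. j \<noteq> i - 1 \<and> j \<noteq> i \<longrightarrow> s ! j = t ! j"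
    proof (intro allI impI)
      fix j assume "j < n" "j \<noteq> i - 1 \<and> j \<noteq> i"
      then have "Suc j \<in> {1..n} - {i, i + 1}" using i by auto
      then show "s ! j = t ! j" using *[rule_format, of "Suc j"] by simp
    qed
  next
    assume *: "\<forall>j<n. j \<noteq> i - 1 \<and> j \<noteq> i \<longrightarrow> s ! j = t ! j"
    show "\<forall>j\<in>{1..n} - {i, i + 1}. s ! (j - 1) = t ! (j - 1)"
    proof
      fix j assume "j \<in> {1..n} - {i, i + 1}"
      then have "j - 1 < n" "j - 1 \<noteq> i - 1 \<and> j - 1 \<noteq> i" using i by auto
      then show "s ! (j - 1) = t ! (j - 1)" using * by blast
    qed
  qed
  finally show ?thesis using st by (simp add: dmat_def u_mat_def)
qed

lemma mmul_cong:
  assumes "\<And>v. length v = b \<Longrightarrow> A s v = A' s v" "\<And>v. length v = b \<Longrightarrow> B v t = B' v t"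
  shows "mmul b A B s t = mmul b A' B' s t"
  unfolding mmul_def by (intro sum.cong) (simp_all add: assms)

text \<open>Planarity comes for free: multiplying the identity diagram by u gives a noncrossing
  diagram with the same matrix, hence the same diagram.\<close>

lemma u_diagram_in:
  assumes i: "1 \<le> i" "i < n" shows "u_diagram n i \<in> diagrams n n"
proof -
  obtain D' k where D': "D' \<in> diagrams n n" "k > 0"
    "\<And>s t. length s = n \<Longrightarrow> length t = n \<Longrightarrow> mmul n (u_mat n i) (dmat (id_diagram n)) s t = k * dmat D' s t"
    using u_mat_diagram[OF id_diagram_in i] by metis
  have "1 * dmat (u_diagram n i) s t = k * dmat D' s t" if st: "length s = n" "length t = n" for s t
  proof -
    have "k * dmat D' s t = mmul n (u_mat n i) (id_mat n) s t"
      unfolding D'(3)[OF st, symmetric] by (rule mmul_cong) (use st dmat_id in auto)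
    also have "\<dots> = u_mat n i s t" by (simp add: mmul_id_mat_right[OF u_mat_Mat])
    finally show ?thesis using dmat_u[OF st i] by simp
  qed
  note eq = this
  have "u_diagram n i = D' \<and> 1 = k"
  proof (rule pairing_eqI)
    show "pairing n n (u_diagram n i)" by (rule matching_pairing[OF u_diagram_matching[OF i]])
    show "pairing n n D'" by (rule matching_pairing[OF diagrams_matching[OF D'(1)]])
  qed (use D'(2) eq in simp_all)
  then have "u_diagram n i = D'" by (rule conjunct1)
  then show ?thesis using D'(1) by (simp only:)
qed

lemma mat_of_u: "1 \<le> i \<Longrightarrow> i < n \<Longrightarrow> mat_of n n (u_elem n i) = u_mat n i"
  by (rule mat_eqI[OF mat_of_Mat u_mat_Mat]) (simp add: u_elem_def mat_of_of_diagram dmat_u)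

lemma u_elem_in: "1 \<le> i \<Longrightarrow> i < n \<Longrightarrow> u_elem n i \<in> Hom n n"
  unfolding u_elem_def by (intro of_diagram_in_Hom u_diagram_in)

lemma u_diagram_comp:
  assumes D: "D \<in> diagrams a b" and i: "1 \<le> i" "i < a"
  shows "u_elem a i \<odot> of_diagram D \<in> Hom a b"
proof -
  obtain D' k where D': "D' \<in> diagrams a b" "k > 0"
    "\<And>s t. length s = a \<Longrightarrow> length t = b \<Longrightarrow> mmul a (u_mat a i) (dmat D) s t = k * dmat D' s t"
    using u_mat_diagram[OF D i] by metis
  have "mmul a (dmat (u_diagram a i)) (dmat D) s t = k * dmat D' s t" if st: "length s = a" "length t = b" for s t
    unfolding D'(3)[OF st, symmetric] by (rule mmul_cong) (use dmat_u st i in auto)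
  from diagram_comp_eqI[OF diagrams_composable[OF u_diagram_in[OF i] D]
      matching_pairing[OF diagrams_matching[OF D'(1)]] D'(2) this]
  have "diagram_comp (u_diagram a i) D = D'" by simp
  then show ?thesis
    unfolding u_elem_def of_diagram_comp by (simp add: Hom_scale of_diagram_in_Hom D')
qed

text \<open>The reflected form of \<open>u_mat_diagram\<close>.\<close>

lemma diagram_comp_u:
  assumes D: "D \<in> diagrams a b" and i: "1 \<le> i" "i < b"
  shows "diagram_comp D (u_diagram b i) \<in> diagrams a b \<and>
    (\<forall>j l. {Top j, Top l} \<in> D \<longrightarrow> {Top j, Top l} \<in> diagram_comp D (u_diagram b i)) \<and>
    ({Bot i, Bot (i + 1)} \<in> D \<longrightarrow> (\<forall>s t. length s = a \<longrightarrow> length t = b \<longrightarrow>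
       mmul b (dmat D) (u_mat b i) s t = 2 * dmat D s t))"
proof -
  obtain D' k where D': "D' \<in> diagrams b a" "k > 0"
    "\<And>s t. length s = b \<Longrightarrow> length t = a \<Longrightarrow> mmul b (u_mat b i) (dmat (flip D)) s t = k * dmat D' s t"
    "\<And>j l. {Bot j, Bot l} \<in> flip D \<Longrightarrow> {Bot j, Bot l} \<in> D'"
    "{Top i, Top (i + 1)} \<in> flip D \<Longrightarrow> D' = flip D \<and> k = 2"
    using u_mat_diagram[OF flip_diagrams[OF D] i] by metis
  have u_mat: "mmul b (dmat D) (u_mat b i) s t = k * dmat (flip D') s t" if st: "length s = a" "length t = b" for s t
  proof -
    \<comment> \<open>Transposition: the matrix of u is symmetric, and that of D becomes the matrix
      of the reflected diagram.\<close>
    have "mmul b (dmat D) (u_mat b i) s t = mmul b (u_mat b i) (dmat (flip D)) t s"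
      unfolding mmul_def by (intro sum.cong) (auto simp: dmat_flip u_mat_def)
    also have "\<dots> = k * dmat (flip D') s t"
      using D'(3)[OF st(2,1)] by (simp add: dmat_flip)
    finally show ?thesis .
  qed
  have "mmul b (dmat D) (dmat (u_diagram b i)) s t = k * dmat (flip D') s t" if st: "length s = a" "length t = b" for s t
    unfolding u_mat[OF st, symmetric] by (rule mmul_cong) (use dmat_u st i in auto)
  from diagram_comp_eqI[OF diagrams_composable[OF D u_diagram_in[OF i]]
      matching_pairing[OF diagrams_matching[OF flip_diagrams[OF D'(1)]]] D'(2) this]
  have eq: "diagram_comp D (u_diagram b i) = flip D'" by simp
  have "{Top j, Top l} \<in> flip D'" if "{Top j, Top l} \<in> D" for j l
    using D'(4)[of j l] that by (simp add: flip_edge)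
  moreover have "mmul b (dmat D) (u_mat b i) s t = 2 * dmat D s t" if "{Bot i, Bot (i + 1)} \<in> D" "length s = a" "length t = b" for s t
    using u_mat[OF that(2,3)] D'(5) that(1) by (simp add: flip_edge)
  ultimately show ?thesis
    unfolding eq using flip_diagrams[OF D'(1)] by blast
qed

lemma u_elem_Hom:
  assumes "y \<in> Hom a b" "1 \<le> i" "i < a" shows "u_elem a i \<odot> y \<in> Hom a b"
  using assms(1)
proof (induction rule: Hom_induct)
  case (of_diagram D)
  then show ?case by (rule u_diagram_comp[OF _ assms(2,3)])
qed (simp_all add: hom_comp_add_right hom_comp_scale_right Hom_add Hom_scale)

lemma Hom_u_elem:
  assumes "x \<in> Hom a b" "1 \<le> i" "i < b" shows "x \<odot> u_elem b i \<in> Hom a b"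
  using assms(1)
proof (induction rule: Hom_induct)
  case (of_diagram D)
  then show ?case
    using diagram_comp_u[OF of_diagram assms(2,3)]
    by (simp add: u_elem_def of_diagram_comp Hom_scale of_diagram_in_Hom)
qed (simp_all add: hom_comp_add_left hom_comp_scale_left Hom_add Hom_scale)

lemma id_comp:
  assumes "y \<in> Hom a b" shows "of_diagram (id_diagram a) \<odot> y = y"
  using assms
proof (induction rule: Hom_induct)
  case (of_diagram D)
  have "mmul a (dmat (id_diagram a)) (dmat D) s t = 1 * dmat D s t" if st: "length s = a" "length t = b" for s t
  proof -
    have "mmul a (dmat (id_diagram a)) (dmat D) s t = mmul a (id_mat a) (mat_of a b (of_diagram D)) s t"
      by (rule mmul_cong) (use st in \<open>auto simp: dmat_id mat_of_of_diagram\<close>)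
    then show ?thesis using st by (simp add: mmul_id_mat_left[OF mat_of_Mat] mat_of_of_diagram)
  qed
  from diagram_comp_eqI[OF diagrams_composable[OF id_diagram_in of_diagram]
      matching_pairing[OF diagrams_matching[OF of_diagram]] _ this]
  show ?case by (simp add: of_diagram_comp)
qed (simp_all add: hom_comp_add_right hom_comp_scale_right)

text \<open>The stability of \<open>Hom n b\<close> under x is part of the claim since it cannot be
  read off from the matrix of x.\<close>

lemma u_span_lift:
  assumes "A \<in> u_span n"
  obtains x where "x \<in> Hom n n" "mat_of n n x = A" "\<And>b y. y \<in> Hom n b \<Longrightarrow> x \<odot> y \<in> Hom n b"
proof -
  have "\<exists>x. x \<in> Hom n n \<and> mat_of n n x = A \<and> (\<forall>b. \<forall>y\<in>Hom n b. x \<odot> y \<in> Hom n b)"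
    using assms
  proof (induction rule: u_span.induct)
    case u_span_id_mat
    have "mat_of n n (of_diagram (id_diagram n)) = id_mat n"
      by (rule mat_eqI[OF mat_of_Mat id_mat_Mat]) (simp add: mat_of_of_diagram dmat_id)
    then show ?case
      by (intro exI[of _ "of_diagram (id_diagram n)"]) (simp add: of_diagram_in_Hom id_comp)
  next
    case (u_span_u_mat i A)
    then obtain x where x: "x \<in> Hom n n" "mat_of n n x = A" "\<forall>b. \<forall>y\<in>Hom n b. x \<odot> y \<in> Hom n b" by blast
    \<comment> \<open>Rebracketed, the product only needs that a single generator preserves
      planarity.\<close>
    have "(u_elem n i \<odot> x) \<odot> y \<in> Hom n b" if "y \<in> Hom n b" for b y
      unfolding hom_comp_assoc[OF u_elem_in[OF u_span_u_mat(1,2)] x(1) that]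
      using x that u_span_u_mat by (intro u_elem_Hom) auto
    then show ?case
      using x u_span_u_mat by (intro exI[of _ "u_elem n i \<odot> x"]) (simp add: u_elem_Hom mat_of_hom_comp[of _ n n _ n] u_elem_in mat_of_u)
  next
    case (u_span_lcomb A B c d)
    then obtain x y where x: "x \<in> Hom n n" "mat_of n n x = A" "\<forall>b. \<forall>y\<in>Hom n b. x \<odot> y \<in> Hom n b"
      and y: "y \<in> Hom n n" "mat_of n n y = B" "\<forall>b. \<forall>z\<in>Hom n b. y \<odot> z \<in> Hom n b" by blast
    then show ?case
      by (intro exI[of _ "comb_scale c x + comb_scale d y"])
        (simp add: Hom_add Hom_scale mat_of_lcomb hom_comp_add_left hom_comp_scale_left)
  qed
  then show thesis using that by blast
qed

section \<open>Faithfulness\<close>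

definition opener :: "diagram \<Rightarrow> point \<Rightarrow> bool" where
  "opener D p \<longleftrightarrow> (\<exists>q. {p, q} \<in> D \<and> bpos p < bpos q)"

text \<open>
  Unlike \<open>bpos\<close>, which skips 0, this numbers the boundary consecutively: an edge of a noncrossing
  matching encloses an even number of points and hence joins positions of different parity.
\<close>

fun pos :: "point \<Rightarrow> int" where
  "pos (Top i) = - int i"
| "pos (Bot j) = int j - 1"

lemma matching_subset_eq:
  assumes D: "matching a b D" and E: "matching a b E" and sub: "D \<subseteq> E" shows "D = E"
proof (rule equalityI[OF sub], rule subsetI)
  fix e assume e: "e \<in> E"
  then obtain p q where pq: "e = {p, q}" using matching_edgeE[OF E] by metis
  then have "p \<in> points a b" using matching_edge_points[OF E] e by blast
  then obtain r where r: "{p, r} \<in> D" by (rule matching_partner[OF D])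
  then have "{p, r} \<in> E" using sub by blast
  then have "q = r" using matching_edge_unique[OF E] e pq by blast
  then show "e \<in> D" using r pq by simp
qed

lemma edge_bpos_neq: "matching a b D \<Longrightarrow> {p, q} \<in> D \<Longrightarrow> bpos p \<noteq> bpos q"
  using bpos_inj matching_edge_points matching_edge_neq by metis

lemma opener_edge: "matching a b D \<Longrightarrow> {p, q} \<in> D \<Longrightarrow> opener D p \<longleftrightarrow> bpos p < bpos q"
  unfolding opener_def using matching_edge_unique by metis

lemma pos_less: "p \<in> points a b \<Longrightarrow> q \<in> points a b \<Longrightarrow> pos p < pos q \<longleftrightarrow> bpos p < bpos q"
  by (cases p; cases q) (auto simp: points_def image_iff)

lemma partner_inside:
  assumes D: "matching a b D" "noncrossing D" and pq: "{p, q} \<in> D" "bpos p < bpos q"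
    and r: "{r, r'} \<in> D" "bpos p < bpos r" "bpos r < bpos q"
  shows "bpos p < bpos r' \<and> bpos r' < bpos q"
proof -
  have rn: "r \<noteq> p" "r \<noteq> q" using r by auto
  have r'r: "{r', r} \<in> D" using r(1) by (simp add: insert_commute)
  have qp: "{q, p} \<in> D" using pq(1) by (simp add: insert_commute)
  have "r' \<noteq> p"
  proof
    assume "r' = p"
    then have "{p, r} \<in> D" using r'r by simp
    then show False using matching_edge_unique[OF D(1) pq(1)] rn by simp
  qed
  moreover have "r' \<noteq> q"
  proof
    assume "r' = q"
    then have "{q, r} \<in> D" using r'r by simp
    then show False using matching_edge_unique[OF D(1) qp] rn by simp
  qed
  moreover have "r' \<in> points a b" "p \<in> points a b" "q \<in> points a b"
    using matching_edge_points[OF D(1)] r(1) pq(1) by blast+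
  ultimately have "bpos r' \<noteq> bpos p" "bpos r' \<noteq> bpos q"
    using bpos_inj by metis+
  then show ?thesis
    using noncrossing_sep[OF D(2) pq(1) r(1) pq(2)] r by auto
qed

text \<open>On \<open>points a b\<close> the function \<open>pos\<close> takes each integer from -a
  to b - 1 exactly once, so the points between p and q can be counted.\<close>

lemma bij_pos_interval:
  assumes "p \<in> points a b" "q \<in> points a b"
  shows "bij_betw pos {r \<in> points a b. bpos p < bpos r \<and> bpos r < bpos q} {pos p<..<pos q}"
proof (rule bij_betwI')
  fix r s assume "r \<in> {r \<in> points a b. bpos p < bpos r \<and> bpos r < bpos q}"
    "s \<in> {r \<in> points a b. bpos p < bpos r \<and> bpos r < bpos q}"
  then have rs: "r \<in> points a b" "s \<in> points a b" by auto
  have "pos r = pos s \<longleftrightarrow> bpos r = bpos s"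
    using pos_less[OF rs] pos_less[OF rs(2,1)] by linarith
  then show "(pos r = pos s) = (r = s)"
    using bpos_inj[OF rs] by simp
next
  fix r assume "r \<in> {r \<in> points a b. bpos p < bpos r \<and> bpos r < bpos q}"
  then show "pos r \<in> {pos p<..<pos q}"
    using pos_less[of p a b r] pos_less[of r a b q] assms by auto
next
  fix z assume z: "z \<in> {pos p<..<pos q}"
  define r where "r = (if z < 0 then Top (nat (- z)) else Bot (nat (z + 1)))"
  have "- int a \<le> pos p" "pos q < int b"
    using assms by (cases p; cases q; auto simp: points_def image_iff)+
  then have "r \<in> points a b" and pr: "pos r = z"
    using z by (auto simp: r_def points_def image_iff)
  then show "\<exists>r\<in>{r \<in> points a b. bpos p < bpos r \<and> bpos r < bpos q}. z = pos r"
    using pos_less[of p a b r] pos_less[of r a b q] assms z by (intro bexI[of _ r]) auto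
qed

lemma odd_edge:
  assumes D: "matching a b D" "noncrossing D" and pq: "{p, q} \<in> D" "bpos p < bpos q"
  shows "odd (pos q - pos p)"
proof -
  define B where "B = {r \<in> points a b. bpos p < bpos r \<and> bpos r < bpos q}"
  define DB where "DB = {e \<in> D. e \<subseteq> B}"
  have pts: "p \<in> points a b" "q \<in> points a b" using matching_edge_points[OF D(1) pq(1)] by auto
  \<comment> \<open>By planarity an edge that meets the interior of the interval lies inside it, so
    the interior is a union of edges.\<close>
  have "\<Union>DB = B"
  proof (intro equalityI subsetI)
    fix r assume r: "r \<in> B"
    then obtain r' where r': "{r, r'} \<in> D"
      using matching_partner[OF D(1), of r] by (auto simp: B_def)
    have "r' \<in> B"
      using partner_inside[OF D pq r'] r matching_edge_points[OF D(1) r'] by (auto simp: B_def)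
    then have "{r, r'} \<in> DB" using r r' by (simp add: DB_def)
    then show "r \<in> \<Union>DB" by blast
  qed (auto simp: DB_def)
  moreover have "card (\<Union>DB) = (\<Sum>e\<in>DB. card e)"
  proof (rule card_Union_disjoint)
    show "pairwise disjnt DB"
      using matching_disjoint[OF D(1)] by (auto simp: pairwise_def disjnt_def DB_def)
    have "card e = 2" if "e \<in> DB" for e
      using D(1) that by (simp add: DB_def matching_def)
    then show "finite e" if "e \<in> DB" for e
      using that by (metis card.infinite zero_neq_numeral)
  qed
  moreover have "(\<Sum>e\<in>DB. card e) = 2 * card DB"
    using D(1) by (simp add: DB_def matching_def)
  ultimately have "even (card B)" by simp
  moreover have "card B = nat (pos q - pos p - 1)"
    using bij_betw_same_card[OF bij_pos_interval[OF pts]] by (simp add: B_def)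
  moreover have "pos p < pos q" using pos_less[OF pts] pq by simp
  ultimately show ?thesis
    by (simp add: even_nat_iff)
qed

text \<open>Openers and closers form a balanced bracket word. Induction on the position of the
  closer q of an edge {p, q} of D: if E pairs q with some p' other than p, then the partner of p' in
  D (p' right of p) or of p in E (p' left of p) closes before q, and there D and E already agree, a
  contradiction.\<close>

lemma opener_determines:
  assumes D: "matching a b D" "noncrossing D" and E: "matching a b E" "noncrossing E"
    and op: "\<And>p. p \<in> points a b \<Longrightarrow> opener D p = opener E p"
  shows "D = E"
proof (rule matching_subset_eq[OF D(1) E(1)])
  have main: "{p, q} \<in> E" if "{p, q} \<in> D" "bpos p < bpos q" for p q
    using that
  \<comment> \<open>The shift by a makes all positions nonnegative, so that \<open>nat\<close>
    preserves their order.\<close>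
  proof (induction "nat (bpos q + int a)" arbitrary: p q rule: less_induct)
    case less
    have pts: "p \<in> points a b" "q \<in> points a b" using matching_edge_points[OF D(1) less.prems(1)] by auto
    have pos: "- int a \<le> bpos r" if "r \<in> points a b" for r
      using that by (auto simp: points_def)
    have IH: "{p', q'} \<in> E" if "{p', q'} \<in> D" "bpos p' < bpos q'" "bpos q' < bpos q" for p' q'
    proof (rule less.hyps[OF _ that(1,2)])
      show "nat (bpos q' + int a) < nat (bpos q + int a)"
        using that pos[of q'] matching_edge_points[OF D(1) that(1)] by auto
    qed
    have qp: "{q, p} \<in> D" using less.prems by (simp add: insert_commute)
    have "\<not> opener D q" "opener D p"
      using opener_edge[OF D(1) qp] opener_edge[OF D(1) less.prems(1)] less.prems(2) by auto
    then have opq: "\<not> opener E q" "opener E p" using op pts by auto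
    obtain p' where p': "{q, p'} \<in> E" using matching_partner[OF E(1) pts(2)] .
    then have p'q: "{p', q} \<in> E" by (simp add: insert_commute)
    have lt: "bpos p' < bpos q"
      using opq(1) opener_edge[OF E(1) p'] edge_bpos_neq[OF E(1) p'] by auto
    have p'pts: "p' \<in> points a b" using matching_edge_points[OF E(1) p'] by simp
    show ?case
    proof (cases "p' = p")
      case True then show ?thesis using p'q by simp
    next
      case False
      then have "bpos p' \<noteq> bpos p" using bpos_inj pts p'pts by metis
      then consider "bpos p < bpos p'" | "bpos p' < bpos p" by linarith
      then show ?thesis
      proof cases
        case 1
        have "opener E p'" using opener_edge[OF E(1) p'q] lt by simp
        then have "opener D p'" using op p'pts by simp
        then obtain q'' where q'': "{p', q''} \<in> D" "bpos p' < bpos q''" unfolding opener_def by blast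
        have "bpos q'' < bpos q"
          using partner_inside[OF D less.prems q''(1) 1 lt] by simp
        then have "{p', q''} \<in> E" using IH q'' by simp
        then have "q'' = q" using matching_edge_unique[OF E(1) p'q] by simp
        then show ?thesis using \<open>bpos q'' < bpos q\<close> by simp
      next
        case 2
        obtain q' where q': "{p, q'} \<in> E" "bpos p < bpos q'" using opq(2) unfolding opener_def by blast
        have "bpos q' < bpos q"
          using partner_inside[OF E p'q lt q'(1) 2 less.prems(2)] by simp
        have q'pts: "q' \<in> points a b" using matching_edge_points[OF E(1) q'(1)] by simp
        have q'p: "{q', p} \<in> E" using q'(1) by (simp add: insert_commute)
        have "\<not> opener E q'" using opener_edge[OF E(1) q'p] q'(2) by simp
        then have nop: "\<not> opener D q'" using op q'pts by simp
        obtain p'' where p'': "{q', p''} \<in> D" using matching_partner[OF D(1) q'pts] .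
        then have p''q': "{p'', q'} \<in> D" by (simp add: insert_commute)
        have "bpos p'' < bpos q'"
          using nop opener_edge[OF D(1) p''] edge_bpos_neq[OF D(1) p''] by auto
        then have "{p'', q'} \<in> E" using IH p''q' \<open>bpos q' < bpos q\<close> by simp
        then have "{q', p''} \<in> E" by (simp add: insert_commute)
        then have "p'' = p" using matching_edge_unique[OF E(1) q'p] by simp
        then have "q' = q" using matching_edge_unique[OF D(1) less.prems(1)] p''q' by simp
        then show ?thesis using \<open>bpos q' < bpos q\<close> by simp
      qed
    qed
  qed
  show "D \<subseteq> E"
  proof
    fix e assume e: "e \<in> D"
    then obtain p q where pq: "e = {p, q}" using matching_edgeE[OF D(1)] by metis
    then have 1: "{p, q} \<in> D" "{q, p} \<in> D" using e by (simp_all add: insert_commute)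
    have "bpos p < bpos q \<or> bpos q < bpos p"
      using edge_bpos_neq[OF D(1) 1(1)] by linarith
    then show "e \<in> E" using main[OF 1(1)] main[OF 1(2)] pq by (auto simp: insert_commute)
  qed
qed

definition weight :: "nat \<Rightarrow> nat \<Rightarrow> (point \<Rightarrow> bool) \<Rightarrow> int" where
  "weight a b f = (\<Sum>p\<in>points a b. if f p then bpos p else 0)"

lemma weight_edges:
  assumes D: "matching a b D"
  shows "weight a b f = (\<Sum>e\<in>D. \<Sum>p\<in>e. if f p then bpos p else 0)"
proof -
  have "points a b = \<Union>D" using D partition_onD1 by (auto simp: matching_def)
  moreover have "card e = 2" if "e \<in> D" for e using D that by (simp add: matching_def)
  then have "finite e" if "e \<in> D" for e using that by (metis card.infinite zero_neq_numeral)
  ultimately show ?thesis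
    unfolding weight_def
    by (simp only:, subst sum.Union_disjoint) (use matching_disjoint[OF D] in auto)
qed

text \<open>Among all functions that choose one end of every edge, \<open>opener\<close> takes the
  left one each time. It minimises the weight edge by edge and is the only minimiser.\<close>

lemma weight_opener:
  assumes D: "matching a b D" and f: "\<And>p q. {p, q} \<in> D \<Longrightarrow> f p \<noteq> f q"
  shows "weight a b (opener D) \<le> weight a b f"
    and "weight a b f = weight a b (opener D) \<Longrightarrow> p \<in> points a b \<Longrightarrow> f p = opener D p"
proof -
  let ?g = "\<lambda>f e. \<Sum>p\<in>e. if f p then bpos p else (0 :: int)"
  have edge: "?g (opener D) e \<le> ?g f e \<and> (?g f e = ?g (opener D) e \<longrightarrow> (\<forall>p\<in>e. f p = opener D p))"
    if e: "e \<in> D" for e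
  proof -
    have *: ?thesis if pq: "e = {p, q}" "bpos p < bpos q" for p q
    proof -
      have 1: "{p, q} \<in> D" "{q, p} \<in> D" using e pq by (simp_all add: insert_commute)
      have "p \<noteq> q" using pq by auto
      moreover have "opener D p" "\<not> opener D q"
        using opener_edge[OF D 1(1)] opener_edge[OF D 1(2)] pq by simp_all
      ultimately show ?thesis
        unfolding pq(1) using pq(2) f[OF 1(1)] by auto
    qed
    obtain p q where pq: "e = {p, q}" using matching_edgeE[OF D e] by metis
    then have "bpos p \<noteq> bpos q" using edge_bpos_neq[OF D] e by simp
    then consider "bpos p < bpos q" | "bpos q < bpos p" by linarith
    then show ?thesis
    proof cases
      case 1
      then show ?thesis by (rule *[OF pq])
    next
      case 2
      have "e = {q, p}" using pq by (simp add: insert_commute)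
      then show ?thesis using 2 by (rule *)
    qed
  qed
  have "finite (points a b)" by (simp add: points_def)
  moreover have "partition_on (points a b) D" using D by (simp add: matching_def)
  ultimately have fin: "finite D" by (rule finite_elements)
  show "weight a b (opener D) \<le> weight a b f"
    unfolding weight_edges[OF D] by (rule sum_mono[OF edge[THEN conjunct1]])
  assume eq: "weight a b f = weight a b (opener D)" and p: "p \<in> points a b"
  obtain q where q: "{p, q} \<in> D" using matching_partner[OF D p] .
  have "?g f e = ?g (opener D) e" if "e \<in> D" for e
  proof (rule ccontr)
    assume "?g f e \<noteq> ?g (opener D) e"
    then have "?g (opener D) e < ?g f e" using edge[OF that] by linarith
    then have "\<exists>e\<in>D. ?g (opener D) e < ?g f e" using that by (rule bexI)
    then have "(\<Sum>e\<in>D. ?g (opener D) e) < (\<Sum>e\<in>D. ?g f e)"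
      by (intro sum_strict_mono_ex1[OF fin] ballI edge[THEN conjunct1])
    then show False using eq unfolding weight_edges[OF D] by simp
  qed
  from edge[OF q] this[OF q] show "f p = opener D p" by simp
qed

text \<open>Take D of least weight in the support, and its twisted colouring. If E in the support is
  consistent with it, the openers of D choose one end of each edge of E, so E weighs at most as much
  as D; by minimality the weights agree and E = D. The matrix entry there is thus the coefficient of
  D, which is nonzero.\<close>

lemma mat_of_faithful:
  assumes x: "x \<in> Hom a b" and 0: "mat_of a b x = zero_mat"
  shows "x = 0"
proof (rule ccontr)
  assume "x \<noteq> 0"
  let ?K = "Poly_Mapping.keys x"
  let ?w = "\<lambda>D. weight a b (opener D)"
  have K: "?K \<noteq> {}" "finite ?K" using \<open>x \<noteq> 0\<close> by simp_all
  define D where "D = arg_min_on ?w ?K"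
  have DK: "D \<in> ?K"
    unfolding D_def by (rule arg_min_if_finite(1)[OF K(2,1)])
  have Dmin: "?w D \<le> ?w E" if "E \<in> ?K" for E
    unfolding D_def by (rule arg_min_least[OF K(2,1) that])
  have dia: "matching a b E" "noncrossing E" if "E \<in> ?K" for E
    using x that diagrams_matching by (auto simp: Hom_iff diagrams_def)
  \<comment> \<open>Parity changes along every edge of a noncrossing matching, so equal colours at
    the ends mean that exactly one end is an opener of \<open>D\<close>.\<close>
  define f where "f p = (opener D p \<noteq> even (pos p))" for p
  let ?s = "label_list a (\<lambda>i. f (Top i))" and ?t = "label_list b (\<lambda>i. f (Bot i))"
  have lab: "lab ?s ?t p = f p" if "p \<in> points a b" for p
    using lab_label_list[OF that] .
  have fedge: "f p = f q \<longleftrightarrow> opener D p \<noteq> opener D q" if E: "E \<in> ?K" "{p, q} \<in> E" for E p q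
  proof -
    have qp: "{q, p} \<in> E" using E by (simp add: insert_commute)
    have "bpos p < bpos q \<or> bpos q < bpos p" using edge_bpos_neq[OF dia(1)[OF E(1)] E(2)] by linarith
    then have "odd (pos q - pos p)"
      using odd_edge[OF dia[OF E(1)] E(2)] odd_edge[OF dia[OF E(1)] qp] by auto
    then show ?thesis by (auto simp: f_def)
  qed
  have "consistent E (lab ?s ?t) \<longleftrightarrow> E = D" if E: "E \<in> ?K" for E
  proof
    assume "E = D"
    show "consistent E (lab ?s ?t)"
      unfolding consistent_def
    proof (intro ballI)
      fix e p q assume e: "e \<in> E" "p \<in> e" "q \<in> e"
      then obtain u v where uv: "e = {u, v}" using matching_edgeE[OF dia(1)[OF E]] by metis
      then have "{u, v} \<in> D" "{v, u} \<in> D" using e \<open>E = D\<close> by (simp_all add: insert_commute)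
      then have "opener D u \<noteq> opener D v"
        using opener_edge[OF dia(1)[OF DK]] edge_bpos_neq[OF dia(1)[OF DK]] by fastforce
      then have "f u = f v" using fedge[OF DK \<open>{u, v} \<in> D\<close>] by simp
      moreover have "u \<in> points a b" "v \<in> points a b"
        using matching_edge_points[OF dia(1)[OF DK] \<open>{u, v} \<in> D\<close>] by simp_all
      ultimately show "lab ?s ?t p = lab ?s ?t q" using e uv lab by auto
    qed
  next
    assume c: "consistent E (lab ?s ?t)"
    have ne: "opener D p \<noteq> opener D q" if "{p, q} \<in> E" for p q
    proof -
      have "lab ?s ?t p = lab ?s ?t q" using c that unfolding consistent_def by (metis insertCI)
      then have "f p = f q" using lab matching_edge_points[OF dia(1)[OF E] that] by simp
      then show ?thesis using fedge[OF E that] by simp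
    qed
    have "?w E \<le> ?w D" by (rule weight_opener(1)[OF dia(1)[OF E] ne])
    then have "?w D = ?w E" using Dmin[OF E] by linarith
    then have "opener D p = opener E p" if "p \<in> points a b" for p
      using weight_opener(2)[where f = "opener D", OF dia(1)[OF E] ne _ that] by blast
    then show "E = D" using opener_determines[OF dia[OF DK] dia[OF E]] by simp
  qed
  then have dmat: "dmat E ?s ?t = (if E = D then 1 else 0)" if "E \<in> ?K" for E
    using that by (simp add: dmat_def)
  have "mat_of a b x ?s ?t = (\<Sum>E\<in>?K. if E = D then Poly_Mapping.lookup x E else 0)"
    unfolding mat_of_def by (simp only: length_label_list simp_thms if_True) (intro sum.cong refl, simp add: dmat)
  also have "\<dots> = Poly_Mapping.lookup x D"
    using K(2) DK by simp
  finally show False using 0 DK by (simp add: in_keys_iff)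
qed

lemma mat_of_inj: "x \<in> Hom a b \<Longrightarrow> y \<in> Hom a b \<Longrightarrow> mat_of a b x = mat_of a b y \<Longrightarrow> x = y"
proof -
  assume xy: "x \<in> Hom a b" "y \<in> Hom a b" "mat_of a b x = mat_of a b y"
  then have "mat_of a b (x - y) = zero_mat" by (simp add: fun_eq_iff mat_of_diff)
  then have "x - y = 0" by (rule mat_of_faithful[OF Hom_diff[OF xy(1,2)]])
  then show "x = y" by simp
qed

section \<open>The Jones-Wenzl idempotent\<close>

text \<open>An innermost cap joins neighbours: the partner of \<open>Top (i + 1)\<close> is trapped
  under the cap and yields a shorter one.\<close>

lemma cap_between:
  assumes D: "matching a b D" "noncrossing D"
  shows "{Top i, Top j} \<in> D \<Longrightarrow> i < j \<Longrightarrow> \<exists>l. i \<le> l \<and> l < j \<and> {Top l, Top (l + 1)} \<in> D"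
proof (induction "j - i" arbitrary: i j rule: less_induct)
  case less
  show ?case
  proof (cases "j = i + 1")
    case True
    then show ?thesis using less.prems by (intro exI[of _ i]) simp
  next
    case False
    then have lt: "i + 1 < j" using less.prems by simp
    have ji: "{Top j, Top i} \<in> D" using less.prems by (simp add: insert_commute)
    have "Top (i + 1) \<in> points a b"
      using matching_edge_points[OF D(1) less.prems(1)] lt by (auto simp: points_def)
    then obtain r where r: "{Top (i + 1), r} \<in> D" by (rule matching_partner[OF D(1)])
    have "bpos (Top j) < bpos r \<and> bpos r < bpos (Top i)"
      by (rule partner_inside[OF D ji _ r]) (use lt in simp_all)
    then obtain l where l: "r = Top l" "i < l" "l < j" by (cases r) auto
    have "l \<noteq> i + 1" using matching_edge_neq[OF D(1) r] l by auto
    then have "i + 1 < l" "l - (i + 1) < j - i" using l by auto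
    from less.hyps[OF this(2) _ this(1)] r l obtain k where "i + 1 \<le> k" "k < l" "{Top k, Top (k + 1)} \<in> D"
      by auto
    then show ?thesis using l by (intro exI[of _ k]) simp
  qed
qed

text \<open>Without caps every top point goes to the bottom, and planarity makes this map strictly
  increasing, hence the identity.\<close>

lemma no_cap_id:
  assumes D: "matching n n D" "noncrossing D" and no: "\<And>i j. {Top i, Top j} \<notin> D"
  shows "D = id_diagram n"
proof -
  have ex: "\<exists>k. {Top i, Bot k} \<in> D \<and> 1 \<le> k \<and> k \<le> n" if "1 \<le> i" "i \<le> n" for i
  proof -
    have "Top i \<in> points n n" using that by (simp add: points_def)
    then obtain r where r: "{Top i, r} \<in> D" by (rule matching_partner[OF D(1)])
    then obtain k where k: "r = Bot k" using no by (cases r) auto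
    then show ?thesis using r matching_edge_points[OF D(1) r] by (auto simp: points_def)
  qed
  define \<sigma> where "\<sigma> i = (SOME k. {Top i, Bot k} \<in> D \<and> 1 \<le> k \<and> k \<le> n)" for i
  have s: "{Top i, Bot (\<sigma> i)} \<in> D" "1 \<le> \<sigma> i" "\<sigma> i \<le> n" if "1 \<le> i" "i \<le> n" for i
    using someI_ex[OF ex[OF that]] by (simp_all add: \<sigma>_def)
  have inj: "i = j" if "1 \<le> i" "i \<le> n" "1 \<le> j" "j \<le> n" "\<sigma> i = \<sigma> j" for i j
  proof -
    have "{Bot (\<sigma> i), Top i} \<in> D" "{Bot (\<sigma> i), Top j} \<in> D"
      using s(1)[of i] s(1)[of j] that by (simp_all add: insert_commute)
    then show ?thesis using matching_edge_unique[OF D(1)] by blast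
  qed
  have mono: "\<sigma> i < \<sigma> j" if "1 \<le> i" "i < j" "j \<le> n" for i j
  proof (rule ccontr)
    assume "\<not> \<sigma> i < \<sigma> j"
    moreover have "\<sigma> i \<noteq> \<sigma> j" using inj[of i j] that by auto
    ultimately have "\<sigma> j < \<sigma> i" by simp
    then show False
      using noncrossingD[OF D(2) s(1)[of j] s(1)[of i]] s(2)[of j] that by simp
  qed
  have fixed: "\<sigma> i = i" if i: "1 \<le> i" "i \<le> n" for i
  proof -
    \<comment> \<open>Counting the smaller indices bounds \<sigma> i from below by i; counting the
      larger ones bounds it from above.\<close>
    have "card {1..<i} \<le> card {1..<\<sigma> i}"
    proof (rule card_inj_on_le)
      show "inj_on \<sigma> {1..<i}" using inj i by (intro inj_onI) auto
      show "\<sigma> ` {1..<i} \<subseteq> {1..<\<sigma> i}" using mono[of _ i] s(2) i by auto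
    qed simp
    moreover have "card {i<..n} \<le> card {\<sigma> i<..n}"
    proof (rule card_inj_on_le)
      show "inj_on \<sigma> {i<..n}" using inj i by (intro inj_onI) auto
      show "\<sigma> ` {i<..n} \<subseteq> {\<sigma> i<..n}" using mono[of i] s(3) i by auto
    qed simp
    ultimately show ?thesis using s(2,3)[OF i] i by simp
  qed
  have "id_diagram n \<subseteq> D"
    unfolding id_diagram_def using s(1) fixed by auto
  then show ?thesis
    using matching_subset_eq[OF diagrams_matching[OF id_diagram_in] D(1)] by simp
qed

lemma cap_exists:
  assumes D: "D \<in> diagrams n n" "D \<noteq> id_diagram n"
  obtains i where "1 \<le> i" "i < n" "{Top i, Top (i + 1)} \<in> D"
proof -
  have m: "matching n n D" "noncrossing D" using D diagrams_matching by (auto simp: diagrams_def)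
  then obtain i j where ij: "{Top i, Top j} \<in> D" using no_cap_id D(2) by blast
  then have "{Top j, Top i} \<in> D" by (simp add: insert_commute)
  moreover have "i \<noteq> j" using matching_edge_neq[OF m(1) ij] by simp
  ultimately obtain l where l: "{Top l, Top (l + 1)} \<in> D"
    using cap_between[OF m, of i j] cap_between[OF m, of j i] ij by (metis linorder_neqE_nat)
  from matching_edge_points[OF m(1) l] have "1 \<le> l" "l < n" by (auto simp: points_def)
  then show thesis using that l by blast
qed

lemma flip_id: "flip (id_diagram n) = id_diagram n"
proof -
  have "{p, q} \<in> flip (id_diagram n) \<longleftrightarrow> {p, q} \<in> id_diagram n" for p q
    unfolding flip_edge by (cases p; cases q) (auto simp: id_diagram_def doubleton_eq_iff)
  then have "id_diagram n \<subseteq> flip (id_diagram n)"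
    by (auto simp: id_diagram_def)
  then show ?thesis
    using matching_subset_eq diagrams_matching flip_diagrams id_diagram_in by metis
qed

lemma cup_exists:
  assumes D: "D \<in> diagrams n n" "D \<noteq> id_diagram n"
  obtains i where "1 \<le> i" "i < n" "{Bot i, Bot (i + 1)} \<in> D"
proof -
  have "flip D \<noteq> id_diagram n" using D(2) flip_id by (metis flip_flip)
  then obtain i where "1 \<le> i" "i < n" "{Top i, Top (i + 1)} \<in> flip D"
    using cap_exists[OF flip_diagrams[OF D(1)]] by metis
  then show thesis using that by (simp add: flip_edge)
qed

lemma mat_of_id: "mat_of n n (of_diagram (id_diagram n)) = id_mat n"
  by (rule mat_eqI[OF mat_of_Mat id_mat_Mat]) (simp add: mat_of_of_diagram dmat_id)

text \<open>Every diagram R other than the identity has a cup at some i, so 2 R Z = R u Z = 0. Only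
  the identity acts on Z, hence a scalar c that serves all such Z.\<close>

lemma Hom_killed_right:
  assumes "x \<in> Hom n n"
  shows "\<exists>c. \<forall>Z\<in>Mat n n. (\<forall>i. 1 \<le> i \<and> i < n \<longrightarrow> mmul n (u_mat n i) Z = zero_mat) \<longrightarrow>
     mmul n (mat_of n n x) Z = lcomb c Z 0 Z"
  using assms
proof (induction rule: Hom_induct)
  case zero
  show ?case by (intro exI[of _ 0]) (simp add: lcomb_def)
next
  case (of_diagram D)
  show ?case
  proof (cases "D = id_diagram n")
    case True
    then show ?thesis by (intro exI[of _ 1]) (simp add: mat_of_id mmul_id_mat_left lcomb_def)
  next
    case False
    obtain i where i: "1 \<le> i" "i < n" "{Bot i, Bot (i + 1)} \<in> D"
      using cup_exists[OF of_diagram False] .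
    let ?R = "mat_of n n (of_diagram D)"
    have *: "mmul n ?R (u_mat n i) = lcomb 2 ?R 0 ?R"
    proof (rule mat_eqI[OF mmul_Mat[OF mat_of_Mat u_mat_Mat] lcomb_Mat[OF mat_of_Mat mat_of_Mat]])
      fix s t :: "bool list" assume st: "length s = n" "length t = n"
      have "mmul n ?R (u_mat n i) s t = mmul n (dmat D) (u_mat n i) s t"
        by (rule mmul_cong) (use st in \<open>simp_all add: mat_of_of_diagram\<close>)
      also have "\<dots> = 2 * dmat D s t"
        using diagram_comp_u[OF of_diagram i(1,2)] i(3) st by blast
      finally show "mmul n ?R (u_mat n i) s t = lcomb 2 ?R 0 ?R s t"
        using st by (simp add: lcomb_def mat_of_of_diagram)
    qed
    have "mmul n ?R Z = zero_mat" if "\<forall>i. 1 \<le> i \<and> i < n \<longrightarrow> mmul n (u_mat n i) Z = zero_mat" for Z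
    proof -
      have "lcomb 2 (mmul n ?R Z) 0 (mmul n ?R Z) = mmul n (mmul n ?R (u_mat n i)) Z" unfolding * by simp
      also have "\<dots> = zero_mat" using that i by (simp add: mmul_assoc)
      finally show ?thesis by (simp add: lcomb_def fun_eq_iff)
    qed
    then show ?thesis by (intro exI[of _ 0]) (simp add: lcomb_def)
  qed
next
  case (add x y)
  then obtain c d where
    "\<forall>Z\<in>Mat n n. (\<forall>i. 1 \<le> i \<and> i < n \<longrightarrow> mmul n (u_mat n i) Z = zero_mat) \<longrightarrow> mmul n (mat_of n n x) Z = lcomb c Z 0 Z"
    "\<forall>Z\<in>Mat n n. (\<forall>i. 1 \<le> i \<and> i < n \<longrightarrow> mmul n (u_mat n i) Z = zero_mat) \<longrightarrow> mmul n (mat_of n n y) Z = lcomb d Z 0 Z"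
    by blast
  note cd = this
  have eq: "mat_of n n (x + y) = lcomb 1 (mat_of n n x) 1 (mat_of n n y)"
    by (simp add: lcomb_def fun_eq_iff mat_of_add)
  show ?case
    unfolding eq mmul_lcomb_left
  proof (intro exI[of _ "c + d"] ballI impI)
    fix Z assume "Z \<in> Mat n n" "\<forall>i. 1 \<le> i \<and> i < n \<longrightarrow> mmul n (u_mat n i) Z = zero_mat"
    then have 1: "mmul n (mat_of n n x) Z = lcomb c Z 0 Z" and 2: "mmul n (mat_of n n y) Z = lcomb d Z 0 Z"
      using cd by blast+
    show "lcomb 1 (mmul n (mat_of n n x) Z) 1 (mmul n (mat_of n n y) Z) = lcomb (c + d) Z 0 Z"
      unfolding 1 2 by (simp add: lcomb_def algebra_simps)
  qed
next
  case (scale c x)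
  then obtain d where
    "\<forall>Z\<in>Mat n n. (\<forall>i. 1 \<le> i \<and> i < n \<longrightarrow> mmul n (u_mat n i) Z = zero_mat) \<longrightarrow> mmul n (mat_of n n x) Z = lcomb d Z 0 Z"
    by blast
  note d = this
  have eq: "mat_of n n (comb_scale c x) = lcomb c (mat_of n n x) 0 (mat_of n n x)"
    by (simp add: lcomb_def fun_eq_iff mat_of_scale)
  show ?case
    unfolding eq mmul_lcomb_left
  proof (intro exI[of _ "c * d"] ballI impI)
    fix Z assume "Z \<in> Mat n n" "\<forall>i. 1 \<le> i \<and> i < n \<longrightarrow> mmul n (u_mat n i) Z = zero_mat"
    then have 1: "mmul n (mat_of n n x) Z = lcomb d Z 0 Z"
      using d by blast
    show "lcomb c (mmul n (mat_of n n x) Z) 0 (mmul n (mat_of n n x) Z) = lcomb (c * d) Z 0 Z"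
      unfolding 1 by (simp add: lcomb_def algebra_simps)
  qed
qed

text \<open>The mirror image of \<open>Hom_killed_right\<close>, with a cap of the diagram in place
  of a cup.\<close>

lemma Hom_killed_left:
  assumes "x \<in> Hom n n"
  shows "\<exists>c. \<forall>Z\<in>Mat n n. (\<forall>i. 1 \<le> i \<and> i < n \<longrightarrow> mmul n Z (u_mat n i) = zero_mat) \<longrightarrow>
     mmul n Z (mat_of n n x) = lcomb c Z 0 Z"
  using assms
proof (induction rule: Hom_induct)
  case zero
  show ?case by (intro exI[of _ 0]) (simp add: lcomb_def)
next
  case (of_diagram D)
  show ?case
  proof (cases "D = id_diagram n")
    case True
    then show ?thesis by (intro exI[of _ 1]) (simp add: mat_of_id mmul_id_mat_right lcomb_def)
  next
    case False
    obtain i where i: "1 \<le> i" "i < n" "{Top i, Top (i + 1)} \<in> D"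
      using cap_exists[OF of_diagram False] .
    let ?R = "mat_of n n (of_diagram D)"
    obtain D' k where "\<And>s t. length s = n \<Longrightarrow> length t = n \<Longrightarrow> mmul n (u_mat n i) (dmat D) s t = k * dmat D' s t"
      "D' = D \<and> k = 2"
      using u_mat_diagram[OF of_diagram i(1,2)] i(3) by metis
    then have u_mat: "mmul n (u_mat n i) (dmat D) s t = 2 * dmat D s t" if "length s = n" "length t = n" for s t
      using that by blast
    have *: "mmul n (u_mat n i) ?R = lcomb 2 ?R 0 ?R"
    proof (rule mat_eqI[OF mmul_Mat[OF u_mat_Mat mat_of_Mat] lcomb_Mat[OF mat_of_Mat mat_of_Mat]])
      fix s t :: "bool list" assume st: "length s = n" "length t = n"
      have "mmul n (u_mat n i) ?R s t = mmul n (u_mat n i) (dmat D) s t"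
        by (rule mmul_cong) (use st in \<open>simp_all add: mat_of_of_diagram\<close>)
      then show "mmul n (u_mat n i) ?R s t = lcomb 2 ?R 0 ?R s t"
        using st by (simp add: lcomb_def mat_of_of_diagram u_mat)
    qed
    have "mmul n Z ?R = zero_mat" if "\<forall>i. 1 \<le> i \<and> i < n \<longrightarrow> mmul n Z (u_mat n i) = zero_mat" for Z
    proof -
      have "lcomb 2 (mmul n Z ?R) 0 (mmul n Z ?R) = mmul n (mmul n Z (u_mat n i)) ?R" unfolding mmul_assoc * by simp
      also have "\<dots> = zero_mat" using that i by simp
      finally show ?thesis by (simp add: lcomb_def fun_eq_iff)
    qed
    then show ?thesis by (intro exI[of _ 0]) (simp add: lcomb_def)
  qed
next
  case (add x y)
  then obtain c d where
    "\<forall>Z\<in>Mat n n. (\<forall>i. 1 \<le> i \<and> i < n \<longrightarrow> mmul n Z (u_mat n i) = zero_mat) \<longrightarrow> mmul n Z (mat_of n n x) = lcomb c Z 0 Z"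
    "\<forall>Z\<in>Mat n n. (\<forall>i. 1 \<le> i \<and> i < n \<longrightarrow> mmul n Z (u_mat n i) = zero_mat) \<longrightarrow> mmul n Z (mat_of n n y) = lcomb d Z 0 Z"
    by blast
  note cd = this
  have eq: "mat_of n n (x + y) = lcomb 1 (mat_of n n x) 1 (mat_of n n y)"
    by (simp add: lcomb_def fun_eq_iff mat_of_add)
  show ?case
    unfolding eq mmul_lcomb_right
  proof (intro exI[of _ "c + d"] ballI impI)
    fix Z assume "Z \<in> Mat n n" "\<forall>i. 1 \<le> i \<and> i < n \<longrightarrow> mmul n Z (u_mat n i) = zero_mat"
    then have 1: "mmul n Z (mat_of n n x) = lcomb c Z 0 Z" and 2: "mmul n Z (mat_of n n y) = lcomb d Z 0 Z"
      using cd by blast+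
    show "lcomb 1 (mmul n Z (mat_of n n x)) 1 (mmul n Z (mat_of n n y)) = lcomb (c + d) Z 0 Z"
      unfolding 1 2 by (simp add: lcomb_def algebra_simps)
  qed
next
  case (scale c x)
  then obtain d where
    "\<forall>Z\<in>Mat n n. (\<forall>i. 1 \<le> i \<and> i < n \<longrightarrow> mmul n Z (u_mat n i) = zero_mat) \<longrightarrow> mmul n Z (mat_of n n x) = lcomb d Z 0 Z"
    by blast
  note d = this
  have eq: "mat_of n n (comb_scale c x) = lcomb c (mat_of n n x) 0 (mat_of n n x)"
    by (simp add: lcomb_def fun_eq_iff mat_of_scale)
  show ?case
    unfolding eq mmul_lcomb_right
  proof (intro exI[of _ "c * d"] ballI impI)
    fix Z assume "Z \<in> Mat n n" "\<forall>i. 1 \<le> i \<and> i < n \<longrightarrow> mmul n Z (u_mat n i) = zero_mat"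
    then have 1: "mmul n Z (mat_of n n x) = lcomb d Z 0 Z"
      using d by blast
    show "lcomb c (mmul n Z (mat_of n n x)) 0 (mmul n Z (mat_of n n x)) = lcomb (c * d) Z 0 Z"
      unfolding 1 by (simp add: lcomb_def algebra_simps)
  qed
qed

text \<open>Left multiplication by x is one and the same scalar on x and on y, and it is 1 because x
  is a nonzero idempotent, so x y = y. Right multiplication by y gives x y = x in the same
  way.\<close>

lemma killed_idempotent_unique:
  assumes x: "x \<in> Hom n n" "x \<noteq> 0" and y: "y \<in> Hom n n" "y \<noteq> 0"
    and X: "mmul n (mat_of n n x) (mat_of n n x) = mat_of n n x"
      "\<And>i. 1 \<le> i \<Longrightarrow> i < n \<Longrightarrow> mmul n (u_mat n i) (mat_of n n x) = zero_mat \<and> mmul n (mat_of n n x) (u_mat n i) = zero_mat"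
    and Y: "mmul n (mat_of n n y) (mat_of n n y) = mat_of n n y"
      "\<And>i. 1 \<le> i \<Longrightarrow> i < n \<Longrightarrow> mmul n (u_mat n i) (mat_of n n y) = zero_mat \<and> mmul n (mat_of n n y) (u_mat n i) = zero_mat"
  shows "x = y"
proof -
  let ?X = "mat_of n n x" and ?Y = "mat_of n n y"
  have one: "c = 1" if "A = lcomb c A 0 A" "A \<noteq> zero_mat" for c A
  proof -
    from \<open>A \<noteq> zero_mat\<close> obtain s t where "A s t \<noteq> 0" by (auto simp: fun_eq_iff)
    moreover have "A s t = c * A s t" using fun_cong[OF fun_cong[OF \<open>A = lcomb c A 0 A\<close>], of s t] by (simp add: lcomb_def)
    ultimately show ?thesis by simp
  qed
  have nz: "?X \<noteq> zero_mat" "?Y \<noteq> zero_mat" using mat_of_faithful x y by auto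
  obtain c where c: "\<forall>Z\<in>Mat n n. (\<forall>i. 1 \<le> i \<and> i < n \<longrightarrow> mmul n (u_mat n i) Z = zero_mat) \<longrightarrow> mmul n ?X Z = lcomb c Z 0 Z"
    using Hom_killed_right[OF x(1)] by blast
  obtain d where d: "\<forall>Z\<in>Mat n n. (\<forall>i. 1 \<le> i \<and> i < n \<longrightarrow> mmul n Z (u_mat n i) = zero_mat) \<longrightarrow> mmul n Z ?Y = lcomb d Z 0 Z"
    using Hom_killed_left[OF y(1)] by blast
  have "?X = lcomb c ?X 0 ?X" using bspec[OF c mat_of_Mat[of n n x]] X by simp
  then have "c = 1" using one nz by blast
  moreover have "?Y = lcomb d ?Y 0 ?Y" using bspec[OF d mat_of_Mat[of n n y]] Y by simp
  then have "d = 1" using one nz by blast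
  moreover have "mmul n ?X ?Y = lcomb c ?Y 0 ?Y" using bspec[OF c mat_of_Mat[of n n y]] Y by simp
  moreover have "mmul n ?X ?Y = lcomb d ?X 0 ?X" using bspec[OF d mat_of_Mat[of n n x]] X by simp
  ultimately have "?X = ?Y" by (simp add: lcomb_def)
  then show ?thesis by (rule mat_of_inj[OF x(1) y(1)])
qed

text \<open>The lift z of \<open>jw_mat m\<close> satisfies the description of \<open>JW m\<close>.
  Each of its equations is verified on matrices and carried back by faithfulness.\<close>

lemma JW_properties:
  shows JW_Hom: "JW m \<in> Hom m m" and mat_of_JW: "mat_of m m (JW m) = jw_mat m"
    and JW_comp: "y \<in> Hom m b \<Longrightarrow> JW m \<odot> y \<in> Hom m b"
proof -
  obtain z where z: "z \<in> Hom m m" "mat_of m m z = jw_mat m" "\<And>b y. y \<in> Hom m b \<Longrightarrow> z \<odot> y \<in> Hom m b"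
    using u_span_lift[OF jw_mat_u_span] by metis
  have nz: "z \<noteq> 0" using z(2) jw_mat_nonzero[of m] by auto
  have "z \<odot> z = z"
    by (rule mat_of_inj[OF z(3)[OF z(1)] z(1)]) (simp add: mat_of_hom_comp[OF z(1) z(1)] z(2))
  moreover have "u_elem m i \<odot> z = 0" "z \<odot> u_elem m i = 0" if i: "1 \<le> i" "i < m" for i
  proof -
    show "u_elem m i \<odot> z = 0"
      by (rule mat_of_faithful[OF u_elem_Hom[OF z(1) i]])
        (simp add: mat_of_hom_comp[OF u_elem_in[OF i] z(1)] z(2) mat_of_u[OF i] u_mat_jw_mat[OF i])
    show "z \<odot> u_elem m i = 0"
      by (rule mat_of_faithful[OF Hom_u_elem[OF z(1) i]])
        (simp add: mat_of_hom_comp[OF z(1) u_elem_in[OF i]] z(2) mat_of_u[OF i] jw_mat_u_mat[OF i])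
  qed
  ultimately have "JW m = z"
    unfolding JW_def
  proof (intro the_equality)
    fix x assume x: "x \<in> Hom m m \<and> x \<noteq> 0 \<and> x \<odot> x = x \<and>
      (\<forall>i. 1 \<le> i \<and> i < m \<longrightarrow> u_elem m i \<odot> x = 0 \<and> x \<odot> u_elem m i = 0)"
    have u: "mmul m (u_mat m i) (mat_of m m x) = zero_mat \<and> mmul m (mat_of m m x) (u_mat m i) = zero_mat" if i: "1 \<le> i" "i < m" for i
      using x i mat_of_hom_comp[OF u_elem_in[OF i], of x m] mat_of_hom_comp[OF _ u_elem_in[OF i], of x m]
      by (simp add: mat_of_u[OF i])
    have "mat_of m m (x \<odot> x) = mmul m (mat_of m m x) (mat_of m m x)"
      by (rule mat_of_hom_comp) (use x in simp_all)
    then have xx: "mmul m (mat_of m m x) (mat_of m m x) = mat_of m m x" using x by simp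
    have zz: "mmul m (mat_of m m z) (mat_of m m z) = mat_of m m z" unfolding z(2) by simp
    have zu: "mmul m (u_mat m i) (mat_of m m z) = zero_mat \<and> mmul m (mat_of m m z) (u_mat m i) = zero_mat" if i: "1 \<le> i" "i < m" for i
      unfolding z(2) using u_mat_jw_mat[OF i] jw_mat_u_mat[OF i] by simp
    show "x = z"
      by (rule killed_idempotent_unique[OF _ _ z(1) nz xx u zz zu]) (use x in simp_all)
  qed (use z nz in auto)
  then show "JW m \<in> Hom m m" "mat_of m m (JW m) = jw_mat m" "y \<in> Hom m b \<Longrightarrow> JW m \<odot> y \<in> Hom m b"
    using z by auto
qed

section \<open>Juxtaposition and bending\<close>

definition juxt :: "nat \<Rightarrow> nat \<Rightarrow> nat \<Rightarrow> diagram \<Rightarrow> diagram" where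
  "juxt a b d D = D \<union> {{Top (a + j), Bot (b + j)} | j. j \<in> {1..d}}"

lemma points_bounds: "p \<in> points a b \<Longrightarrow> - int a \<le> bpos p \<and> bpos p \<le> int b"
  by (cases p) (auto simp: points_def image_iff)

text \<open>In boundary order the new lines start before all old points, end after them and are
  nested in one another, so nothing can cross them.\<close>

lemma juxt_diagrams:
  assumes D: "D \<in> diagrams a b" shows "juxt a b d D \<in> diagrams (a + d) (b + d)"
proof -
  have m: "matching a b D" and nc: "noncrossing D" using D diagrams_matching by (auto simp: diagrams_def)
  define N where "N = (\<lambda>j. {Top (a + j), Bot (b + j)}) ` {1..d}"
  have J: "juxt a b d D = D \<union> N" unfolding juxt_def N_def Setcompr_eq_image ..
  have NU: "\<Union>N = (\<lambda>j. Top (a + j)) ` {1..d} \<union> (\<lambda>j. Bot (b + j)) ` {1..d}" by (auto simp: N_def)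
  have DU: "\<Union>D = points a b" using m partition_onD1 by (auto simp: matching_def)
  have shift: "(\<lambda>j. f (c + j)) ` {1..d} = f ` {c + 1..c + d}" for f :: "nat \<Rightarrow> point" and c
  proof -
    have "{c + 1..c + d} = (\<lambda>j. c + j) ` {1..d}"
      using image_add_atLeastAtMost[of c 1 d] by simp
    then show ?thesis by (simp only: image_image)
  qed
  have split: "{1..c + d} = {1..c} \<union> {c + 1..c + d}" for c :: nat by auto
  have "points a b \<union> \<Union>N = points (a + d) (b + d)"
    unfolding NU shift points_def split image_Un by blast
  have disj: "points a b \<inter> \<Union>N = {}"
    unfolding NU points_def by auto
  have "partition_on (points (a + d) (b + d)) (juxt a b d D)"
  proof (rule partition_onI)
    show "\<Union>(juxt a b d D) = points (a + d) (b + d)"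
      using \<open>points a b \<union> \<Union>N = points (a + d) (b + d)\<close> DU by (simp add: J)
    show "{} \<notin> juxt a b d D"
      using m by (auto simp: J N_def matching_def partition_on_def)
    fix e e' assume e: "e \<in> juxt a b d D" "e' \<in> juxt a b d D" "e \<noteq> e'"
    have NN: "e \<inter> e' = {}" if "e \<in> N" "e' \<in> N" "e \<noteq> e'" for e e'
      using that by (auto simp: N_def)
    have DN: "e \<inter> e' = {}" if "e \<in> D" "e' \<in> N" for e e'
      using that disj DU by blast
    show "disjnt e e'"
      using e NN[of e e'] DN[of e e'] DN[of e' e] matching_disjoint[OF m, of e e']
      unfolding J disjnt_def by (auto simp: Int_commute)
  qed
  moreover have "card e = 2" if "e \<in> juxt a b d D" for e
    using that m by (auto simp: J N_def matching_def)
  moreover have "noncrossing (juxt a b d D)"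
    unfolding noncrossing_def
  proof (rule notI, elim exE conjE)
    fix p q r s
    assume e: "{p, q} \<in> juxt a b d D" "{r, s} \<in> juxt a b d D"
      and lt: "bpos p < bpos r" "bpos r < bpos q" "bpos q < bpos s"
    have old: "- int a \<le> bpos x \<and> bpos x \<le> int b \<and> - int a \<le> bpos y \<and> bpos y \<le> int b"
      if "{x, y} \<in> D" for x y
      using matching_edge_points[OF m that] points_bounds by blast
    have new: "\<exists>j\<ge>1. bpos x = - int (a + j) \<and> bpos y = int (b + j)" if "{x, y} \<in> N" "bpos x < bpos y" for x y
      using that by (auto simp: N_def doubleton_eq_iff)
    from e consider "{p, q} \<in> D" "{r, s} \<in> D" | "{p, q} \<in> N" "{r, s} \<in> D"
      | "{p, q} \<in> D" "{r, s} \<in> N" | "{p, q} \<in> N" "{r, s} \<in> N"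
      unfolding J by blast
    then show False
    proof cases
      case 1 show ?thesis by (rule noncrossingD[OF nc 1 lt])
    next
      case 2
      then show ?thesis using new[of p q] old[of r s] lt by force
    next
      case 3
      then show ?thesis using new[of r s] old[of p q] lt by force
    next
      case 4
      then show ?thesis using new[of r s] new[of p q] lt by force
    qed
  qed
  ultimately show ?thesis by (simp add: diagrams_def)
qed

lemma lin_ext_Hom:
  assumes "x \<in> Hom a b" "\<And>D. D \<in> diagrams a b \<Longrightarrow> \<phi> D \<in> diagrams a' b'"
  shows "lin_ext \<phi> x \<in> Hom a' b'"
proof -
  have "Poly_Mapping.single (\<phi> D) (Poly_Mapping.lookup x D) \<in> Hom a' b'" if "D \<in> Poly_Mapping.keys x" for D
    using assms that by (intro single_in_Hom) (auto simp: Hom_iff)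
  then show ?thesis
    unfolding lin_ext_def Hom_def by (intro comb.span_sum)
qed

lemma mat_of_lin_ext:
  "length s = a \<Longrightarrow> length t = b \<Longrightarrow>
    mat_of a b (lin_ext \<phi> x) s t = (\<Sum>D\<in>Poly_Mapping.keys x. Poly_Mapping.lookup x D * dmat (\<phi> D) s t)"
  unfolding lin_ext_def mat_of_sum by (simp add: mat_of_single)

lemma juxtapose_eq: "juxtapose a b d = lin_ext (juxt a b d)"
  unfolding juxtapose_def juxt_def ..

lemma strand_pow_Mat: "A \<in> Mat a b \<Longrightarrow> (strand ^^ d) A \<in> Mat (a + d) (b + d)"
  by (induction d) auto

lemma strand_pow: "length u = d \<Longrightarrow> length w = d \<Longrightarrow>
    (strand ^^ d) A (s @ u) (t @ w) = (if u = w then A s t else 0)"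
proof (induction d arbitrary: u w)
  case (Suc d)
  from Suc.prems obtain u' x w' y where "u = u' @ [x]" "w = w' @ [y]" "length u' = d" "length w' = d"
    by (metis length_Suc_conv_rev)
  then show ?case
    using Suc.IH[of u' w'] strand_snoc[of "(strand ^^ d) A" "s @ u'" x "t @ w'" y]
    by (cases "u' = w'") auto
qed simp

lemma split_length:
  assumes "length s = a + d" obtains s' u where "s = s' @ u" "length s' = a" "length u = d"
  using that[of "take a s" "drop a s"] assms by simp

lemma dmat_juxt:
  assumes D: "D \<in> diagrams a b" and st: "length s = a" "length t = b" "length u = d" "length w = d"
  shows "dmat (juxt a b d D) (s @ u) (t @ w) = (if u = w then dmat D s t else 0)"
proof -
  have "consistent D (lab (s @ u) (t @ w)) = consistent D (lab s t)"
  proof (rule consistent_cong)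
    fix e p assume "e \<in> D" "p \<in> e"
    then have "p \<in> points a b" using matching_sub[OF diagrams_matching[OF D]] by blast
    then show "lab (s @ u) (t @ w) p = lab s t p"
      using st by (cases p) (auto simp: points_def nth_append)
  qed
  moreover have "consistent ((\<lambda>j. {Top (a + j), Bot (b + j)}) ` {1..d}) (lab (s @ u) (t @ w)) \<longleftrightarrow> u = w"
  proof -
    have "lab (s @ u) (t @ w) (Top (a + j)) = u ! (j - 1)" "lab (s @ u) (t @ w) (Bot (b + j)) = w ! (j - 1)"
      if "j \<in> {1..d}" for j
      using that st by (auto simp: nth_append)
    then have "consistent ((\<lambda>j. {Top (a + j), Bot (b + j)}) ` {1..d}) (lab (s @ u) (t @ w)) \<longleftrightarrow>
        (\<forall>j\<in>{1..d}. u ! (j - 1) = w ! (j - 1))"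
      unfolding consistent_image by simp
    also have "\<dots> \<longleftrightarrow> (\<forall>j<d. u ! j = w ! j)"
    proof
      assume *: "\<forall>j\<in>{1..d}. u ! (j - 1) = w ! (j - 1)"
      show "\<forall>j<d. u ! j = w ! j"
      proof (intro allI impI)
        fix j assume "j < d" then show "u ! j = w ! j" using *[rule_format, of "Suc j"] by simp
      qed
    qed auto
    also have "\<dots> \<longleftrightarrow> u = w" using st by (simp add: list_eq_iff_nth_eq)
    finally show ?thesis .
  qed
  ultimately show ?thesis
    unfolding dmat_def juxt_def Setcompr_eq_image consistent_Un by simp
qed

lemma juxtapose_Hom: "x \<in> Hom a b \<Longrightarrow> juxtapose a b d x \<in> Hom (a + d) (b + d)"
  unfolding juxtapose_eq by (rule lin_ext_Hom[OF _ juxt_diagrams])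

lemma mat_of_juxtapose:
  assumes x: "x \<in> Hom a b"
  shows "mat_of (a + d) (b + d) (juxtapose a b d x) = (strand ^^ d) (mat_of a b x)"
proof (rule mat_eqI[OF mat_of_Mat strand_pow_Mat[OF mat_of_Mat]])
  fix s t :: "bool list" assume "length s = a + d" "length t = b + d"
  then obtain s' u t' w where st: "s = s' @ u" "t = t' @ w" "length s' = a" "length u = d" "length t' = b" "length w = d"
    by (metis split_length)
  have "mat_of (a + d) (b + d) (juxtapose a b d x) s t =
      (\<Sum>D\<in>Poly_Mapping.keys x. Poly_Mapping.lookup x D * dmat (juxt a b d D) (s' @ u) (t' @ w))"
    unfolding juxtapose_eq st(1,2) by (rule mat_of_lin_ext) (simp_all add: st)
  also have "\<dots> = (\<Sum>D\<in>Poly_Mapping.keys x. Poly_Mapping.lookup x D * (if u = w then dmat D s' t' else 0))"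
    using x by (intro sum.cong refl) (auto simp: Hom_iff dmat_juxt st)
  also have "\<dots> = (if u = w then mat_of a b x s' t' else 0)"
    by (simp add: mat_of_def st)
  also have "\<dots> = (strand ^^ d) (mat_of a b x) s t"
    unfolding st(1,2) strand_pow[OF st(4,6)] ..
  finally show "mat_of (a + d) (b + d) (juxtapose a b d x) s t = (strand ^^ d) (mat_of a b x) s t" .
qed

definition bend_diagram :: "nat \<Rightarrow> nat \<Rightarrow> nat \<Rightarrow> diagram \<Rightarrow> diagram" where
  "bend_diagram a b m D = (\<lambda>e. bend_point a b m ` e) ` D"

lemma bend_eq: "bend a b m = lin_ext (bend_diagram a b m)"
  unfolding bend_def bend_diagram_def ..

text \<open>Along the boundary, bending rotates the first m points to the end. The shift is a + b +
  1 since \<open>bpos\<close> skips 0.\<close>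

lemma bpos_bend:
  "p \<in> points a b \<Longrightarrow> m \<le> a \<Longrightarrow> bpos (bend_point a b m p) =
     (if bpos p < int m - int a then int a + int b + 1 + bpos p else bpos p)"
  by (cases p) (auto simp: points_def)

lemma bend_diagrams:
  assumes D: "D \<in> diagrams a b" and ma: "m \<le> a"
  shows "bend_diagram a b m D \<in> diagrams (a - m) (b + m)"
proof -
  let ?f = "bend_point a b m"
  have mt: "matching a b D" and nc: "noncrossing D" using D diagrams_matching by (auto simp: diagrams_def)
  have "bij_betw ?f (points a b) (points (a - m) (b + m))"
  proof (rule bij_betwI')
    fix p q assume pq: "p \<in> points a b" "q \<in> points a b"
    show "(?f p = ?f q) = (p = q)"
    proof
      assume "?f p = ?f q"
      then have "bpos (?f p) = bpos (?f q)" by simp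
      then have "bpos p = bpos q"
        using points_bounds[OF pq(1)] points_bounds[OF pq(2)]
        unfolding bpos_bend[OF pq(1) ma] bpos_bend[OF pq(2) ma] by (auto split: if_splits)
      then show "p = q" using bpos_inj[OF pq] by simp
    qed simp
  next
    fix p assume "p \<in> points a b"
    then show "?f p \<in> points (a - m) (b + m)"
      by (cases p) (auto simp: points_def image_iff)
  next
    fix q assume q: "q \<in> points (a - m) (b + m)"
    show "\<exists>p\<in>points a b. q = ?f p"
    proof (cases q)
      case (Top j)
      then show ?thesis using q by (intro bexI[of _ "Top j"]) (auto simp: points_def)
    next
      case (Bot j)
      show ?thesis
      proof (cases "j \<le> b")
        case True
        then show ?thesis using q Bot by (intro bexI[of _ "Bot j"]) (auto simp: points_def)
      next
        case False
        then have j: "b + 1 \<le> j" "j \<le> b + m" using q Bot by (auto simp: points_def)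
        then have "Top (a + b + 1 - j) \<in> points a b" using ma by (auto simp: points_def image_iff)
        then show ?thesis using q Bot j ma by (intro bexI[of _ "Top (a + b + 1 - j)"]) auto
      qed
    qed
  qed
  then have mt': "matching (a - m) (b + m) (bend_diagram a b m D)"
    unfolding bend_diagram_def by (rule bij_diagram_image[OF mt])
  have edge: "\<exists>u v. {u, v} \<in> D \<and> p = ?f u \<and> q = ?f v" if "{p, q} \<in> bend_diagram a b m D" for p q
  proof -
    from that obtain e where e: "e \<in> D" "{p, q} = ?f ` e" unfolding bend_diagram_def by blast
    obtain u v where uv: "e = {u, v}" using matching_edgeE[OF mt e(1)] by metis
    then have "{v, u} \<in> D" "{u, v} \<in> D" using e by (simp_all add: insert_commute)
    moreover have "p = ?f u \<and> q = ?f v \<or> p = ?f v \<and> q = ?f u" using e uv by (auto simp: doubleton_eq_iff)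
    ultimately show ?thesis by blast
  qed
  have "noncrossing (bend_diagram a b m D)"
    unfolding noncrossing_def
  proof (rule notI, elim exE conjE)
    fix p' q' r' s'
    assume e: "{p', q'} \<in> bend_diagram a b m D" "{r', s'} \<in> bend_diagram a b m D"
      and lt': "bpos p' < bpos r'" "bpos r' < bpos q'" "bpos q' < bpos s'"
    obtain p q where pq: "{p, q} \<in> D" "p' = ?f p" "q' = ?f q" using edge[OF e(1)] by blast
    obtain r s where rs: "{r, s} \<in> D" "r' = ?f r" "s' = ?f s" using edge[OF e(2)] by blast
    have qp: "{q, p} \<in> D" and sr: "{s, r} \<in> D" using pq rs by (simp_all add: insert_commute)
    note pts = matching_edge_points[OF mt pq(1), THEN conjunct1] matching_edge_points[OF mt pq(1), THEN conjunct2]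
      matching_edge_points[OF mt rs(1), THEN conjunct1] matching_edge_points[OF mt rs(1), THEN conjunct2]
    have mv: "bpos (?f x) = int a + int b + 1 + bpos x" "int b < bpos (?f x)" if "x \<in> points a b" "bpos x < int m - int a" for x
      using bpos_bend[OF that(1) ma] points_bounds[OF that(1)] that by auto
    have st: "bpos (?f x) = bpos x" "bpos (?f x) \<le> int b" if "x \<in> points a b" "\<not> bpos x < int m - int a" for x
      using bpos_bend[OF that(1) ma] points_bounds[OF that(1)] that by auto
    have lt: "bpos (?f p) < bpos (?f r)" "bpos (?f r) < bpos (?f q)" "bpos (?f q) < bpos (?f s)"
      using lt' pq rs by simp_all
    let ?M = "\<lambda>x. bpos x < int m - int a"
    \<comment> \<open>Moved points come last after bending. In a crossing listed in increasing order
      they are therefore a final segment, and rotating them back to the front gives a crossing in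
      D.\<close>
    have mono: "?M x \<Longrightarrow> ?M y" if "bpos (?f x) < bpos (?f y)" "x \<in> points a b" "y \<in> points a b" for x y
      using mv[of x] st[of y] that by linarith
    show False
    proof (cases "?M p")
      case True
      then have "?M r" "?M q" "?M s" using mono lt pts by blast+
      then have "bpos p < bpos r" "bpos r < bpos q" "bpos q < bpos s"
        using lt True mv(1) pts by simp_all
      then show ?thesis by (rule noncrossingD[OF nc pq(1) rs(1)])
    next
      case p: False
      show ?thesis
      proof (cases "?M r")
        case True
        then have "?M q" "?M s" using mono lt pts by blast+
        then have "bpos r < bpos q" "bpos q < bpos s" "bpos s < bpos p"
          using lt True p mv(1) pts by auto
        then show ?thesis by (rule noncrossingD[OF nc rs(1) qp])
      next
        case r: False
        show ?thesis
        proof (cases "?M q")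
          case True
          then have "?M s" using mono lt pts by blast
          then have "bpos q < bpos s" "bpos s < bpos p" "bpos p < bpos r"
            using lt True p r mv(1) st(1) pts by auto
          then show ?thesis by (rule noncrossingD[OF nc qp sr])
        next
          case q: False
          show ?thesis
          proof (cases "?M s")
            case True
            then have "bpos s < bpos p" "bpos p < bpos r" "bpos r < bpos q"
              using lt p q r mv(1) st(1) pts by auto
            then show ?thesis by (rule noncrossingD[OF nc sr pq(1)])
          next
            case False
            then have "bpos p < bpos r" "bpos r < bpos q" "bpos q < bpos s"
              using lt p q r st(1) pts by simp_all
            then show ?thesis by (rule noncrossingD[OF nc pq(1) rs(1)])
          qed
        qed
      qed
    qed
  qed
  then show ?thesis using mt' by (simp add: diagrams_def matching_def)
qed

lemma bend_mat_pow_Mat: "A \<in> Mat (a + m) b \<Longrightarrow> (bend_mat ^^ m) A \<in> Mat a (b + m)"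
proof (induction m arbitrary: a)
  case (Suc m)
  then have "(bend_mat ^^ m) A \<in> Mat (Suc a) (b + m)" by simp
  then show ?case by auto
qed simp

text \<open>The strand bent first, the rightmost one, ends leftmost among the new bottom points;
  hence the reversal.\<close>

lemma bend_mat_pow: "length w = m \<Longrightarrow> (bend_mat ^^ m) A s (t @ w) = A (s @ rev w) t"
proof (induction m arbitrary: s w)
  case (Suc m)
  from Suc.prems obtain w' y where w: "w = w' @ [y]" "length w' = m"
    by (metis length_Suc_conv_rev)
  then show ?case using Suc.IH[OF w(2), of "s @ [y]"] bend_mat_snoc(1)[of "(bend_mat ^^ m) A" s "t @ w'" y] by simp
qed simp

lemma dmat_bend:
  assumes D: "D \<in> diagrams a b" and st: "length s = a - m" "length t = b" "length w = m" and ma: "m \<le> a"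
  shows "dmat (bend_diagram a b m D) s (t @ w) = dmat D (s @ rev w) t"
proof -
  have "consistent (bend_diagram a b m D) (lab s (t @ w)) =
      consistent D (\<lambda>p. lab s (t @ w) (bend_point a b m p))"
    by (simp add: consistent_def bend_diagram_def)
  also have "\<dots> = consistent D (lab (s @ rev w) t)"
  proof (rule consistent_cong)
    fix e p assume "e \<in> D" "p \<in> e"
    then have p: "p \<in> points a b" using matching_sub[OF diagrams_matching[OF D]] by blast
    show "lab s (t @ w) (bend_point a b m p) = lab (s @ rev w) t p"
    proof (cases p)
      case (Top j)
      then have j: "1 \<le> j" "j \<le> a" using p by (auto simp: points_def)
      show ?thesis
      proof (cases "a < j + m")
        case True
        have "b + (a + 1 - j) - 1 = b + (a - j)" using j by simp
        then have "lab s (t @ w) (bend_point a b m p) = (t @ w) ! (b + (a - j))"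
          using Top True by (simp only: bend_point.simps if_True lab.simps)
        moreover have "(t @ w) ! (b + (a - j)) = w ! (a - j)"
          unfolding st(2)[symmetric] by (rule nth_append_length_plus)
        moreover have "\<not> j - 1 < length s" "m - Suc (j - 1 - length s) = a - j" "j - 1 - length s < length w"
          using True j ma st by auto
        then have "(s @ rev w) ! (j - 1) = w ! (a - j)"
          using st(3) by (simp only: nth_append if_False rev_nth)
        ultimately show ?thesis using Top by (simp only: lab.simps)
      next
        case False
        then have "j - 1 < length s" using j st by arith
        then show ?thesis using Top False by (simp add: nth_append)
      qed
    next
      case (Bot j)
      then show ?thesis using p st by (auto simp: points_def nth_append)
    qed
  qed
  finally show ?thesis by (simp add: dmat_def)
qed

lemma bend_Hom: "x \<in> Hom a b \<Longrightarrow> m \<le> a \<Longrightarrow> bend a b m x \<in> Hom (a - m) (b + m)"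
  unfolding bend_eq by (rule lin_ext_Hom[OF _ bend_diagrams])

lemma mat_of_bend:
  assumes x: "x \<in> Hom a b" and m: "m \<le> a"
  shows "mat_of (a - m) (b + m) (bend a b m x) = (bend_mat ^^ m) (mat_of a b x)"
proof (rule mat_eqI[OF mat_of_Mat bend_mat_pow_Mat])
  show "mat_of a b x \<in> Mat (a - m + m) b" using m by simp
  fix s t :: "bool list" assume s: "length s = a - m" and "length t = b + m"
  then obtain t' w where st: "t = t' @ w" "length t' = b" "length w = m"
    by (metis split_length)
  have "mat_of (a - m) (b + m) (bend a b m x) s t =
      (\<Sum>D\<in>Poly_Mapping.keys x. Poly_Mapping.lookup x D * dmat (bend_diagram a b m D) s (t' @ w))"
    unfolding bend_eq st(1) by (rule mat_of_lin_ext) (simp_all add: st s)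
  also have "\<dots> = (\<Sum>D\<in>Poly_Mapping.keys x. Poly_Mapping.lookup x D * dmat D (s @ rev w) t')"
    using x by (intro sum.cong refl) (auto simp: Hom_iff dmat_bend st s m)
  also have "\<dots> = mat_of a b x (s @ rev w) t'"
    using m by (simp add: mat_of_def st s)
  also have "\<dots> = (bend_mat ^^ m) (mat_of a b x) s t"
    unfolding st(1) bend_mat_pow[OF st(3)] ..
  finally show "mat_of (a - m) (b + m) (bend a b m x) s t = (bend_mat ^^ m) (mat_of a b x) s t" .
qed

section \<open>Block sequences and the cell module\<close>

definition word :: "(nat \<times> nat) list \<Rightarrow> nat list" where
  "word bs = concat (map (\<lambda>(d, m). replicate d 0 @ replicate m 1) bs)"

lemma word_simps [simp]: "word [] = []"
  "word ((d, m) # bs) = replicate d 0 @ replicate m 1 @ word bs"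
  "word (bs @ cs) = word bs @ word cs"
  by (simp_all add: word_def)

lemma count_replicate: "count_list (replicate n x) y = (if x = y then n else 0)"
  by (induction n) auto

lemma count_word: "count_list (word bs) 0 = (\<Sum>j<length bs. fst (bs ! j))"
  "count_list (word bs) 1 = (\<Sum>j<length bs. snd (bs ! j))"
  "length (word bs) = (\<Sum>j<length bs. fst (bs ! j) + snd (bs ! j))"
  by (induction bs rule: rev_induct; force simp: count_replicate nth_append split: prod.splits)+

text \<open>Within a run of zeros each projector is absorbed by the next, so that one per block
  remains, as in \<open>gdiag\<close>.\<close>

lemma word_mat_replicate_0:
  "ballot w \<Longrightarrow> word_mat (w @ replicate (Suc d) 0) =
    mmul (height w + Suc d) (jw_mat (height w + Suc d)) ((strand ^^ Suc d) (word_mat w))"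
proof (induction d)
  case 0
  then show ?case by (simp add: word_mat_snoc_0 height_snoc_0 del: jw_mat.simps(2))
next
  case (Suc d)
  let ?h = "height w + Suc d"
  have dmat: "w @ replicate (Suc (Suc d)) 0 = (w @ replicate (Suc d) 0) @ [0]"
    by (simp add: replicate_append_same)
  have h: "height ((w @ replicate (Suc d) 0) @ [0]) = Suc ?h"
    using ballot_count[OF Suc.prems] by (simp add: height_def count_replicate)
  have "word_mat (w @ replicate (Suc (Suc d)) 0) =
      mmul (Suc ?h) (jw_mat (Suc ?h)) (strand (mmul ?h (jw_mat ?h) ((strand ^^ Suc d) (word_mat w))))"
    unfolding dmat word_mat_snoc_0 h Suc.IH[OF Suc.prems] ..
  also have "\<dots> = mmul (Suc ?h) (mmul (Suc ?h) (jw_mat (Suc ?h)) (strand (jw_mat ?h))) (strand ((strand ^^ Suc d) (word_mat w)))"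
    unfolding strand_mmul mmul_assoc ..
  also have "\<dots> = mmul (Suc ?h) (jw_mat (Suc ?h)) ((strand ^^ Suc (Suc d)) (word_mat w))"
    unfolding jw_mat_strand_jw_mat by simp
  finally show ?case by simp
qed

lemma word_mat_replicate_1: "word_mat (w @ replicate m 1) = (bend_mat ^^ m) (word_mat w)"
proof (induction m)
  case (Suc m)
  have "w @ replicate (Suc m) 1 = (w @ replicate m 1) @ [1]"
    by (simp add: replicate_append_same)
  then have "word_mat (w @ replicate (Suc m) 1) = bend_mat (word_mat (w @ replicate m 1))"
    by (simp only: word_mat_snoc_1)
  then show ?case using Suc.IH by simp
qed simp

text \<open>Positive block sizes guarantee that each block inserts its projector; the ballot
  condition makes the truncated subtractions in \<open>through\<close>, \<open>height\<close> and
  \<open>bend\<close> exact.\<close>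

lemma gdiag_word_mat:
  assumes pos: "\<And>j. j < length bs \<Longrightarrow> fst (bs ! j) > 0" and bal: "ballot (word bs)"
  shows "i \<le> length bs \<Longrightarrow> gdiag bs i \<in> Hom (height (word (take i bs))) (length (word (take i bs))) \<and>
    mat_of (height (word (take i bs))) (length (word (take i bs))) (gdiag bs i) = word_mat (word (take i bs))"
proof (induction i)
  case 0
  have "{} \<in> diagrams 0 0"
    by (simp add: diagrams_def points_def partition_on_empty noncrossing_def)
  moreover have "mat_of 0 0 (of_diagram {}) = id_mat 0"
    by (rule mat_eqI[OF mat_of_Mat id_mat_Mat]) (simp add: mat_of_of_diagram dmat_def consistent_def id_mat_def)
  ultimately show ?case by (simp add: height_def of_diagram_in_Hom word_mat_Nil)
next
  case (Suc i)
  define w where "w = word (take i bs)"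
  define h b d m where "h = height w" and "b = length w" and "d = fst (bs ! i)" and "m = snd (bs ! i)"
  have i: "i < length bs" using Suc.prems by simp
  have "word [bs ! i] = replicate d 0 @ replicate m 1"
    unfolding d_def m_def by (cases "bs ! i") simp
  then have w': "word (take (Suc i) bs) = w @ replicate d 0 @ replicate m 1"
    using i by (simp add: take_Suc_conv_app_nth w_def)
  have bal': "ballot (w @ replicate d 0 @ replicate m 1)"
  proof (rule ballot_append)
    show "ballot ((w @ replicate d 0 @ replicate m 1) @ word (drop (Suc i) bs))"
      using bal unfolding w'[symmetric] word_simps(3)[symmetric] by simp
  qed
  then have bw: "ballot w" by (rule ballot_append)
  have sums: "count_list w 0 = (\<Sum>j<i. fst (bs ! j))" "count_list w 1 = (\<Sum>j<i. snd (bs ! j))"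
    "b = (\<Sum>j<i. fst (bs ! j) + snd (bs ! j))"
    using count_word[of "take i bs"] i by (simp_all add: w_def b_def)
  have cons: "consumed bs i = b" by (simp add: consumed_def sums)
  have "{..i} = insert i {..<i}" by auto
  then have thr: "through bs i = h + d"
    using sums ballot_count[OF bw] by (simp add: through_def h_def height_def d_def)
  have IH: "gdiag bs i \<in> Hom h b" "mat_of h b (gdiag bs i) = word_mat w"
    using Suc.IH i by (simp_all add: h_def b_def w_def)
  have m: "m \<le> h + d"
    using ballot_count[OF bal'] ballot_count[OF bw] by (simp add: count_replicate h_def height_def)
  have h': "height (w @ replicate d 0 @ replicate m 1) = h + d - m"
    using ballot_count[OF bw] by (simp add: count_replicate h_def height_def)
  obtain d' where d': "d = Suc d'" using pos[OF i] by (metis d_def gr0_implies_Suc)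
  have g: "gdiag bs (Suc i) = bend (h + d) (b + d) m (JW (h + d) \<odot> juxtapose h b d (gdiag bs i))"
    by (simp add: Let_def thr cons d_def[symmetric] m_def[symmetric])
  define y where "y = JW (h + d) \<odot> juxtapose h b d (gdiag bs i)"
  have J: "juxtapose h b d (gdiag bs i) \<in> Hom (h + d) (b + d)"
    by (rule juxtapose_Hom[OF IH(1)])
  have y: "y \<in> Hom (h + d) (b + d)"
    unfolding y_def by (rule JW_comp[OF J])
  have "mat_of (h + d) (b + d) y = mmul (h + d) (jw_mat (h + d)) ((strand ^^ d) (word_mat w))"
    unfolding y_def mat_of_hom_comp[OF JW_Hom J] mat_of_JW mat_of_juxtapose[OF IH(1)] IH(2) ..
  also have "\<dots> = word_mat (w @ replicate d 0)"
    unfolding d' h_def word_mat_replicate_0[OF bw] ..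
  finally have ty: "mat_of (h + d) (b + d) y = word_mat (w @ replicate d 0)" .
  have len: "length (w @ replicate d 0 @ replicate m 1) = b + d + m" by (simp add: b_def)
  show ?case
    unfolding w' h' len g y_def[symmetric]
    using bend_Hom[OF y m] mat_of_bend[OF y m] by (simp add: ty word_mat_replicate_1[of "w @ replicate d 0", simplified])
qed

text \<open>Positivity turns the blocks into the maximal runs of equal letters, and these can be
  read off from the word.\<close>

lemma is_block_seq_unique:
  assumes "word bs = word cs" "\<And>j. j < length bs \<Longrightarrow> fst (bs ! j) > 0" "\<And>j. j + 1 < length bs \<Longrightarrow> snd (bs ! j) > 0"
    "\<And>j. j < length cs \<Longrightarrow> fst (cs ! j) > 0" "\<And>j. j + 1 < length cs \<Longrightarrow> snd (cs ! j) > 0"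
  shows "bs = cs"
  using assms
proof (induction bs arbitrary: cs)
  case Nil
  then show ?case
  proof (cases cs)
    case (Cons c cs')
    then have "fst c > 0" using Nil.prems(4)[of 0] by simp
    then show ?thesis using Nil.prems(1) Cons by (cases c) simp
  qed simp
next
  case (Cons x bs)
  obtain d m where x: "x = (d, m)" by (cases x)
  have d: "d > 0" using Cons.prems(2)[of 0] x by simp
  then obtain y cs' where cs: "cs = y # cs'" using Cons.prems(1) x by (cases cs) auto
  obtain d' m' where y: "y = (d', m')" by (cases y)
  have d': "d' > 0" using Cons.prems(4)[of 0] cs y by simp
  have start: "takeWhile (\<lambda>c. c = 1) (word l) = []" if "\<And>j. j < length l \<Longrightarrow> fst (l ! j) > 0" for l :: "(nat \<times> nat) list"
  proof (cases l)
    case (Cons z l')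
    then have "fst z > 0" using that[of 0] by simp
    then obtain e k where "z = (Suc e, k)" by (metis gr0_implies_Suc prod.collapse)
    then show ?thesis using Cons by simp
  qed simp
  have bs0: "fst (bs ! j) > 0" if "j < length bs" for j using Cons.prems(2)[of "Suc j"] that by simp
  have cs0: "fst (cs' ! j) > 0" if "j < length cs'" for j using Cons.prems(4)[of "Suc j"] that cs by simp
  have bs1: "snd (bs ! j) > 0" if "j + 1 < length bs" for j using Cons.prems(3)[of "Suc j"] that by simp
  have cs1: "snd (cs' ! j) > 0" if "j + 1 < length cs'" for j using Cons.prems(5)[of "Suc j"] that cs by simp
  have eq: "replicate d 0 @ replicate m 1 @ word bs = replicate d' 0 @ replicate m' 1 @ word cs'"
    using Cons.prems(1) x y cs by simp
  \<comment> \<open>A run of zeros stops at the block border: a one follows unless the whole word is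
    over.\<close>
  have zeros: "takeWhile (\<lambda>c. c = 0) (replicate m 1 @ word l) = []"
    if "\<not> (m = 0 \<and> l \<noteq> [])" for m and l :: "(nat \<times> nat) list"
    using that by (cases m; cases l) auto
  have mbs: "\<not> (m = 0 \<and> bs \<noteq> [])" using Cons.prems(3)[of 0] x by auto
  have mcs: "\<not> (m' = 0 \<and> cs' \<noteq> [])" using Cons.prems(5)[of 0] y cs by auto
  have tw: "length (takeWhile (\<lambda>c. c = z) (replicate k z @ r)) = k + length (takeWhile (\<lambda>c. c = z) r)" for k r and z :: nat
    by (induction k) auto
  have "d = d'"
    using arg_cong[OF eq, of "\<lambda>l. length (takeWhile (\<lambda>c. c = 0) l)"] zeros[OF mbs] zeros[OF mcs] by (simp add: tw)
  then have eq2: "replicate m 1 @ word bs = replicate m' 1 @ word cs'" using eq by simp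
  have "m = m'"
    using arg_cong[OF eq2, of "\<lambda>l. length (takeWhile (\<lambda>c. c = 1) l)"] start[OF bs0] start[OF cs0] by (simp only: tw)
  then have "word bs = word cs'" using eq2 by simp
  then have "bs = cs'" using Cons.IH bs0 cs0 bs1 cs1 by blast
  then show ?case using x y cs \<open>d = d'\<close> \<open>m = m'\<close> by simp
qed

text \<open>Splits off the maximal run of zeros and then the maximal run of ones.\<close>

lemma block_seq_exists:
  "set w \<subseteq> {0, 1} \<Longrightarrow> w = [] \<or> hd w = 0 \<Longrightarrow> \<exists>bs. word bs = w \<and> (\<forall>j < length bs. fst (bs ! j) > 0) \<and>
     (\<forall>j. j + 1 < length bs \<longrightarrow> snd (bs ! j) > 0)"
proof (induction "length w" arbitrary: w rule: less_induct)
  case less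
  show ?case
  proof (cases w)
    case Nil
    then show ?thesis by (intro exI[of _ "[]"]) simp
  next
    case (Cons c w1)
    then have c: "c = 0" using less.prems by simp
    define w2 where "w2 = dropWhile (\<lambda>c. c = 0) w"
    define w3 where "w3 = dropWhile (\<lambda>c. c = 1) w2"
    define d where "d = length (takeWhile (\<lambda>c. c = 0) w)"
    define m where "m = length (takeWhile (\<lambda>c. c = 1) w2)"
    have tk: "takeWhile (\<lambda>c. c = z) v = replicate (length (takeWhile (\<lambda>c. c = z) v)) z" for z :: nat and v
      by (induction v) auto
    have w: "w = replicate d 0 @ w2" "w2 = replicate m 1 @ w3"
      unfolding d_def m_def w2_def w3_def tk[symmetric] by simp_all
    have d: "d > 0" using Cons c by (simp add: d_def)
    have "set w3 \<subseteq> {0, 1}" using less.prems(1) w by auto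
    moreover have "w3 = [] \<or> hd w3 = 0"
    proof (rule ccontr)
      assume n: "\<not> (w3 = [] \<or> hd w3 = 0)"
      then have "hd w3 \<noteq> 1" using hd_dropWhile[of "\<lambda>c. c = 1" w2] by (simp add: w3_def)
      moreover have "hd w3 \<in> {0, 1}" using n \<open>set w3 \<subseteq> {0, 1}\<close> hd_in_set by blast
      ultimately show False using n by simp
    qed
    moreover have "length w3 < length w" using w d by simp
    ultimately obtain bs where bs: "word bs = w3" "\<forall>j < length bs. fst (bs ! j) > 0"
       "\<forall>j. j + 1 < length bs \<longrightarrow> snd (bs ! j) > 0" using less.hyps by blast
    \<comment> \<open>With no ones in between, the rest would start with a zero and prolong the run
      already removed.\<close>
    have "m > 0" if "w3 \<noteq> []"
    proof (rule ccontr)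
      assume "\<not> m > 0"
      then have "w2 = w3" using w by simp
      then have "hd w3 \<noteq> 0" using hd_dropWhile[of "\<lambda>c. c = 0" w] that by (simp add: w2_def)
      then show False using \<open>w3 = [] \<or> hd w3 = 0\<close> that by simp
    qed
    moreover have "w3 \<noteq> []" if "bs \<noteq> []"
    proof (cases bs)
      case (Cons z bs')
      then have "fst z > 0" using bs(2) by auto
      then show ?thesis using bs(1) Cons by (cases z) auto
    qed (use that in simp)
    ultimately have "bs \<noteq> [] \<Longrightarrow> m > 0" by blast
    then show ?thesis
      using bs d w by (intro exI[of _ "(d, m) # bs"]) (auto simp: nth_Cons split: nat.splits)
  qed
qed

text \<open>Multiplication at the bottom leaves the edges between top points in place.\<close>

lemma cell_null_u:
  assumes x: "x \<in> cell_null \<mu>" and i: "1 \<le> i" "i < sum_list \<mu>"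
  shows "x \<odot> u_elem (sum_list \<mu>) i \<in> cell_null \<mu>"
  using x unfolding cell_null_def
proof (induction rule: comb.span_induct_alt)
  case base
  show ?case by (simp add: comb.span_zero)
next
  case (step c x y)
  then obtain D j l where D: "x = of_diagram D"
    "D \<in> diagrams (col_length \<mu> 1 - col_length \<mu> 2) (sum_list \<mu>)" "{Top j, Top l} \<in> D" by blast
  have "diagram_comp D (u_diagram (sum_list \<mu>) i) \<in> {D \<in> diagrams (col_length \<mu> 1 - col_length \<mu> 2) (sum_list \<mu>). \<exists>i j. {Top i, Top j} \<in> D}"
    using diagram_comp_u[OF D(2) i] D(3) by blast
  then have "x \<odot> u_elem (sum_list \<mu>) i \<in> comb.span (of_diagram `
     {D \<in> diagrams (col_length \<mu> 1 - col_length \<mu> 2) (sum_list \<mu>). \<exists>i j. {Top i, Top j} \<in> D})"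
    unfolding D(1) u_elem_def of_diagram_comp by (intro comb.span_scale comb.span_base imageI)
  then show ?case
    using step by (simp add: hom_comp_add_left hom_comp_scale_left comb.span_add comb.span_scale)
qed

lemma cell_act_class:
  assumes x: "x \<in> cell_hom \<mu>" and i: "1 \<le> i" "i < sum_list \<mu>"
  shows "cell_act \<mu> (cell_class \<mu> x) (u_elem (sum_list \<mu>) i) = cell_class \<mu> (x \<odot> u_elem (sum_list \<mu>) i)"
proof -
  let ?u = "u_elem (sum_list \<mu>) i"
  have "(x, x) \<in> cell_rel \<mu>"
    using x by (auto simp: cell_rel_def cell_null_def comb.span_zero)
  then have "x \<in> cell_class \<mu> x" by (simp add: cell_class_def)
  moreover have "cell_class \<mu> (x' \<odot> ?u) = cell_class \<mu> (x \<odot> ?u)" if "x' \<in> cell_class \<mu> x" for x'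
  proof -
    have x': "x' \<in> cell_hom \<mu>" "x - x' \<in> cell_null \<mu>"
      using that by (auto simp: cell_class_def cell_rel_def)
    have "x \<odot> ?u = (x - x') \<odot> ?u + x' \<odot> ?u"
      by (simp flip: hom_comp_add_left)
    then have "x \<odot> ?u - x' \<odot> ?u \<in> cell_null \<mu>"
      using cell_null_u[OF x'(2) i] by simp
    then have "(x \<odot> ?u, x' \<odot> ?u) \<in> cell_rel \<mu>"
      using Hom_u_elem[OF _ i] x x'(1) by (simp add: cell_rel_def)
    then show ?thesis
      unfolding cell_class_def using equiv_class_eq[OF equiv_cell_rel] by metis
  qed
  ultimately show ?thesis
    unfolding cell_act_def by blast
qed

section \<open>Two-column tableaux\<close>

definition col_word :: "tableau \<Rightarrow> nat list" where
  "col_word t = map (col_of t) [1..<length (concat t) + 1]"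

lemma count_map_upt: "count_list (map f [1..<Suc m]) c = card {j \<in> {1..m}. f j = c}"
proof (induction m)
  case (Suc m)
  have "{j \<in> {1..Suc m}. f j = c} = (if f (Suc m) = c then insert (Suc m) {j \<in> {1..m}. f j = c} else {j \<in> {1..m}. f j = c})"
    by (auto simp: le_Suc_eq)
  then show ?case using Suc.IH by (simp del: upt_Suc add: upt_Suc_append)
qed simp

lemma Std_swap_nth: "r < length t \<Longrightarrow> c < length (t ! r) \<Longrightarrow>
    swap_entries i t ! r ! c = Transposition.transpose i (i + 1) (t ! r ! c)"
  by (simp add: swap_entries_def)

context
  fixes n :: nat and \<mu> :: "nat list" and t :: tableau
  assumes mu: "\<mu> \<in> Par2 n" and t: "t \<in> Std \<mu>"
begin

lemma t_lengths: "map length t = \<mu>" "length t = length \<mu>" "\<And>r. r < length t \<Longrightarrow> length (t ! r) = \<mu> ! r"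
  using t by (auto simp: Std_def)

lemma row_length: "r < length t \<Longrightarrow> 1 \<le> length (t ! r) \<and> length (t ! r) \<le> 2"
proof -
  assume r: "r < length t"
  then have "\<mu> ! r \<in> set \<mu>" using t_lengths(2) by simp
  moreover have "0 \<notin> set \<mu>" "\<forall>p\<in>set \<mu>. p \<le> 2" using mu by (simp_all add: Par2_def partitions_of_def)
  ultimately have "\<mu> ! r \<noteq> 0" "\<mu> ! r \<le> 2" by metis+
  then show ?thesis using t_lengths(3)[OF r] by simp
qed

lemma entries: "set (concat t) = {1..n}" "length (concat t) = n" "sum_list \<mu> = n"
proof -
  show s: "sum_list \<mu> = n" using mu by (simp add: Par2_def partitions_of_def)
  then show "set (concat t) = {1..n}" using t by (simp add: Std_def)
  show "length (concat t) = n" using s t_lengths(1) by (simp add: length_concat)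
qed

lemma entry_range: "r < length t \<Longrightarrow> c < length (t ! r) \<Longrightarrow> t ! r ! c \<in> {1..n}"
  using entries(1) by (metis UN_I nth_mem set_concat)

text \<open>Distinctness of the concatenation forbids repeated rows only if they are nonempty, which
  holds because the parts of \<mu> are positive.\<close>

lemma cell_unique:
  assumes "r < length t" "c < length (t ! r)" "r' < length t" "c' < length (t ! r')" "t ! r ! c = t ! r' ! c'"
  shows "r = r' \<and> c = c'"
proof -
  have "distinct (concat t)" using t by (simp add: Std_def)
  then have d: "distinct (removeAll [] t)" "\<And>ys. ys \<in> set t \<Longrightarrow> distinct ys"
    "\<And>ys zs. ys \<in> set t \<Longrightarrow> zs \<in> set t \<Longrightarrow> ys \<noteq> zs \<Longrightarrow> set ys \<inter> set zs = {}"
    unfolding distinct_concat_iff by auto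
  have "[] \<notin> set t" using row_length by (metis in_set_conv_nth list.size(3) not_one_le_zero)
  then have dt: "distinct t" using d(1) by (simp add: removeAll_id)
  have "t ! r = t ! r'"
  proof (rule ccontr)
    assume "t ! r \<noteq> t ! r'"
    then have "set (t ! r) \<inter> set (t ! r') = {}" using d(3) assms by simp
    then show False using assms by (metis disjoint_iff nth_mem)
  qed
  then have "r = r'" using dt assms nth_eq_iff_index_eq by metis
  moreover have "c = c'" using d(2)[of "t ! r"] assms \<open>r = r'\<close> nth_eq_iff_index_eq by (metis nth_mem)
  ultimately show ?thesis by simp
qed

lemma cell_eq:
  assumes "r < length t" "c < length (t ! r)" "t ! r ! c = i"
  shows "row_of t i = r" "col_of t i = c"
proof -
  have "cell_of t i = (r, c)"
    unfolding cell_of_def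
  proof (rule the_equality)
    show "case (r, c) of (r, c) \<Rightarrow> r < length t \<and> c < length (t ! r) \<and> t ! r ! c = i"
      using assms by simp
    fix x assume "case x of (r, c) \<Rightarrow> r < length t \<and> c < length (t ! r) \<and> t ! r ! c = i"
    then obtain a b where x: "x = (a, b)" "a < length t" "b < length (t ! a)" "t ! a ! b = i"
      by (cases x) auto
    then have "r = a \<and> c = b" using assms by (intro cell_unique) simp_all
    then show "x = (r, c)" using x by simp
  qed
  then show "row_of t i = r" "col_of t i = c" by (simp_all add: row_of_def col_of_def)
qed

lemma cellE:
  assumes "i \<in> {1..n}"
  shows "row_of t i < length t" "col_of t i < length (t ! row_of t i)" "t ! row_of t i ! col_of t i = i"
proof -
  have "i \<in> set (concat t)" using assms entries by simp
  then obtain r c where "r < length t" "c < length (t ! r)" "t ! r ! c = i"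
    by (auto simp: in_set_conv_nth)
  then show "row_of t i < length t" "col_of t i < length (t ! row_of t i)" "t ! row_of t i ! col_of t i = i"
    using cell_eq by auto
qed

lemma col_le_1: "i \<in> {1..n} \<Longrightarrow> col_of t i = 0 \<or> col_of t i = 1"
  using cellE[of i] row_length[of "row_of t i"] by linarith

lemma column_mono: "r < r' \<Longrightarrow> r' < length t \<Longrightarrow> c < length (t ! r') \<Longrightarrow>
    c < length (t ! r) \<and> t ! r ! c < t ! r' ! c"
proof (induction r')
  case (Suc k)
  have srt: "sorted_wrt (\<ge>) \<mu>" using mu by (simp add: Par2_def partitions_of_def)
  have "length (t ! Suc k) \<le> length (t ! k)"
    using sorted_wrt_nth_less[OF srt, of k "Suc k"] Suc.prems t_lengths(2,3) by simp
  then have ck: "c < length (t ! k)" using Suc.prems by simp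
  moreover have "t ! k ! c < t ! Suc k ! c"
    using t Suc.prems by (simp add: Std_def)
  ultimately show ?case using Suc by (cases "r = k") auto
qed simp

lemma row_mono:
  assumes "r < length t" "c < c'" "c' < length (t ! r)"
  shows "t ! r ! c < t ! r ! c'"
proof -
  have "sorted_wrt (<) (t ! r)" using t assms by (simp add: Std_def)
  then show ?thesis using assms sorted_wrt_nth_less by metis
qed

text \<open>In a column the smaller entries are exactly those above, so the row of an entry can be
  counted in the column word.\<close>

lemma row_count:
  assumes i: "i \<in> {1..n}"
  shows "card {j \<in> {1..i - 1}. col_of t j = col_of t i} = row_of t i"
proof -
  define r c where "r = row_of t i" and "c = col_of t i"
  have cell: "r < length t" "c < length (t ! r)" "t ! r ! c = i"
    using cellE[OF i] by (simp_all add: r_def c_def)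
  have "bij_betw (\<lambda>r'. t ! r' ! c) {..<r} {j \<in> {1..i - 1}. col_of t j = c}"
  proof (rule bij_betwI')
    fix x y assume "x \<in> {..<r}" "y \<in> {..<r}"
    then have "x < length t" "y < length t" "c < length (t ! x)" "c < length (t ! y)"
      using column_mono[of _ r c] cell by auto
    then show "(t ! x ! c = t ! y ! c) = (x = y)" using cell_unique by blast
  next
    fix x assume "x \<in> {..<r}"
    then have x: "x < length t" "c < length (t ! x)" "t ! x ! c < i"
      using column_mono[of x r c] cell by auto
    then show "t ! x ! c \<in> {j \<in> {1..i - 1}. col_of t j = c}"
      using cell_eq(2)[OF x(1,2) refl] entry_range[OF x(1,2)] by auto
  next
    fix j assume j: "j \<in> {j \<in> {1..i - 1}. col_of t j = c}"
    then have jn: "j \<in> {1..n}" using i by auto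
    define x where "x = row_of t j"
    have x: "x < length t" "c < length (t ! x)" "t ! x ! c = j"
      using cellE[OF jn] j by (auto simp: x_def)
    have "x < r"
    proof (rule ccontr)
      assume "\<not> x < r"
      then have "r = x \<or> r < x" by auto
      then have "i \<le> j" using column_mono[of r x c] x cell by auto
      then show False using j i by auto
    qed
    then show "\<exists>x\<in>{..<r}. j = t ! x ! c" using x by auto
  qed
  from bij_betw_same_card[OF this] show ?thesis by (simp add: r_def c_def)
qed

lemma col_word_prefix: "m \<le> n \<Longrightarrow> take m (col_word t) = map (col_of t) [1..<Suc m]"
  unfolding col_word_def entries(2) by (simp add: take_map take_upt del: upt_Suc)

lemma col_word_length [simp]: "length (col_word t) = n"
  by (simp add: col_word_def entries(2) del: upt_Suc length_concat)

text \<open>Each entry of the second column has a smaller left neighbour, and distinct entries have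
  distinct neighbours.\<close>

lemma col_word_ballot: "ballot (col_word t)"
  unfolding ballot_def
proof (intro conjI allI impI)
  show "set (col_word t) \<subseteq> {0, 1}"
  proof
    fix x assume "x \<in> set (col_word t)"
    moreover have "set (col_word t) = col_of t ` {1..n}"
      unfolding col_word_def entries(2) set_map set_upt by (simp add: atLeastLessThanSuc_atLeastAtMost)
    ultimately obtain j where "j \<in> {1..n}" "x = col_of t j" by blast
    then show "x \<in> {0, 1}" using col_le_1 by auto
  qed
  fix p q assume pq: "col_word t = p @ q"
  define m where "m = length p"
  have m: "m \<le> n" using arg_cong[OF pq, of length] by (simp add: m_def)
  have p: "p = map (col_of t) [1..<Suc m]"
    using col_word_prefix[OF m] pq by (simp add: m_def)
  have "card {j \<in> {1..m}. col_of t j = 1} \<le> card {j \<in> {1..m}. col_of t j = 0}"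
  proof (rule card_inj_on_le)
    let ?f = "\<lambda>j. t ! row_of t j ! 0"
    have cell: "row_of t j < length t" "1 < length (t ! row_of t j)" "t ! row_of t j ! 1 = j"
      if "j \<in> {j \<in> {1..m}. col_of t j = 1}" for j
      using cellE[of j] that m by auto
    show "inj_on ?f {j \<in> {1..m}. col_of t j = 1}"
    proof (rule inj_onI)
      fix j k assume j: "j \<in> {j \<in> {1..m}. col_of t j = 1}" and k: "k \<in> {j \<in> {1..m}. col_of t j = 1}"
        and "?f j = ?f k"
      then have "row_of t j = row_of t k"
        using cell_unique[of "row_of t j" 0 "row_of t k" 0] cell[OF j] cell[OF k] by linarith
      then show "j = k" using cell(3)[OF j] cell(3)[OF k] by simp
    qed
    show "?f ` {j \<in> {1..m}. col_of t j = 1} \<subseteq> {j \<in> {1..m}. col_of t j = 0}"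
    proof (rule image_subsetI)
      fix j assume j: "j \<in> {j \<in> {1..m}. col_of t j = 1}"
      have 0: "0 < length (t ! row_of t j)" using cell(2)[OF j] by linarith
      have "?f j < j" using row_mono[OF cell(1)[OF j] _ cell(2)[OF j], of 0] cell(3)[OF j] by simp
      then show "?f j \<in> {j \<in> {1..m}. col_of t j = 0}"
        using entry_range[OF cell(1)[OF j] 0] cell_eq(2)[OF cell(1)[OF j] 0 refl] j by auto
    qed
  qed simp
  then show "count_list p 1 \<le> count_list p 0"
    unfolding p count_map_upt .
qed

lemma col_word_count: "count_list (col_word t) c = col_length \<mu> (c + 1)"
proof -
  have "count_list (col_word t) c = card {j \<in> {1..n}. col_of t j = c}"
    unfolding col_word_def entries(2) using count_map_upt[of "col_of t" n c] by simp
  also have "\<dots> = card {r. r < length t \<and> c < length (t ! r)}"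
  proof (rule bij_betw_same_card[symmetric], rule bij_betwI')
    fix x y assume "x \<in> {r. r < length t \<and> c < length (t ! r)}" "y \<in> {r. r < length t \<and> c < length (t ! r)}"
    then show "(t ! x ! c = t ! y ! c) = (x = y)" using cell_unique by blast
  next
    fix x assume "x \<in> {r. r < length t \<and> c < length (t ! r)}"
    then show "t ! x ! c \<in> {j \<in> {1..n}. col_of t j = c}"
      using entry_range[of x c] cell_eq(2)[of x c] by simp
  next
    fix j assume "j \<in> {j \<in> {1..n}. col_of t j = c}"
    then show "\<exists>x\<in>{r. r < length t \<and> c < length (t ! r)}. j = t ! x ! c"
      using cellE[of j] by (intro bexI[of _ "row_of t j"]) auto
  qed
  also have "\<dots> = col_length \<mu> (c + 1)"
    unfolding col_length_def length_filter_conv_card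
    using t_lengths by (intro arg_cong[of _ _ card]) (auto simp: Suc_le_eq)
  finally show ?thesis .
qed

lemma col_word_height: "height (col_word t) = col_length \<mu> 1 - col_length \<mu> 2"
  unfolding height_def col_word_count by (simp add: numeral_2_eq_2)

text \<open>The two counts recover the rows of i and i + 1 from the word; through them the contents
  are related to heights.\<close>

lemma col_word_split:
  assumes i: "1 \<le> i" "i < n"
  obtains p q where "length p = i - 1" "p = map (col_of t) [1..<i]"
    "q = map (col_of t) [i + 2..<n + 1]"
    "col_word t = p @ [col_of t i, col_of t (i + 1)] @ q"
    "count_list p (col_of t i) = row_of t i"
    "count_list (p @ [col_of t i]) (col_of t (i + 1)) = row_of t (i + 1)"
proof -
  let ?p = "map (col_of t) [1..<i]" and ?q = "map (col_of t) [i + 2..<n + 1]"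
  have "[1..<n + 1] = [1..<i] @ [i..<n + 1]"
    using i upt_add_eq_append[of 1 i "n + 1 - i"] by simp
  also have "[i..<n + 1] = i # (i + 1) # [i + 2..<n + 1]"
    using i by (simp add: upt_conv_Cons del: upt_Suc)
  finally have w: "col_word t = ?p @ [col_of t i, col_of t (i + 1)] @ ?q"
    by (simp add: col_word_def entries(2) del: upt_Suc length_concat)
  have "count_list ?p (col_of t i) = row_of t i"
    using count_map_upt[of "col_of t" "i - 1" "col_of t i"] row_count[of i] i by simp
  moreover have "?p @ [col_of t i] = map (col_of t) [1..<Suc i]"
    using i by simp
  then have "count_list (?p @ [col_of t i]) (col_of t (i + 1)) = row_of t (i + 1)"
    using count_map_upt[of "col_of t" i "col_of t (i + 1)"] row_count[of "i + 1"] i by (simp del: upt_Suc)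
  ultimately show thesis using that[OF _ refl refl w] i by simp
qed

end

lemma swap_cells:
  assumes mu: "\<mu> \<in> Par2 n" and t: "t \<in> Std \<mu>" and s: "swap_entries i t \<in> Std \<mu>"
    and i: "1 \<le> i" "i < n" and j: "j \<in> {1..n}"
  shows "row_of (swap_entries i t) j = row_of t (Transposition.transpose i (i + 1) j)"
    "col_of (swap_entries i t) j = col_of t (Transposition.transpose i (i + 1) j)"
proof -
  let ?j = "Transposition.transpose i (i + 1) j"
  have "?j \<in> {1..n}" using i j by (auto simp: Transposition.transpose_def)
  note c = cellE[OF mu t this]
  have "swap_entries i t ! row_of t ?j ! col_of t ?j = j"
    using Std_swap_nth[OF c(1,2)] c(3) by simp
  moreover have "row_of t ?j < length (swap_entries i t)"
    "col_of t ?j < length (swap_entries i t ! row_of t ?j)"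
    using c by (simp_all add: swap_entries_def)
  ultimately show "row_of (swap_entries i t) j = row_of t ?j" "col_of (swap_entries i t) j = col_of t ?j"
    using cell_eq[OF mu s] by blast+
qed

text \<open>Within a column the order of i and i + 1 is forced, and the exchange would reverse
  it.\<close>

lemma swap_col_neq:
  assumes mu: "\<mu> \<in> Par2 n" and t: "t \<in> Std \<mu>" and s: "swap_entries i t \<in> Std \<mu>"
    and i: "1 \<le> i" "i < n"
  shows "col_of t i \<noteq> col_of t (i + 1)"
proof
  assume eq: "col_of t i = col_of t (i + 1)"
  have I: "i \<in> {1..n}" "i + 1 \<in> {1..n}" using i by auto
  have key: "row_of u i < row_of u (i + 1)" if u: "u \<in> Std \<mu>" and c: "col_of u i = col_of u (i + 1)" for u
  proof (rule ccontr)
    assume "\<not> row_of u i < row_of u (i + 1)"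
    then have "row_of u i = row_of u (i + 1) \<or> row_of u (i + 1) < row_of u i" by auto
    then show False
      using cellE[OF mu u I(1)] cellE[OF mu u I(2)] c
        column_mono[OF mu u, of "row_of u (i + 1)" "row_of u i" "col_of u i"] by auto
  qed
  have "row_of t i < row_of t (i + 1)" by (rule key[OF t eq])
  moreover have "row_of (swap_entries i t) i < row_of (swap_entries i t) (i + 1)"
    using key[OF s] swap_cells[OF mu t s i] I eq by simp
  then have "row_of t (i + 1) < row_of t i"
    using swap_cells[OF mu t s i] I by simp
  ultimately show False by simp
qed

text \<open>\<open>restricted_shape\<close> discards empty rows. If the first k rows are nonempty,
  they keep their places.\<close>

lemma sum_take_restricted:
  assumes "k \<le> length t" "\<And>r. r < k \<Longrightarrow> length (filter (\<lambda>x. x \<le> m) (t ! r)) \<noteq> 0"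
  shows "sum_list (take k (restricted_shape t m)) = (\<Sum>r<k. length (filter (\<lambda>x. x \<le> m) (t ! r)))"
proof -
  let ?f = "\<lambda>row. length (filter (\<lambda>x. x \<le> m) row)"
  have "map ?f t = map ?f (take k t) @ map ?f (drop k t)"
    by (metis append_take_drop_id map_append)
  moreover have "filter (\<lambda>p. p \<noteq> 0) (map ?f (take k t)) = map ?f (take k t)"
  proof (rule filter_True, rule ballI)
    fix x assume "x \<in> set (map ?f (take k t))"
    then obtain r where "r < k" "x = ?f (t ! r)"
      by (auto simp: in_set_conv_nth)
    then show "x \<noteq> 0" using assms(2) by simp
  qed
  ultimately have "take k (restricted_shape t m) = map ?f (take k t)"
    using assms(1) by (simp add: restricted_shape_def)
  then show ?thesis
    using assms(1) by (simp add: sum_list_sum_nth atLeast0LessThan)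
qed

text \<open>If i were in the second column, the exchange would take one box from the first rows of
  the shape of the entries up to i, contradicting dominance.\<close>

lemma swap_dominated:
  assumes mu: "\<mu> \<in> Par2 n" and t: "t \<in> Std \<mu>" and s: "swap_entries i t \<in> Std \<mu>"
    and i: "1 \<le> i" "i < n" and dom: "t \<unlhd> swap_entries i t"
  shows "col_of t i = 0" "col_of t (i + 1) = 1"
proof -
  have I: "i \<in> {1..n}" "i + 1 \<in> {1..n}" using i by auto
  have False if c: "col_of t i = 1"
  proof -
    define r0 where "r0 = row_of t i"
    have cell: "r0 < length t" "1 < length (t ! r0)" "t ! r0 ! 1 = i"
      using cellE[OF mu t I(1)] c by (simp_all add: r0_def)
    \<comment> \<open>Down to row r0 both columns are filled with entries up to i, and i itself
      occurs only at the very end, so the exchange lowers the count by one.\<close>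
    have row: "\<exists>x y. t ! r = [x, y] \<and> x < y \<and> y \<le> i \<and> (r < r0 \<longrightarrow> y < i)" if r: "r \<le> r0" for r
    proof -
      have r': "r < length t" "1 < length (t ! r)" "t ! r ! 1 \<le> i" "r < r0 \<longrightarrow> t ! r ! 1 < i"
        using column_mono[OF mu t, of r r0 1] cell r by (cases "r = r0"; simp)+
      then have "length (t ! r) = 2" using row_length[OF mu t r'(1)] by simp
      then obtain x y where "t ! r = [x, y]" by (auto simp: length_Suc_conv numeral_2_eq_2)
      then show ?thesis using row_mono[OF mu t r'(1) _ r'(2), of 0] r' by simp
    qed
    have "sum_list (take (Suc r0) (restricted_shape t i)) = (\<Sum>r<Suc r0. 2)"
    proof -
      have *: "length (filter (\<lambda>x. x \<le> i) (t ! r)) = 2" if "r < Suc r0" for r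
      proof -
        from row[of r] \<open>r < Suc r0\<close> obtain x y where "t ! r = [x, y]" "x < y" "y \<le> i" by auto
        then show ?thesis by simp
      qed
      show ?thesis
        using * cell(1) by (subst sum_take_restricted) (simp_all add: *)
    qed
    moreover have "sum_list (take (Suc r0) (restricted_shape (swap_entries i t) i)) = (\<Sum>r<Suc r0. if r = r0 then 1 else 2)"
    proof -
      have *: "length (filter (\<lambda>x. x \<le> i) (swap_entries i t ! r)) = (if r = r0 then 1 else 2)" if "r < Suc r0" for r
      proof -
        from row[of r] \<open>r < Suc r0\<close>
        obtain x y where xy: "t ! r = [x, y]" "x < y" "y \<le> i" "r < r0 \<longrightarrow> y < i" by auto
        have "swap_entries i t ! r = [Transposition.transpose i (i + 1) x, Transposition.transpose i (i + 1) y]"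
          using that cell(1) xy(1) by (simp add: swap_entries_def)
        moreover have "r = r0 \<Longrightarrow> y = i" using cell(3) xy(1) by simp
        ultimately show ?thesis
          using xy that by (cases "r = r0") (auto simp: Transposition.transpose_def)
      qed
      show ?thesis
        using * cell(1) by (subst sum_take_restricted) (simp_all add: * swap_entries_def)
    qed
    moreover have "sum_list (take (Suc r0) (restricted_shape t i)) \<le> sum_list (take (Suc r0) (restricted_shape (swap_entries i t) i))"
      using dom by (simp add: tab_dominated_def dominated_def)
    moreover have "(\<Sum>r<r0. if r = r0 then 1 else 2) = (\<Sum>r<r0. 2 :: nat)"
      by (intro sum.cong) auto
    ultimately show False by simp
  qed
  then show "col_of t i = 0" using col_le_1[OF mu t I(1)] by auto
  then show "col_of t (i + 1) = 1"
    using swap_col_neq[OF mu t s i] col_le_1[OF mu t I(2)] by auto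
qed

section \<open>The action on the cell module\<close>

definition f_comb :: "tableau \<Rightarrow> comb" where
  "f_comb t = gdiag (block_seq t) (length (block_seq t))"

lemma f_elem_eq: "f_elem \<mu> t = cell_class \<mu> (f_comb t)"
  by (simp add: f_elem_def f_comb_def)

lemma is_block_seq_iff: "is_block_seq t bs \<longleftrightarrow> word bs = col_word t \<and>
    (\<forall>j < length bs. fst (bs ! j) > 0) \<and> (\<forall>j. j + 1 < length bs \<longrightarrow> snd (bs ! j) > 0)"
  by (simp only: is_block_seq_def word_def col_word_def)

text \<open>The description \<open>block_seq\<close> is resolved by the decomposition into runs,
  which exists because a ballot word cannot start with 1.\<close>

lemma f_comb_properties:
  assumes mu: "\<mu> \<in> Par2 n" and t: "t \<in> Std \<mu>"
  shows "f_comb t \<in> cell_hom \<mu>"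
    "mat_of (col_length \<mu> 1 - col_length \<mu> 2) (sum_list \<mu>) (f_comb t) = word_mat (col_word t)"
proof -
  have bal: "ballot (col_word t)" by (rule col_word_ballot[OF mu t])
  have "col_word t = [] \<or> hd (col_word t) = 0"
  proof (cases "col_word t")
    case (Cons c w)
    then have "count_list [c] 1 \<le> count_list [c] 0" "c \<in> {0, 1}"
      using bal unfolding ballot_def by (metis append_Cons append_Nil, auto)
    then show ?thesis using Cons by auto
  qed simp
  then obtain bs where bs: "is_block_seq t bs"
    using block_seq_exists[of "col_word t"] bal unfolding is_block_seq_iff ballot_def by blast
  have "block_seq t = bs"
    unfolding block_seq_def
  proof (rule the_equality)
    show "is_block_seq t bs" by (rule bs)
    fix cs assume "is_block_seq t cs"
    then show "cs = bs"
      using bs unfolding is_block_seq_iff by (intro is_block_seq_unique) auto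
  qed
  moreover have w: "word bs = col_word t" and pos: "\<And>j. j < length bs \<Longrightarrow> fst (bs ! j) > 0"
    using bs by (simp_all add: is_block_seq_iff)
  ultimately have "f_comb t \<in> Hom (height (col_word t)) (length (col_word t)) \<and>
      mat_of (height (col_word t)) (length (col_word t)) (f_comb t) = word_mat (col_word t)"
    using gdiag_word_mat[OF pos, of "length bs"] bal by (simp add: f_comb_def)
  then show "f_comb t \<in> cell_hom \<mu>"
    "mat_of (col_length \<mu> 1 - col_length \<mu> 2) (sum_list \<mu>) (f_comb t) = word_mat (col_word t)"
    unfolding col_word_height[OF mu t] col_word_length[OF mu t] entries(3)[OF mu t] by blast+
qed

lemma cell_class_lcomb:
  assumes "x \<in> cell_hom \<mu>" "y \<in> cell_hom \<mu>"
  shows "cell_class \<mu> (comb_scale a x + comb_scale b y) =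
    cell_add \<mu> (cell_scale \<mu> a (cell_class \<mu> x)) (cell_scale \<mu> b (cell_class \<mu> y))"
  using assms by (simp add: cell_scale_class cell_add_class Hom_scale)

text \<open>Faithfulness lifts the matrix identity to \<open>Hom\<close>; only then are classes
  taken.\<close>

lemma f_comb_u:
  assumes mu: "\<mu> \<in> Par2 n" and t: "t \<in> Std \<mu>" "t' \<in> Std \<mu>" "t'' \<in> Std \<mu>" and i: "1 \<le> i" "i < n"
    and eq: "mmul n (word_mat (col_word t)) (u_mat n i) = lcomb a (word_mat (col_word t')) b (word_mat (col_word t''))"
  shows "cell_act \<mu> (f_elem \<mu> t) (u_elem n i) =
    cell_add \<mu> (cell_scale \<mu> a (f_elem \<mu> t')) (cell_scale \<mu> b (f_elem \<mu> t''))"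
proof -
  have n: "sum_list \<mu> = n" by (rule entries(3)[OF mu t(1)])
  note f = f_comb_properties[OF mu t(1), unfolded n] and f' = f_comb_properties[OF mu t(2), unfolded n]
    and f'' = f_comb_properties[OF mu t(3), unfolded n]
  have "f_comb t \<odot> u_elem n i = comb_scale a (f_comb t') + comb_scale b (f_comb t'')"
  proof (rule mat_of_inj)
    show "f_comb t \<odot> u_elem n i \<in> Hom (col_length \<mu> 1 - col_length \<mu> 2) n"
      by (rule Hom_u_elem[OF f(1) i])
    show "comb_scale a (f_comb t') + comb_scale b (f_comb t'') \<in> Hom (col_length \<mu> 1 - col_length \<mu> 2) n"
      by (rule Hom_add[OF Hom_scale[OF f'(1)] Hom_scale[OF f''(1)]])
    show "mat_of (col_length \<mu> 1 - col_length \<mu> 2) n (f_comb t \<odot> u_elem n i) =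
        mat_of (col_length \<mu> 1 - col_length \<mu> 2) n (comb_scale a (f_comb t') + comb_scale b (f_comb t''))"
      unfolding mat_of_hom_comp[OF f(1) u_elem_in[OF i]] mat_of_u[OF i] f(2) eq mat_of_lcomb f'(2) f''(2) ..
  qed
  then show ?thesis
    unfolding f_elem_eq using cell_act_class[of "f_comb t" \<mu> i] f(1) f'(1) f''(1) i n
    by (simp add: cell_class_lcomb)
qed

lemma lcomb_zero: "lcomb 0 A 0 B = zero_mat"
  by (simp_all add: lcomb_def)

lemma cell_scale_zero: "x \<in> cell_hom \<mu> \<Longrightarrow> cell_scale \<mu> 0 (cell_class \<mu> x) = cell_zero \<mu>"
  by (simp add: cell_scale_class cell_zero_def)

theorem theorem3p3:
  fixes n i :: nat and \<mu> :: "nat list" and t :: tableau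
  assumes "\<mu> \<in> Par2 n" and "t \<in> Std \<mu>" and "1 \<le> i" and "i < n"
  shows
    "(swap_entries i t \<in> Std \<mu> \<and> t \<unlhd> swap_entries i t \<longrightarrow>
       (let td = t; tu = swap_entries i t; r = rat_of_int (content tu i - content td i) in
          cell_act \<mu> (f_elem \<mu> td) (u_elem n i) =
            cell_add \<mu> (cell_scale \<mu> ((r + 1) / r) (f_elem \<mu> td))
                       (cell_scale \<mu> ((r^2 - 1) / r^2) (f_elem \<mu> tu)) \<and>
          cell_act \<mu> (f_elem \<mu> tu) (u_elem n i) =
            cell_add \<mu> (cell_scale \<mu> ((r - 1) / r) (f_elem \<mu> tu)) (f_elem \<mu> td))) \<and>
     (swap_entries i t \<notin> Std \<mu> \<longrightarrow>
       (col_of t i = col_of t (i + 1) \<longrightarrow>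
          cell_act \<mu> (f_elem \<mu> t) (u_elem n i) = cell_zero \<mu>) \<and>
       (row_of t i = row_of t (i + 1) \<longrightarrow>
          cell_act \<mu> (f_elem \<mu> t) (u_elem n i) = cell_scale \<mu> 2 (f_elem \<mu> t)))"
proof -
  note mu = assms(1) and t = assms(2) and i = assms(3,4)
  have I: "i \<in> {1..n}" "i + 1 \<in> {1..n}" using i by auto
  obtain p q where p: "length p = i - 1" "p = map (col_of t) [1..<i]"
    and q: "q = map (col_of t) [i + 2..<n + 1]"
    and w: "col_word t = p @ [col_of t i, col_of t (i + 1)] @ q"
    and ri: "count_list p (col_of t i) = row_of t i"
    and ri': "count_list (p @ [col_of t i]) (col_of t (i + 1)) = row_of t (i + 1)"
    by (rule col_word_split[OF mu t i])
  have bal: "ballot (col_word t)" by (rule col_word_ballot[OF mu t])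
  then have bp: "ballot p" and bp2: "ballot (p @ [col_of t i, col_of t (i + 1)])"
    unfolding w by (metis ballot_append append_assoc)+
  have q01: "set q \<subseteq> {0, 1}" using bal unfolding w ballot_def by simp
  have len: "length p + 2 = i + 1" using p i by simp
  have ip: "i = Suc (length p)" using len by simp
  have nw: "n = length (p @ [c, d] @ q)" for c d
    using col_word_length[OF mu t] unfolding w by simp
  \<comment> \<open>Reduces each case to the prefix p followed by two letters; the tail q is
    restored by \<open>word_mat_u_mat_append\<close>.\<close>
  have lift: "mmul n (word_mat (p @ [c, d] @ q)) (u_mat n i) = lcomb x (word_mat (p @ v @ q)) y (word_mat (p @ v' @ q))"
    if "ballot (p @ [c, d])" "ballot (p @ v)" "ballot (p @ v')"
      "height (p @ v) = height (p @ [c, d])" "height (p @ v') = height (p @ [c, d])"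
      "mmul (Suc (Suc (length p))) (word_mat (p @ [c, d])) (u_mat (Suc (Suc (length p))) (Suc (length p))) =
         lcomb x (word_mat (p @ v)) y (word_mat (p @ v'))" for c d v v' x y
    using word_mat_u_mat_append[OF that(1-5), of i q x y] that(6) q01 i ip nw[of c d] by simp
  show ?thesis
  proof (intro conjI impI)
    assume s: "swap_entries i t \<in> Std \<mu> \<and> t \<unlhd> swap_entries i t"
    let ?u = "swap_entries i t"
    have su: "?u \<in> Std \<mu>" using s by simp
    have c: "col_of t i = 0" "col_of t (i + 1) = 1"
      using swap_dominated[OF mu t su i] s by simp_all
    have cu: "col_of ?u i = 1" "row_of ?u i = row_of t (i + 1)"
      using swap_cells[OF mu t su i I(1)] c by simp_all
    have "col_word ?u = p @ [1, 0] @ q"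
    proof -
      obtain p' q' where p': "p' = map (col_of ?u) [1..<i]" and q': "q' = map (col_of ?u) [i + 2..<n + 1]"
        and w': "col_word ?u = p' @ [col_of ?u i, col_of ?u (i + 1)] @ q'"
        by (rule col_word_split[OF mu su i])
      have "col_of ?u j = col_of t j" if "j \<in> {1..n}" "j \<noteq> i" "j \<noteq> i + 1" for j
        using swap_cells(2)[OF mu t su i that(1)] that by (simp add: Transposition.transpose_def)
      then have "p' = p" "q' = q"
        unfolding p' q' p(2) q using i by (auto simp del: upt_Suc)
      moreover have "col_of ?u (i + 1) = 0"
        using swap_cells(2)[OF mu t su i I(2)] c by simp
      ultimately show ?thesis using w' cu by simp
    qed
    note wu = this
    have wt: "col_word t = p @ [0, 1] @ q" using w c by simp
    have "ballot (col_word ?u)" by (rule col_word_ballot[OF mu su])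
    then have bu: "ballot (p @ [1, 0])" "ballot (p @ [1])"
      unfolding wu by (metis ballot_append append_assoc append_Cons append_Nil)+
    have bt: "ballot (p @ [0, 1])" using bp2 c by simp
    \<comment> \<open>In the exchanged tableau the prefix p is followed by a 1, which needs a strand
      to bend.\<close>
    have k: "0 < height p" using ballot_count[OF bu(2)] by (simp add: height_def)
    have h: "height (p @ [1, 0]) = height (p @ [0, 1])" by (simp add: height_def)
    define r where "r = rat_of_int (content ?u i - content t i)"
    \<comment> \<open>The contents of i are 1 - \<open>row_of t (i + 1)\<close> after the exchange
      and -\<open>row_of t i\<close> before it; their difference is one more than the height of
      p.\<close>
    have "int (row_of t i) - int (row_of t (i + 1)) = int (height p)"
      using ri ri' c k by (simp add: height_def)
    then have r: "r = rat_of_nat (Suc (height p))"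
      unfolding r_def content_def cu c by simp
    have A: "mmul n (word_mat (col_word t)) (u_mat n i) =
        lcomb ((r + 1) / r) (word_mat (col_word t)) ((r^2 - 1) / r^2) (word_mat (col_word ?u))"
      unfolding wt wu by (rule lift) (use bt bu h word_mat_swap(1)[OF bp k] r in simp_all)
    have B: "mmul n (word_mat (col_word ?u)) (u_mat n i) =
        lcomb ((r - 1) / r) (word_mat (col_word ?u)) 1 (word_mat (col_word t))"
      unfolding wt wu by (rule lift) (use bt bu h word_mat_swap(2)[OF bp k] r in simp_all)
    \<comment> \<open>In (b) the element f_d carries no explicit coefficient, while
      \<open>f_comb_u\<close> produces a scaling by 1.\<close>
    have "cell_scale \<mu> 1 (f_elem \<mu> t) = f_elem \<mu> t"
      unfolding f_elem_eq using cell_scale_class[OF f_comb_properties(1)[OF mu t]] by simp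
    then show "let td = t; tu = swap_entries i t; r = rat_of_int (content tu i - content td i) in
          cell_act \<mu> (f_elem \<mu> td) (u_elem n i) =
            cell_add \<mu> (cell_scale \<mu> ((r + 1) / r) (f_elem \<mu> td))
                       (cell_scale \<mu> ((r^2 - 1) / r^2) (f_elem \<mu> tu)) \<and>
          cell_act \<mu> (f_elem \<mu> tu) (u_elem n i) =
            cell_add \<mu> (cell_scale \<mu> ((r - 1) / r) (f_elem \<mu> tu)) (f_elem \<mu> td)"
      using f_comb_u[OF mu t t su i A] f_comb_u[OF mu su su t i B]
      unfolding Let_def r_def[symmetric] by simp
  next
    assume c: "col_of t i = col_of t (i + 1)"
    have "mmul (Suc (Suc (length p))) (word_mat (p @ [col_of t i, col_of t (i + 1)]))
        (u_mat (Suc (Suc (length p))) (Suc (length p))) = zero_mat"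
    proof (cases "col_of t i = 0")
      case True
      then show ?thesis using word_mat_same_0[OF bp] c by simp
    next
      case False
      then have "col_of t i = 1" using col_le_1[OF mu t I(1)] by simp
      then show ?thesis using word_mat_same_1[OF bp] bp2 c by simp
    qed
    \<comment> \<open>Zero is presented as a combination with zero coefficients, to fit
      \<open>lift\<close> and \<open>f_comb_u\<close>.\<close>
    then have "mmul n (word_mat (col_word t)) (u_mat n i) = lcomb 0 (word_mat (col_word t)) 0 (word_mat (col_word t))"
      unfolding w by (intro lift bp2 refl) (simp add: lcomb_zero)
    from f_comb_u[OF mu t t t i this]
    show "cell_act \<mu> (f_elem \<mu> t) (u_elem n i) = cell_zero \<mu>"
      unfolding f_elem_eq cell_scale_zero[OF f_comb_properties(1)[OF mu t]]
      by (simp add: cell_zero_def cell_add_class)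
  next
    assume r: "row_of t i = row_of t (i + 1)"
    have "col_of t i < col_of t (i + 1)"
    proof (rule ccontr)
      assume "\<not> col_of t i < col_of t (i + 1)"
      then have "col_of t i = col_of t (i + 1) \<or> col_of t (i + 1) < col_of t i" by auto
      then show False
        using cellE[OF mu t I(1)] cellE[OF mu t I(2)] r
          row_mono[OF mu t, of "row_of t i" "col_of t (i + 1)" "col_of t i"] by auto
    qed
    then have c: "col_of t i = 0" "col_of t (i + 1) = 1"
      using col_le_1[OF mu t I(1)] col_le_1[OF mu t I(2)] by auto
    \<comment> \<open>Equal rows mean that p contains as many zeros as ones.\<close>
    have "height p = 0" using ri ri' r c by (simp add: height_def)
    then have "mmul n (word_mat (col_word t)) (u_mat n i) = lcomb 2 (word_mat (col_word t)) 0 (word_mat (col_word t))"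
      unfolding w using word_mat_row[OF bp] c bp2 by (intro lift bp2 refl) simp
    from f_comb_u[OF mu t t t i this]
    show "cell_act \<mu> (f_elem \<mu> t) (u_elem n i) = cell_scale \<mu> 2 (f_elem \<mu> t)"
      using f_comb_properties(1)[OF mu t]
      unfolding f_elem_eq by (simp add: cell_scale_class cell_add_class Hom_scale)
  qed
qed

end
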